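(* Let $k\in\mathbb{N}$ be fixed. Let $(g_{i,j})_{1\le i\le k,\ j\ge 1}$ be a jointly Gaussian family of $N(0,1)$ random variables on a probability space such that ${\rm E}[g_{i,j}g_{i,j'}]=0$ whenever $j\neq j'$ (so for each fixed $i$, the $g_{i,1},g_{i,2},\ldots$ are independent). For $i=1,\ldots,k$ let $$F_i=\sum_{j=1}^\infty \lambda_{i,j}(g_{i,j}^2-1),\qquad \lambda_{i,j}\in\mathbb{R},\ \sum_{j=1}^\infty\lambda_{i,j}^2<\infty,$$ and $F=(F_1,\ldots,F_k)$. Suppose the law of $F$ is not absolutely continuous with respect to Lebesgue measure on $\mathbb{R}^k$. Then there exist $k-1$ independent $N(0,1)$ random variables $\eta_1,\ldots,\eta_{k-1}$ (on the same probability space) and real numbers $a_1,\ldots,a_k,b_1,\ldots,b_{k-1}$ with $(a_1,\ldots,a_k)\neq(0,\ldots,0)$ such that almost surely $$a_1F_1+\cdots+a_kF_k=b_1(\eta_1^2-1)+\cdots+b_{k-1}(\eta_{k-1}^2-1).$$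
   Context: The series defining $F_i$ converge in $L^2$ and almost surely. For $k=1$ the right-hand side is the empty sum $0$. *)

theory Defs
  imports "HOL-Probability.Probability"
begin

definition gaussian_rv :: "'a measure \<Rightarrow> ('a \<Rightarrow> real) \<Rightarrow> bool" where
  "gaussian_rv M X \<longleftrightarrow> X \<in> borel_measurable M \<and>
     ((\<exists>c. AE x in M. X x = c) \<or>
      (\<exists>\<mu> \<sigma>. \<sigma> > 0 \<and> distributed M lborel X (normal_density \<mu> \<sigma>)))"

definition jointly_gaussian :: "'a measure \<Rightarrow> ('i \<Rightarrow> 'a \<Rightarrow> real) \<Rightarrow> bool" where
  "jointly_gaussian M X \<longleftrightarrow>
     (\<forall>S c. finite S \<longrightarrow> gaussian_rv M (\<lambda>x. \<Sum>p\<in>S. c p * X p x))"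

end

theory Submission
  imports Defs "HOL-Computational_Algebra.Polynomial"
begin

text \<open>
  Let \<open>V\<close> be the closed linear span of the \<open>g i j\<close> in \<open>L\<^sup>2\<close>; all its elements are centered Gaussian, and
  orthogonal families in \<open>V\<close> are independent. The variable \<open>F i\<close> is attached to the symmetric
  Hilbert-Schmidt operator \<open>A i X = \<Sum>j. lam i j * \<langle>X, g i j\<rangle> * g i j\<close> on \<open>V\<close>.

  If \<open>A i X\<close> (\<open>i\<close> ranging over the index type) are linearly independent for some \<open>X\<close>, let \<open>e\<close> be an
  orthonormal basis of their span. Conditionally on the part of the \<open>g i j\<close> orthogonal to \<open>e\<close>, the vector
  \<open>F\<close> is a quadratic map of the standard Gaussian vector \<open>e\<close>, whose Jacobian matrix is \<open>2 * A i (e l)\<close>.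
  Its determinant does not vanish almost surely: along the direction \<open>X\<close> it is a nonzero polynomial in one variable.
  By the inverse function theorem preimages of null sets are null, so \<open>F\<close> has an absolutely continuous law.

  Otherwise choose \<open>X\<close> for which the span of the \<open>A i X\<close> has maximal dimension \<open>r\<close>, less than the number
  \<open>k\<close> of indices, and \<open>a \<noteq> 0\<close> with \<open>(\<Sum>i. a i * A i X) = 0\<close>. Perturbing \<open>X\<close> to \<open>X + t Y\<close> shows
  that \<open>\<Sum>i. a i * A i Y\<close> lies in that span for every \<open>Y\<close>. So \<open>\<Sum>i. a i * A i\<close> has rank at most \<open>k - 1\<close>,
  and diagonalizing it gives the \<open>\<eta> m\<close> and \<open>b m\<close>.
\<close>

section \<open>Square-integrable functions\<close>

text \<open>Each row of \<open>g\<close> is orthonormal, but different rows may be correlated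
  arbitrarily, so the \<open>F i\<close> cannot be diagonalized together. Hence the detour through
  one common space \<open>V\<close>, where all \<open>F i\<close> are compared by their bilinear
  forms \<open>q i\<close>. Convergence in mean square alone would not suffice: the decomposition of
  \<open>F i\<close> along \<open>e\<close> is carried out at a fixed sample point, so the series
  for \<open>F i\<close> and \<open>A i (e l)\<close> must converge there. This is why Kolmogorov's
  inequality enters. Conditioning is replaced by an identity between a joint law and a product
  measure, followed by Fubini for null sets. That identity has to allow infinite families, because
  the orthogonal parts of all \<open>g i j\<close> are frozen at once. The orthonormal system is
  padded to exactly as many vectors as there are indices, even if the \<open>A i X\<close> are
  dependent. This keeps the coefficient matrix of the \<open>A i X\<close> square: invertible in the
  regular case, and otherwise with a right null vector matching the left null vector
  \<open>a\<close>. The right one supplies the eigenvalue 0 that is dropped.\<close>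

definition L2 :: "'a measure \<Rightarrow> ('a \<Rightarrow> real) set" where
  "L2 M = {X \<in> borel_measurable M. integrable M (\<lambda>x. (X x)\<^sup>2)}"

text \<open>Only a semi-inner product, since functions are not identified modulo null sets:
  \<open>ip M X X = 0\<close> means that \<open>X\<close> vanishes almost surely.\<close>

definition ip :: "'a measure \<Rightarrow> ('a \<Rightarrow> real) \<Rightarrow> ('a \<Rightarrow> real) \<Rightarrow> real" where
  "ip M X Y = (LINT x|M. X x * Y x)"

lemma L2_measurable[measurable_dest]: "X \<in> L2 M \<Longrightarrow> X \<in> borel_measurable M"
  and L2_integrable_sq: "X \<in> L2 M \<Longrightarrow> integrable M (\<lambda>x. (X x)\<^sup>2)"
  by (auto simp: L2_def)

lemma L2_integrable_mult:
  assumes "X \<in> L2 M" "Y \<in> L2 M"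
  shows "integrable M (\<lambda>x. X x * Y x)"
proof (rule Bochner_Integration.integrable_bound)
  show "integrable M (\<lambda>x. (X x)\<^sup>2 + (Y x)\<^sup>2)"
    using assms by (auto simp: L2_integrable_sq)
  have "\<bar>a * b\<bar> \<le> a\<^sup>2 + b\<^sup>2" for a b :: real
  proof -
    have "2 * \<bar>a * b\<bar> \<le> a\<^sup>2 + b\<^sup>2"
      using sum_squares_bound[of "\<bar>a\<bar>" "\<bar>b\<bar>"] by (simp add: abs_mult)
    then show ?thesis using abs_ge_zero[of "a * b"] by linarith
  qed
  then show "AE x in M. norm (X x * Y x) \<le> norm ((X x)\<^sup>2 + (Y x)\<^sup>2)"
    by auto
qed (use assms in \<open>auto simp: L2_def\<close>)

lemma L2_add:
  assumes "X \<in> L2 M" "Y \<in> L2 M"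
  shows "(\<lambda>x. X x + Y x) \<in> L2 M"
proof -
  have "(\<lambda>x. (X x + Y x)\<^sup>2) = (\<lambda>x. (X x)\<^sup>2 + (Y x)\<^sup>2 + 2 * (X x * Y x))"
    by (simp add: power2_sum algebra_simps)
  with assms L2_integrable_mult[OF assms] show ?thesis
    unfolding L2_def by auto
qed

lemma L2_cmult: "X \<in> L2 M \<Longrightarrow> (\<lambda>x. c * X x) \<in> L2 M"
  unfolding L2_def by (auto simp: power_mult_distrib)

lemma L2_zero[simp]: "(\<lambda>x. 0) \<in> L2 M"
  unfolding L2_def by auto

lemma L2_diff: "X \<in> L2 M \<Longrightarrow> Y \<in> L2 M \<Longrightarrow> (\<lambda>x. X x - Y x) \<in> L2 M"
  using L2_add[of X M "\<lambda>x. (-1) * Y x"] L2_cmult[of Y M "-1"] by simp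

lemma L2_sum: "(\<And>i. i \<in> A \<Longrightarrow> X i \<in> L2 M) \<Longrightarrow> (\<lambda>x. \<Sum>i\<in>A. X i x) \<in> L2 M"
  by (induction A rule: infinite_finite_induct) (auto intro: L2_add)

lemmas L2_intros = L2_add L2_cmult L2_diff L2_sum L2_zero

lemma ip_commute: "ip M X Y = ip M Y X"
  by (simp add: ip_def mult.commute)

lemma ip_nonneg[simp]: "ip M X X \<ge> 0"
  unfolding ip_def by (intro Bochner_Integration.integral_nonneg) simp

lemma ip_add_left: "X \<in> L2 M \<Longrightarrow> Y \<in> L2 M \<Longrightarrow> Z \<in> L2 M \<Longrightarrow> ip M (\<lambda>x. X x + Y x) Z = ip M X Z + ip M Y Z"
  unfolding ip_def by (simp add: distrib_right L2_integrable_mult)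

lemma ip_cmult_left: "ip M (\<lambda>x. c * X x) Z = c * ip M X Z"
  unfolding ip_def by (simp add: mult.assoc)

lemma ip_diff_left: "X \<in> L2 M \<Longrightarrow> Y \<in> L2 M \<Longrightarrow> Z \<in> L2 M \<Longrightarrow> ip M (\<lambda>x. X x - Y x) Z = ip M X Z - ip M Y Z"
  unfolding ip_def by (simp add: left_diff_distrib L2_integrable_mult)

lemma ip_zero_left[simp]: "ip M (\<lambda>x. 0) Z = 0"
  by (simp add: ip_def)

lemma ip_sum_left: "(\<And>i. i \<in> A \<Longrightarrow> X i \<in> L2 M) \<Longrightarrow> Z \<in> L2 M \<Longrightarrow> ip M (\<lambda>x. \<Sum>i\<in>A. X i x) Z = (\<Sum>i\<in>A. ip M (X i) Z)"
  by (induction A rule: infinite_finite_induct) (auto simp: ip_add_left L2_sum)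

lemma ip_add_right: "X \<in> L2 M \<Longrightarrow> Y \<in> L2 M \<Longrightarrow> Z \<in> L2 M \<Longrightarrow> ip M Z (\<lambda>x. X x + Y x) = ip M Z X + ip M Z Y"
  by (simp add: ip_commute[of M Z] ip_add_left)

lemma ip_cmult_right: "ip M Z (\<lambda>x. c * X x) = c * ip M Z X"
  by (simp add: ip_commute[of M Z] ip_cmult_left)

lemma ip_diff_right: "X \<in> L2 M \<Longrightarrow> Y \<in> L2 M \<Longrightarrow> Z \<in> L2 M \<Longrightarrow> ip M Z (\<lambda>x. X x - Y x) = ip M Z X - ip M Z Y"
  by (simp add: ip_commute[of M Z] ip_diff_left)

lemma ip_sum_right: "(\<And>i. i \<in> A \<Longrightarrow> X i \<in> L2 M) \<Longrightarrow> Z \<in> L2 M \<Longrightarrow> ip M Z (\<lambda>x. \<Sum>i\<in>A. X i x) = (\<Sum>i\<in>A. ip M Z (X i))"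
  by (simp add: ip_commute[of M Z] ip_sum_left)

lemma ip_cong_AE:
  assumes "AE x in M. X x = X' x" "X \<in> L2 M" "X' \<in> L2 M" "Y \<in> L2 M"
  shows "ip M X Y = ip M X' Y"
  unfolding ip_def using assms by (intro integral_cong_AE) (auto simp: L2_def)

lemma ip_self_eq_0_iff: "X \<in> L2 M \<Longrightarrow> ip M X X = 0 \<longleftrightarrow> (AE x in M. X x = 0)"
  using integral_nonneg_eq_0_iff_AE[of M "\<lambda>x. (X x)\<^sup>2"]
  unfolding ip_def by (auto simp: power2_eq_square[symmetric] L2_integrable_sq)

lemma ip_Cauchy_Schwarz:
  assumes X: "X \<in> L2 M" and Y: "Y \<in> L2 M"
  shows "(ip M X Y)\<^sup>2 \<le> ip M X X * ip M Y Y"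
proof (cases "ip M Y Y = 0")
  case True
  then have "AE x in M. Y x = 0" using ip_self_eq_0_iff[OF Y] by simp
  then have "ip M Y X = ip M (\<lambda>x. 0) X" using assms by (intro ip_cong_AE) auto
  then show ?thesis using True by (simp add: ip_commute[of M X Y])
next
  case False
  then have p: "ip M Y Y > 0" using ip_nonneg[of M Y] by linarith
  define t where "t = ip M X Y / ip M Y Y"
  have "0 \<le> ip M (\<lambda>x. X x - t * Y x) (\<lambda>x. X x - t * Y x)" by simp
  also have "\<dots> = (ip M X X - t * ip M X Y) - t * (ip M X Y - t * ip M Y Y)"
    using X Y by (simp add: ip_diff_left ip_diff_right ip_cmult_left ip_cmult_right L2_intros
        ip_commute[of M Y X])
  also have "t * ip M Y Y = ip M X Y"
    using p by (simp add: t_def)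
  also have "(ip M X X - t * ip M X Y) - t * (ip M X Y - ip M X Y) = ip M X X - (ip M X Y)\<^sup>2 / ip M Y Y"
    by (simp add: t_def power2_eq_square)
  finally show ?thesis using p by (simp add: field_simps)
qed

text \<open>The parallelogram law with the difference term dropped; for squared distances it
  replaces the triangle inequality.\<close>

lemma ip_self_add_le:
  assumes X: "X \<in> L2 M" and Y: "Y \<in> L2 M"
  shows "ip M (\<lambda>x. X x + Y x) (\<lambda>x. X x + Y x) \<le> 2 * ip M X X + 2 * ip M Y Y"
proof -
  have "0 \<le> ip M (\<lambda>x. X x - Y x) (\<lambda>x. X x - Y x)" by simp
  then show ?thesis
    using X Y by (simp add: ip_diff_left ip_diff_right ip_add_left ip_add_right L2_intros ip_commute[of M Y X])
qed

lemma ip_tendsto: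
  assumes S: "\<And>n. S n \<in> L2 M" and T: "T \<in> L2 M" and Y: "Y \<in> L2 M"
    and lim: "(\<lambda>n. ip M (\<lambda>x. S n x - T x) (\<lambda>x. S n x - T x)) \<longlonglongrightarrow> 0"
  shows "(\<lambda>n. ip M (S n) Y) \<longlonglongrightarrow> ip M T Y"
proof -
  have "(\<lambda>n. ip M (S n) Y - ip M T Y) \<longlonglongrightarrow> 0"
  proof (rule tendsto_0_le[where K=1])
    have "(\<lambda>n. sqrt (ip M (\<lambda>x. S n x - T x) (\<lambda>x. S n x - T x)) * sqrt (ip M Y Y)) \<longlonglongrightarrow> sqrt 0 * sqrt (ip M Y Y)"
      by (intro tendsto_intros lim)
    then show "(\<lambda>n. sqrt (ip M (\<lambda>x. S n x - T x) (\<lambda>x. S n x - T x)) * sqrt (ip M Y Y)) \<longlonglongrightarrow> 0" by simp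
    have "\<bar>ip M (S n) Y - ip M T Y\<bar> \<le> sqrt (ip M (\<lambda>x. S n x - T x) (\<lambda>x. S n x - T x)) * sqrt (ip M Y Y)" for n
      using ip_Cauchy_Schwarz[OF L2_diff[OF S T] Y, of n]
      by (simp add: ip_diff_left S T Y real_sqrt_mult[symmetric] real_le_rsqrt)
    then show "\<forall>\<^sub>F n in sequentially. norm (ip M (S n) Y - ip M T Y) \<le> norm (sqrt (ip M (\<lambda>x. S n x - T x) (\<lambda>x. S n x - T x)) * sqrt (ip M Y Y)) * 1"
      by (intro always_eventually allI) (simp add: abs_mult)
  qed
  then show ?thesis by (simp add: LIM_zero_iff)
qed

text \<open>The limit is given pointwise, so completeness is not invoked: Fatou's lemma, applied to
  \<open>S n - S m\<close> as \<open>n\<close> grows, turns the Cauchy bound \<open>r m\<close> into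
  a bound on the distance from \<open>S m\<close> to \<open>T\<close>.\<close>

lemma L2_limit:
  assumes S: "\<And>n. S n \<in> L2 M" and T[measurable]: "T \<in> borel_measurable M"
    and lim: "AE x in M. (\<lambda>n. S n x) \<longlonglongrightarrow> T x"
    and cau: "\<And>m n. m \<le> n \<Longrightarrow> ip M (\<lambda>x. S n x - S m x) (\<lambda>x. S n x - S m x) \<le> r m"
    and r: "r \<longlonglongrightarrow> 0"
  shows "T \<in> L2 M" and "(\<lambda>n. ip M (\<lambda>x. S n x - T x) (\<lambda>x. S n x - T x)) \<longlonglongrightarrow> 0"
proof -
  have [measurable]: "S n \<in> borel_measurable M" for n using S by (auto simp: L2_def)
  have r0: "r m \<ge> 0" for m using cau[of m m] by simp
  have nn: "(\<integral>\<^sup>+x. ennreal ((T x - S m x)\<^sup>2) \<partial>M) \<le> ennreal (r m)" for m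
  proof -
    have "AE x in M. ennreal ((T x - S m x)\<^sup>2) = liminf (\<lambda>n. ennreal ((S n x - S m x)\<^sup>2))"
      using lim
    proof eventually_elim
      case (elim x)
      have "(\<lambda>n. ennreal ((S n x - S m x)\<^sup>2)) \<longlonglongrightarrow> ennreal ((T x - S m x)\<^sup>2)"
        by (intro tendsto_intros elim)
      then show ?case by (rule lim_imp_Liminf[OF sequentially_bot, symmetric])
    qed
    then have "(\<integral>\<^sup>+x. ennreal ((T x - S m x)\<^sup>2) \<partial>M) = (\<integral>\<^sup>+x. liminf (\<lambda>n. ennreal ((S n x - S m x)\<^sup>2)) \<partial>M)"
      by (rule nn_integral_cong_AE)
    also have "\<dots> \<le> liminf (\<lambda>n. \<integral>\<^sup>+x. ennreal ((S n x - S m x)\<^sup>2) \<partial>M)"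
      by (rule nn_integral_liminf) simp
    also have "\<dots> \<le> liminf (\<lambda>n::nat. ennreal (r m))"
    proof (rule Liminf_mono, rule eventually_sequentiallyI[of m])
      fix n assume "m \<le> n"
      have "(\<integral>\<^sup>+x. ennreal ((S n x - S m x)\<^sup>2) \<partial>M) = ennreal (LINT x|M. (S n x - S m x)\<^sup>2)"
        using L2_integrable_sq[OF L2_diff[OF S S]] by (intro nn_integral_eq_integral) auto
      also have "\<dots> \<le> ennreal (r m)"
        using cau[OF \<open>m \<le> n\<close>] unfolding ip_def by (intro ennreal_leI) (simp add: power2_eq_square)
      finally show "(\<integral>\<^sup>+x. ennreal ((S n x - S m x)\<^sup>2) \<partial>M) \<le> ennreal (r m)" .
    qed
    also have "\<dots> = ennreal (r m)" by (simp add: Liminf_const)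
    finally show ?thesis .
  qed
  have D: "(\<lambda>x. T x - S m x) \<in> L2 M" for m
    unfolding L2_def using le_less_trans[OF nn[of m] ennreal_less_top] by (auto intro!: integrableI_bounded)
  have "(\<lambda>x. (T x - S 0 x) + S 0 x) \<in> L2 M"
    by (intro L2_add D S)
  then show TL: "T \<in> L2 M" by simp
  have le: "ip M (\<lambda>x. S m x - T x) (\<lambda>x. S m x - T x) \<le> r m" for m
  proof -
    have "ennreal (LINT x|M. (T x - S m x)\<^sup>2) = (\<integral>\<^sup>+x. ennreal ((T x - S m x)\<^sup>2) \<partial>M)"
      using L2_integrable_sq[OF D[of m]] by (intro nn_integral_eq_integral[symmetric]) auto
    with nn[of m] have "ennreal (LINT x|M. (T x - S m x)\<^sup>2) \<le> ennreal (r m)" by simp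
    then have "(LINT x|M. (T x - S m x)\<^sup>2) \<le> r m" using r0 by (simp add: ennreal_le_iff)
    also have "(LINT x|M. (T x - S m x)\<^sup>2) = ip M (\<lambda>x. S m x - T x) (\<lambda>x. S m x - T x)"
      unfolding ip_def by (intro Bochner_Integration.integral_cong refl) (simp add: power2_eq_square algebra_simps)
    finally show ?thesis .
  qed
  show "(\<lambda>n. ip M (\<lambda>x. S n x - T x) (\<lambda>x. S n x - T x)) \<longlonglongrightarrow> 0"
    by (rule tendsto_sandwich[OF _ _ tendsto_const r]) (auto simp: le)
qed

lemma Bessel:
  assumes h: "\<And>j. j \<in> J \<Longrightarrow> h j \<in> L2 M" and on: "\<And>i j. i \<in> J \<Longrightarrow> j \<in> J \<Longrightarrow> ip M (h i) (h j) = (if i = j then 1 else 0)"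
    and X: "X \<in> L2 M" and J: "finite J"
  shows "(\<Sum>j\<in>J. (ip M X (h j))\<^sup>2) \<le> ip M X X"
proof -
  let ?P = "\<lambda>x. \<Sum>j\<in>J. ip M X (h j) * h j x"
  have P: "?P \<in> L2 M" using h by (auto intro!: L2_intros)
  have XP: "ip M X ?P = (\<Sum>j\<in>J. (ip M X (h j))\<^sup>2)"
    using h X by (simp add: ip_sum_right ip_cmult_right L2_intros power2_eq_square)
  have "ip M (h j) ?P = ip M X (h j)" if "j \<in> J" for j
  proof -
    have "ip M (h j) ?P = (\<Sum>i\<in>J. ip M X (h i) * ip M (h j) (h i))"
      using h that by (simp add: ip_sum_right ip_cmult_right L2_intros)
    also have "\<dots> = (\<Sum>i\<in>J. if i = j then ip M X (h j) else 0)"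
      using that by (intro sum.cong refl) (auto simp: on)
    finally show ?thesis using that J by simp
  qed
  then have PP: "ip M ?P ?P = (\<Sum>j\<in>J. (ip M X (h j))\<^sup>2)"
    using h P by (subst ip_sum_left) (auto simp: ip_cmult_left L2_intros power2_eq_square intro!: sum.cong)
  have "0 \<le> ip M (\<lambda>x. X x - ?P x) (\<lambda>x. X x - ?P x)" by simp
  also have "\<dots> = ip M X X - ip M X ?P - (ip M X ?P - ip M ?P ?P)"
    using X P by (simp add: ip_diff_left ip_diff_right L2_diff ip_commute[of M ?P X])
  finally show ?thesis unfolding XP PP by simp
qed

lemma Bessel_summable:
  fixes h :: "nat \<Rightarrow> 'a \<Rightarrow> real"
  assumes "\<And>j. h j \<in> L2 M" "\<And>i j. ip M (h i) (h j) = (if i = j then 1 else 0)" "X \<in> L2 M"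
  shows "summable (\<lambda>j. (ip M X (h j))\<^sup>2)"
proof (rule bounded_imp_summable)
  show "(\<Sum>j\<le>n. (ip M X (h j))\<^sup>2) \<le> ip M X X" for n
    using assms by (intro Bessel) auto
qed simp

section \<open>Uniqueness of characteristic functions and independence\<close>

text \<open>The positive and the negative part of \<open>W\<close> have equal total mass (take
  \<open>t = 0\<close>). After normalization both are densities under which \<open>X\<close> has the
  same characteristic function, so Levy's theorem gives \<open>X\<close> the same law under
  both.\<close>

lemma integral_indicator_eq_0_of_char_real:
  fixes W X :: "'a \<Rightarrow> real"
  assumes W: "integrable M W" and X[measurable]: "X \<in> borel_measurable M"
    and ch: "\<And>t. (CLINT x|M. W x * iexp (t * X x)) = 0"
    and B[measurable]: "B \<in> sets borel"
  shows "(LINT x|M. W x * indicator B (X x)) = 0"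
proof -
  define Wp where "Wp x = max 0 (W x)" for x
  define Wm where "Wm x = max 0 (- W x)" for x
  have Wpm: "W x = Wp x - Wm x" "Wp x \<ge> 0" "Wm x \<ge> 0" for x
    by (auto simp: Wp_def Wm_def)
  have int: "integrable M Wp" "integrable M Wm"
    using W unfolding Wp_def[abs_def] Wm_def[abs_def] by auto
  have meas[measurable]: "Wp \<in> borel_measurable M" "Wm \<in> borel_measurable M"
    using int by auto
  have inte: "integrable M (\<lambda>x. V x * iexp (t * X x))" if "integrable M V" for V :: "'a \<Rightarrow> real" and t
  proof (rule Bochner_Integration.integrable_bound[OF that])
    show "(\<lambda>x. V x * iexp (t * X x)) \<in> borel_measurable M"
      using that by measurable
  qed (auto simp: norm_mult)
  have inti: "integrable M (\<lambda>x. V x * indicator B (X x))" if "integrable M V" for V :: "'a \<Rightarrow> real"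
    by (rule Bochner_Integration.integrable_bound[OF that]) (use that in \<open>auto simp: indicator_def\<close>)
  have "(CLINT x|M. Wp x * iexp (t * X x)) - (CLINT x|M. Wm x * iexp (t * X x)) = 0" for t
    using ch[of t] unfolding Wpm(1)
    by (subst Bochner_Integration.integral_diff[symmetric]) (auto simp: inte int left_diff_distrib simp del: of_real_mult)
  then have che: "(CLINT x|M. Wp x * iexp (t * X x)) = (CLINT x|M. Wm x * iexp (t * X x))" for t
    by simp
  define m where "m = (LINT x|M. Wp x)"
  have m2: "m = (LINT x|M. Wm x)"
    using che[of 0] unfolding m_def by (simp add: integral_complex_of_real[symmetric] del: integral_complex_of_real) (metis integral_complex_of_real of_real_eq_iff)
  have m0: "m \<ge> 0" unfolding m_def by (intro integral_nonneg_AE) (auto simp: Wpm)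
  have *: "(LINT x|M. Wp x * indicator B (X x)) = (LINT x|M. Wm x * indicator B (X x))"
  proof (cases "m = 0")
    case True
    have "AE x in M. Wp x = 0" "AE x in M. Wm x = 0"
      using integral_nonneg_eq_0_iff_AE[OF int(1)] integral_nonneg_eq_0_iff_AE[OF int(2)] True m_def m2 Wpm by auto
    then show ?thesis by (intro integral_cong_AE) auto
  next
    case False
    with m0 have mp: "m > 0" by simp
    define P where "P V = distr (density M (\<lambda>x. ennreal (V x / m))) borel X" for V
    have P: "real_distribution (P V) \<and> char (P V) t = (CLINT x|M. V x * iexp (t * X x)) / m
        \<and> measure (P V) B = (LINT x|M. V x * indicator B (X x)) / m"
      if V: "integrable M V" "\<And>x. V x \<ge> 0" "(LINT x|M. V x) = m" for V t
    proof -
      have [measurable]: "V \<in> borel_measurable M" using V by auto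
      have "emeasure (density M (\<lambda>x. ennreal (V x / m))) (space M) = 1"
        using V mp by (simp add: emeasure_density nn_integral_eq_integral cong: nn_integral_cong)
      then interpret D: prob_space "density M (\<lambda>x. ennreal (V x / m))"
        by (intro prob_spaceI) simp
      have rd: "real_distribution (P V)"
        unfolding P_def by (rule D.real_distribution_distr) simp
      have "char (P V) t = (CLINT x|M. (V x / m) *\<^sub>R iexp (t * X x))"
        unfolding char_def P_def using V mp by (simp add: integral_distr integral_density)
      also have "\<dots> = (CLINT x|M. V x * iexp (t * X x)) / m"
        by (subst Bochner_Integration.integral_divide_zero[symmetric]) (simp add: scaleR_conv_of_real)
      finally have c: "char (P V) t = (CLINT x|M. V x * iexp (t * X x)) / m" .
      have "measure (P V) B = (LINT x|P V. indicator B x)"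
        by (simp add: P_def)
      also have "\<dots> = (LINT x|M. (V x / m) * indicator B (X x))"
        unfolding P_def using V mp by (subst integral_distr, simp, simp, subst integral_density) auto
      also have "\<dots> = (LINT x|M. V x * indicator B (X x)) / m"
        by (subst Bochner_Integration.integral_divide_zero[symmetric]) simp
      finally show ?thesis using rd c by simp
    qed
    have "P Wp = P Wm"
    proof (rule Levy_uniqueness)
      show "char (P Wp) = char (P Wm)"
        using P[OF int(1)] P[OF int(2)] Wpm m_def m2 che by (auto simp: fun_eq_iff)
    qed (use P[OF int(1)] P[OF int(2)] Wpm m_def m2 in auto)
    then have "(LINT x|M. Wp x * indicator B (X x)) / m = (LINT x|M. Wm x * indicator B (X x)) / m"
      using P[OF int(1)] P[OF int(2)] Wpm m_def m2 by metis
    then show ?thesis using mp by simp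
  qed
  have "(LINT x|M. W x * indicator B (X x)) = (LINT x|M. Wp x * indicator B (X x) - Wm x * indicator B (X x))"
    unfolding Wpm(1) by (simp add: left_diff_distrib)
  also have "\<dots> = 0"
    by (subst Bochner_Integration.integral_diff) (auto simp: inti int *)
  finally show ?thesis .
qed

text \<open>Conjugating the hypothesis at \<open>-t\<close> shows that \<open>cnj W\<close>
  satisfies it as well. Hence so do the real and the imaginary part, and the real case applies to
  each.\<close>

lemma integral_indicator_eq_0_of_char:
  fixes W :: "'a \<Rightarrow> complex" and X :: "'a \<Rightarrow> real"
  assumes W: "integrable M W" and X[measurable]: "X \<in> borel_measurable M"
    and ch: "\<And>t. (CLINT x|M. W x * iexp (t * X x)) = 0"
    and B[measurable]: "B \<in> sets borel"
  shows "(CLINT x|M. W x * indicator B (X x)) = 0"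
proof -
  have [measurable]: "W \<in> borel_measurable M" using W by auto
  have int: "integrable M (\<lambda>x. V x * iexp (t * X x))" if "integrable M V" for V :: "'a \<Rightarrow> complex" and t
  proof (rule Bochner_Integration.integrable_bound[OF that])
    show "(\<lambda>x. V x * iexp (t * X x)) \<in> borel_measurable M"
      using that by measurable
  qed (auto simp: norm_mult)
  have inti: "integrable M (\<lambda>x. W x * indicator B (X x))"
    by (rule Bochner_Integration.integrable_bound[OF W]) (auto simp: indicator_def)
  have "(CLINT x|M. cnj (W x) * iexp (t * X x)) = 0" for t
  proof -
    have "(CLINT x|M. cnj (W x * iexp ((-t) * X x))) = cnj (CLINT x|M. W x * iexp ((-t) * X x))"
      by (simp add: integral_cnj del: complex_cnj_mult)
    then show ?thesis using ch[of "-t"] by (simp add: exp_cnj)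
  qed note cc = this
  have icnj: "integrable M (\<lambda>x. cnj (W x))" using W by simp
  have "(CLINT x|M. of_real (Re (W x)) * iexp (t * X x)) = 0" for t
  proof -
    have "(CLINT x|M. of_real (Re (W x)) * iexp (t * X x)) =
       (CLINT x|M. (W x * iexp (t * X x) + cnj (W x) * iexp (t * X x)) / 2)"
      by (intro Bochner_Integration.integral_cong refl) (simp add: distrib_right[symmetric] complex_add_cnj)
    also have "\<dots> = 0" using ch[of t] cc[of t]
      by (simp add: Bochner_Integration.integral_add int[OF W] int[OF icnj] del: of_real_mult)
    finally show ?thesis .
  qed
  then have re: "(LINT x|M. Re (W x) * indicator B (X x)) = 0"
    using W by (intro integral_indicator_eq_0_of_char_real) auto
  have "(CLINT x|M. of_real (Im (W x)) * iexp (t * X x)) = 0" for t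
  proof -
    have "(CLINT x|M. of_real (Im (W x)) * iexp (t * X x)) =
       (CLINT x|M. (W x * iexp (t * X x) - cnj (W x) * iexp (t * X x)) / (2 * \<i>))"
    proof (intro Bochner_Integration.integral_cong refl)
      fix x
      have "complex_of_real (Im (W x)) = (W x - cnj (W x)) / (2 * \<i>)"
        by (simp add: complex_eq_iff)
      then show "complex_of_real (Im (W x)) * iexp (t * X x) = (W x * iexp (t * X x) - cnj (W x) * iexp (t * X x)) / (2 * \<i>)"
        by (simp only: left_diff_distrib[symmetric] times_divide_eq_left)
    qed
    also have "\<dots> = 0" using ch[of t] cc[of t]
      by (simp add: Bochner_Integration.integral_diff int[OF W] int[OF icnj] del: of_real_mult)
    finally show ?thesis .
  qed
  then have im: "(LINT x|M. Im (W x) * indicator B (X x)) = 0"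
    using W by (intro integral_indicator_eq_0_of_char_real) auto
  have ri: "Re (W x * indicator B (X x)) = Re (W x) * indicator B (X x)"
    "Im (W x * indicator B (X x)) = Im (W x) * indicator B (X x)" for x
    by (auto simp: indicator_def)
  show ?thesis
    using integral_Re[OF inti] integral_Im[OF inti] re im unfolding ri by (auto simp: complex_eq_iff)
qed

text \<open>The exponentials are replaced by indicators one coordinate at a time, each time absorbing the remaining
  factors into the weight \<open>W\<close>; so the one-dimensional uniqueness theorem suffices.\<close>

lemma integral_prod_indicator_eq_0_of_char:
  fixes W :: "'a \<Rightarrow> complex" and X :: "'i \<Rightarrow> 'a \<Rightarrow> real"
  assumes "finite J" and W: "integrable M W" and X: "\<And>j. j \<in> J \<Longrightarrow> X j \<in> borel_measurable M"
    and ch: "\<And>t. (CLINT x|M. W x * iexp (\<Sum>j\<in>J. t j * X j x)) = 0"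
    and B: "\<And>j. j \<in> J \<Longrightarrow> B j \<in> sets borel"
  shows "(CLINT x|M. W x * (\<Prod>j\<in>J. indicator (B j) (X j x))) = 0"
  using assms
proof (induction J arbitrary: W)
  case empty
  then show ?case by simp
next
  case (insert k J)
  have [measurable]: "X k \<in> borel_measurable M" "B k \<in> sets borel" "W \<in> borel_measurable M"
    "\<And>j. j \<in> J \<Longrightarrow> X j \<in> borel_measurable M"
    using insert.prems by auto
  have "(CLINT x|M. (W x * indicator (B k) (X k x)) * iexp (\<Sum>j\<in>J. t j * X j x)) = 0" for t
  proof -
    have I: "integrable M (\<lambda>x. W x * iexp (\<Sum>j\<in>J. t j * X j x))"
    proof (rule Bochner_Integration.integrable_bound[OF insert.prems(1)])
      have [measurable]: "(\<lambda>x. \<Sum>j\<in>J. t j * X j x) \<in> borel_measurable M"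
        by (intro borel_measurable_sum) auto
      show "(\<lambda>x. W x * iexp (\<Sum>j\<in>J. t j * X j x)) \<in> borel_measurable M"
        by measurable
    qed (auto simp: norm_mult simp del: of_real_sum)
    have "(CLINT x|M. (W x * iexp (\<Sum>j\<in>J. t j * X j x)) * iexp (s * X k x)) = 0" for s
    proof -
      have e: "(\<Sum>j\<in>insert k J. (t(k:=s)) j * X j x) = (\<Sum>j\<in>J. t j * X j x) + s * X k x" for x
        using insert.hyps by (auto intro!: sum.cong)
      show ?thesis
        using insert.prems(3)[of "t(k:=s)"] unfolding e
        by (simp add: exp_add distrib_left mult.assoc del: fun_upd_apply)
    qed
    from integral_indicator_eq_0_of_char[OF I _ this, of "B k"] show ?thesis
      by (simp add: mult_ac)
  qed
  moreover have "integrable M (\<lambda>x. W x * indicator (B k) (X k x))"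
    by (rule Bochner_Integration.integrable_bound[OF insert.prems(1)]) (auto simp: indicator_def)
  ultimately have "(CLINT x|M. (W x * indicator (B k) (X k x)) * (\<Prod>j\<in>J. indicator (B j) (X j x))) = 0"
    using insert.prems by (intro insert.IH) auto
  then show ?case using insert.hyps by (simp add: mult.assoc)
qed

text \<open>A Dynkin argument for an arbitrary index set: the finite-dimensional cylinders are
  stable under intersection, complements use the mean 0 of \<open>W\<close> (the case of an empty
  \<open>J\<close>), and disjoint unions use countable additivity of the set integral.\<close>

lemma integral_indicator_PiM_eq_0_of_char:
  fixes W :: "'a \<Rightarrow> complex" and X :: "'i \<Rightarrow> 'a \<Rightarrow> real"
  assumes W: "integrable M W" and X: "\<And>j. j \<in> I \<Longrightarrow> X j \<in> borel_measurable M"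
    and ch: "\<And>J t. finite J \<Longrightarrow> J \<subseteq> I \<Longrightarrow> (CLINT x|M. W x * iexp (\<Sum>j\<in>J. t j * X j x)) = 0"
    and B: "B \<in> sets (PiM I (\<lambda>_. borel))"
  shows "(CLINT x|M. W x * indicator B (\<lambda>j\<in>I. X j x)) = 0"
proof -
  let ?X = "\<lambda>x. \<lambda>j\<in>I. X j x"
  have Xm[measurable]: "?X \<in> M \<rightarrow>\<^sub>M PiM I (\<lambda>_. borel)"
    using X by (intro measurable_restrict) auto
  have [measurable]: "W \<in> borel_measurable M" using W by auto
  have inti: "integrable M (\<lambda>x. W x * indicator B (?X x))" if [measurable]: "B \<in> sets (PiM I (\<lambda>_. borel))" for B
  proof (rule Bochner_Integration.integrable_bound[OF W])
    show "(\<lambda>x. W x * indicator B (?X x)) \<in> borel_measurable M"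
      by measurable
  qed (auto simp: indicator_def)
  have W0: "(CLINT x|M. W x) = 0" using ch[of "{}"] by simp
  have "B \<in> sigma_sets (\<Pi>\<^sub>E i\<in>I. space borel) (prod_algebra I (\<lambda>_. borel))"
    using B by (simp add: sets_PiM)
  from Int_stable_prod_algebra prod_algebra_sets_into_space this show ?thesis
  proof (induction rule: sigma_sets_induct_disjoint)
    case (basic A)
    from prod_algebraE[OF this] obtain J E where
      JE: "A = prod_emb I (\<lambda>_. borel) J (Pi\<^sub>E J E)" "finite J" "J \<noteq> {} \<or> I = {}" "J \<subseteq> I" "\<And>i. i \<in> J \<Longrightarrow> E i \<in> sets borel"
      by metis
    have "indicator A (?X x) = (\<Prod>j\<in>J. indicator (E j) (X j x) :: complex)" for x
    proof -
      have "?X x \<in> A \<longleftrightarrow> (\<forall>j\<in>J. X j x \<in> E j)"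
        using JE(4) unfolding JE(1) prod_emb_def by (auto simp: PiE_iff extensional_def subset_eq)
      moreover have "(\<Prod>j\<in>J. indicator (E j) (X j x) :: complex) = (if \<forall>j\<in>J. X j x \<in> E j then 1 else 0)"
        using JE(2) by (auto intro!: prod.neutral prod_zero simp: indicator_def)
      ultimately show ?thesis by (simp add: indicator_def)
    qed
    moreover have "(CLINT x|M. W x * (\<Prod>j\<in>J. indicator (E j) (X j x))) = 0"
      using JE X ch by (intro integral_prod_indicator_eq_0_of_char W) auto
    ultimately show ?case by (simp only:)
  next
    case empty
    show ?case by simp
  next
    case (compl A)
    then have A: "A \<in> sets (PiM I (\<lambda>_. borel))" by (simp add: sets_PiM)
    have "W x * indicator ((\<Pi>\<^sub>E i\<in>I. space borel) - A) (?X x) = W x - W x * indicator A (?X x)" for x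
      by (auto simp: indicator_def)
    then have "(CLINT x|M. W x * indicator ((\<Pi>\<^sub>E i\<in>I. space borel) - A) (?X x)) = (CLINT x|M. W x) - (CLINT x|M. W x * indicator A (?X x))"
      by (simp only: Bochner_Integration.integral_diff[OF W inti[OF A]])
    then show ?case
      by (simp only: compl.IH W0 diff_self)
  next
    case (union A)
    then have A: "\<And>i. A i \<in> sets (PiM I (\<lambda>_. borel))" by (auto simp: sets_PiM)
    let ?V = "\<lambda>A. ?X -` A \<inter> space M"
    have V: "?V (A i) \<in> sets M" for i using A[of i] by measurable
    have eq: "(CLINT x|M. W x * indicator A (?X x)) = (CLINT x:?V A|M. W x)" for A
      unfolding set_lebesgue_integral_def
      by (intro Bochner_Integration.integral_cong refl) (auto simp: indicator_def)
    have UN: "?V (\<Union>i. A i) = (\<Union>i. ?V (A i))" by auto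
    have "(CLINT x:(\<Union>i. ?V (A i))|M. W x) = (\<Sum>i. (CLINT x:?V (A i)|M. W x))"
    proof (rule lebesgue_integral_countable_add)
      show "set_integrable M (\<Union>i. ?V (A i)) W"
        unfolding set_integrable_def using V by (intro integrable_mult_indicator[OF _ W] sets.countable_UN) auto
      show "?V (A i) \<inter> ?V (A j) = {}" if "i \<noteq> j" for i j
        using union.hyps(1) that unfolding disjoint_family_on_def by blast
    qed (rule V)
    then show ?case using union.IH unfolding eq UN by simp
  qed
qed

text \<open>Two passes, one for each family. A centered exponential in \<open>X\<close> serves as
  weight to replace exponentials in \<open>Y\<close> by indicators; then the centered indicator of
  \<open>Y\<close> serves as weight to do the same for \<open>X\<close>.\<close>

lemma (in prob_space) distr_pair_PiM_of_char:
  fixes X :: "'i \<Rightarrow> 'a \<Rightarrow> real" and Y :: "'j \<Rightarrow> 'a \<Rightarrow> real"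
  assumes X: "\<And>i. i \<in> I \<Longrightarrow> X i \<in> borel_measurable M" and Y: "\<And>j. j \<in> J \<Longrightarrow> Y j \<in> borel_measurable M"
    and ch: "\<And>I' J' s t. finite I' \<Longrightarrow> I' \<subseteq> I \<Longrightarrow> finite J' \<Longrightarrow> J' \<subseteq> J \<Longrightarrow>
      (CLINT x|M. iexp ((\<Sum>i\<in>I'. s i * X i x) + (\<Sum>j\<in>J'. t j * Y j x))) =
      (CLINT x|M. iexp (\<Sum>i\<in>I'. s i * X i x)) * (CLINT x|M. iexp (\<Sum>j\<in>J'. t j * Y j x))"
  shows "distr M (PiM I (\<lambda>_. borel) \<Otimes>\<^sub>M PiM J (\<lambda>_. borel)) (\<lambda>x. (\<lambda>i\<in>I. X i x, \<lambda>j\<in>J. Y j x)) =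
    distr M (PiM I (\<lambda>_. borel)) (\<lambda>x. \<lambda>i\<in>I. X i x) \<Otimes>\<^sub>M distr M (PiM J (\<lambda>_. borel)) (\<lambda>x. \<lambda>j\<in>J. Y j x)"
proof -
  let ?X = "\<lambda>x. \<lambda>i\<in>I. X i x" and ?Y = "\<lambda>x. \<lambda>j\<in>J. Y j x"
  have Xm[measurable]: "?X \<in> M \<rightarrow>\<^sub>M PiM I (\<lambda>_. borel)"
    using X by (intro measurable_restrict) auto
  have Ym[measurable]: "?Y \<in> M \<rightarrow>\<^sub>M PiM J (\<lambda>_. borel)"
    using Y by (intro measurable_restrict) auto
  have sX[measurable]: "(\<lambda>x. \<Sum>i\<in>I'. s i * X i x) \<in> borel_measurable M" if "I' \<subseteq> I" for I' s
    using X that by (intro borel_measurable_sum) auto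
  have sY[measurable]: "(\<lambda>x. \<Sum>i\<in>J'. s i * Y i x) \<in> borel_measurable M" if "J' \<subseteq> J" for J' s
    using Y that by (intro borel_measurable_sum) auto
  have ie: "integrable M (\<lambda>x. iexp (Z x))" if "Z \<in> borel_measurable M" for Z :: "'a \<Rightarrow> real"
    using that by (intro integrable_iexp) auto
  have key: "prob ((?X -` A \<inter> space M) \<inter> (?Y -` B \<inter> space M)) = prob (?X -` A \<inter> space M) * prob (?Y -` B \<inter> space M)"
    if A[measurable]: "A \<in> sets (PiM I (\<lambda>_. borel))" and B[measurable]: "B \<in> sets (PiM J (\<lambda>_. borel))" for A B
  proof -
    have 1: "(CLINT x|M. (indicator B (?Y x) - complex_of_real (prob (?Y -` B \<inter> space M))) * iexp (\<Sum>i\<in>I'. s i * X i x)) = 0"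
      if I': "finite I'" "I' \<subseteq> I" for I' s
    proof -
      let ?e = "\<lambda>x. iexp (\<Sum>i\<in>I'. s i * X i x)"
      define c where "c = (CLINT x|M. ?e x)"
      have [simp]: "integrable M ?e" using sX[OF I'(2)] by (intro ie)
      \<comment> \<open>Subtracting the mean \<open>c\<close> turns the product formula
        \<open>ch\<close> into a vanishing integral, which is the form that the uniqueness lemma
        accepts.\<close>
      have "(CLINT x|M. (?e x - c) * indicator B (?Y x)) = 0"
      proof (rule integral_indicator_PiM_eq_0_of_char[OF _ Y _ B])
        fix J' t assume J': "finite J'" "J' \<subseteq> J"
        let ?f = "\<lambda>x. iexp (\<Sum>j\<in>J'. t j * Y j x)"
        have [simp]: "integrable M ?f" using sY[OF J'(2)] by (intro ie)
        have [simp]: "integrable M (\<lambda>x. ?e x * ?f x)"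
        proof -
          have "integrable M (\<lambda>x. iexp ((\<Sum>i\<in>I'. s i * X i x) + (\<Sum>j\<in>J'. t j * Y j x)))"
            using sX[OF I'(2)] sY[OF J'(2)] by (intro ie borel_measurable_add)
          then show ?thesis by (simp add: exp_add distrib_left)
        qed
        have "(CLINT x|M. (?e x - c) * ?f x) = (CLINT x|M. ?e x * ?f x) - c * (CLINT x|M. ?f x)"
          by (simp add: left_diff_distrib del: of_real_sum of_real_mult)
        also have "\<dots> = 0" using ch[OF I' J', of s t] by (simp add: exp_add distrib_left c_def)
        finally show "(CLINT x|M. (?e x - c) * ?f x) = 0" .
      qed (simp del: of_real_sum of_real_mult)
      moreover have [simp]: "integrable M (\<lambda>x. ?e x * indicator B (?Y x))"
      proof (rule Bochner_Integration.integrable_bound[of M ?e])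
        show "(\<lambda>x. ?e x * indicator B (?Y x)) \<in> borel_measurable M"
          using sX[OF I'(2)] by measurable
      qed (auto simp: indicator_def simp del: of_real_sum)
      moreover have "integrable M (\<lambda>x. indicator B (?Y x) :: complex)"
        by (rule integrable_const_bound[of _ 1]) (auto simp: indicator_def)
      moreover have "(CLINT x|M. indicator B (?Y x)) = prob (?Y -` B \<inter> space M)"
      proof -
        have "(CLINT x|M. indicator B (?Y x)) = (CLINT x|M. complex_of_real (indicator (?Y -` B \<inter> space M) x))"
          by (intro Bochner_Integration.integral_cong refl) (auto simp: indicator_def)
        also have "\<dots> = prob (?Y -` B \<inter> space M)"
          by (subst integral_complex_of_real) simp
        finally show ?thesis .
      qed
      ultimately have "(CLINT x|M. ?e x * indicator B (?Y x)) = c * prob (?Y -` B \<inter> space M)"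
        by (simp add: left_diff_distrib)
      moreover have "(CLINT x|M. (indicator B (?Y x) - complex_of_real (prob (?Y -` B \<inter> space M))) * ?e x)
        = (CLINT x|M. ?e x * indicator B (?Y x) - prob (?Y -` B \<inter> space M) * ?e x)"
        by (intro Bochner_Integration.integral_cong refl) (simp add: algebra_simps del: of_real_sum of_real_mult)
      moreover have "\<dots> = (CLINT x|M. ?e x * indicator B (?Y x)) - prob (?Y -` B \<inter> space M) * c"
        by (simp add: c_def del: of_real_sum of_real_mult)
      ultimately show ?thesis by (simp only: mult.commute diff_self)
    qed
    have ib: "integrable M (\<lambda>x. indicator B (?Y x) :: complex)"
      by (rule integrable_const_bound[of _ 1]) (auto simp: indicator_def)
    have ia: "integrable M (\<lambda>x. indicator A (?X x) :: complex)"
      by (rule integrable_const_bound[of _ 1]) (auto simp: indicator_def)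
    have iab: "integrable M (\<lambda>x. indicator B (?Y x) * indicator A (?X x) :: complex)"
      by (rule integrable_const_bound[of _ 1]) (auto simp: indicator_def)
    have "(CLINT x|M. (indicator B (?Y x) - complex_of_real (prob (?Y -` B \<inter> space M))) * indicator A (?X x)) = 0"
      by (rule integral_indicator_PiM_eq_0_of_char[OF _ X 1 A]) (auto simp: ib)
    then have "(CLINT x|M. indicator B (?Y x) * indicator A (?X x)) =
        prob (?Y -` B \<inter> space M) * (CLINT x|M. indicator A (?X x))"
      using ia iab by (simp add: left_diff_distrib)
    moreover have "(CLINT x|M. indicator B (?Y x) * indicator A (?X x))
      = (CLINT x|M. complex_of_real (indicator ((?X -` A \<inter> space M) \<inter> (?Y -` B \<inter> space M)) x))"
      by (intro Bochner_Integration.integral_cong refl) (auto simp: indicator_def)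
    moreover have "(CLINT x|M. indicator A (?X x)) = (CLINT x|M. complex_of_real (indicator (?X -` A \<inter> space M) x))"
      by (intro Bochner_Integration.integral_cong refl) (auto simp: indicator_def)
    ultimately have "complex_of_real (prob ((?X -` A \<inter> space M) \<inter> (?Y -` B \<inter> space M))) =
       complex_of_real (prob (?Y -` B \<inter> space M) * prob (?X -` A \<inter> space M))"
      by simp
    then show ?thesis unfolding of_real_eq_iff by simp
  qed
  interpret PX: prob_space "distr M (PiM I (\<lambda>_. borel)) ?X" by (rule prob_space_distr) simp
  interpret PY: prob_space "distr M (PiM J (\<lambda>_. borel)) ?Y" by (rule prob_space_distr) simp
  show ?thesis
  proof (rule pair_measure_eqI[symmetric])
    fix A B assume "A \<in> sets (distr M (PiM I (\<lambda>_. borel)) ?X)" "B \<in> sets (distr M (PiM J (\<lambda>_. borel)) ?Y)"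
    then have [measurable]: "A \<in> sets (PiM I (\<lambda>_. borel))" "B \<in> sets (PiM J (\<lambda>_. borel))" by auto
    have "(\<lambda>x. (?X x, ?Y x)) -` (A \<times> B) \<inter> space M = (?X -` A \<inter> space M) \<inter> (?Y -` B \<inter> space M)" by auto
    then show "emeasure (distr M (PiM I (\<lambda>_. borel)) ?X) A * emeasure (distr M (PiM J (\<lambda>_. borel)) ?Y) B =
      emeasure (distr M (PiM I (\<lambda>_. borel) \<Otimes>\<^sub>M PiM J (\<lambda>_. borel)) (\<lambda>x. (?X x, ?Y x))) (A \<times> B)"
      using key[of A B] by (simp add: emeasure_distr emeasure_eq_measure ennreal_mult)
  qed (auto intro: PX.sigma_finite_measure_axioms PY.sigma_finite_measure_axioms)
qed

section \<open>Convergence of series of independent variables\<close>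

lemma (in prob_space) L2_integrable: "X \<in> L2 M \<Longrightarrow> integrable M X"
  unfolding L2_def by (auto intro: square_integrable_imp_integrable)

text \<open>Decompose according to the first time \<open>k\<close> at which the partial sum reaches
  \<open>e\<close>, with indicator \<open>Q k\<close>. The later increment \<open>S n - S k\<close>
  is orthogonal to \<open>S k * Q k\<close>, so on each such event the mean of
  \<open>(S n)\<^sup>2\<close> dominates that of \<open>(S k)\<^sup>2\<close>, which is at least
  \<open>e\<^sup>2\<close> there.\<close>

lemma (in prob_space) Kolmogorov_inequality:
  fixes Z :: "nat \<Rightarrow> 'a \<Rightarrow> real"
  assumes ind: "indep_vars (\<lambda>_. borel) Z UNIV" and Z: "\<And>j. Z j \<in> L2 M"
    and mean: "\<And>j. expectation (Z j) = 0" and e: "e > 0"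
  shows "prob {x\<in>space M. \<exists>k\<in>{m..n}. e \<le> \<bar>\<Sum>j=m..<k. Z j x\<bar>} \<le> (\<Sum>j=m..<n. ip M (Z j) (Z j)) / e\<^sup>2"
proof -
  have Zm[measurable]: "Z j \<in> borel_measurable M" for j using Z by (auto simp: L2_def)
  define S where "S k x = (\<Sum>j=m..<k. Z j x)" for k x
  have SL: "S k \<in> L2 M" for k
    unfolding S_def[abs_def] by (intro L2_intros Z)
  have Sm[measurable]: "S k \<in> borel_measurable M" for k using SL by (auto simp: L2_def)
  \<comment> \<open>Written as a function of the coordinates, so that first passage at time
    \<open>k\<close> visibly depends on the variables with index in \<open>{m..<k}\<close> alone and
    independence can be applied.\<close>
  define q where "q k w = (if e \<le> \<bar>\<Sum>j=m..<k. w j\<bar> \<and> (\<forall>i\<in>{m..<k}. \<bar>\<Sum>j=m..<i. w j\<bar> < e) then 1 else 0 :: real)"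
    for k and w :: "nat \<Rightarrow> real"
  define Q where "Q k x = q k (\<lambda>j. Z j x)" for k x
  have Qdef: "Q k x = (if e \<le> \<bar>S k x\<bar> \<and> (\<forall>i\<in>{m..<k}. \<bar>S i x\<bar> < e) then 1 else 0 :: real)" for k x
    by (simp add: Q_def q_def S_def)
  have Qm[measurable]: "Q k \<in> borel_measurable M" for k
    unfolding Qdef[abs_def] by measurable
  have Q01: "Q k x = 0 \<or> Q k x = 1" for k x by (simp add: Qdef)
  have QL: "(\<lambda>x. X x * Q k x) \<in> L2 M" if "X \<in> L2 M" for X k
  proof -
    have [measurable]: "X \<in> borel_measurable M" using that by (auto simp: L2_def)
    have "integrable M (\<lambda>x. (X x * Q k x)\<^sup>2)"
      by (rule Bochner_Integration.integrable_bound[OF L2_integrable_sq[OF that]])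
         (use Q01 in \<open>auto simp: power_mult_distrib Qdef\<close>)
    then show ?thesis unfolding L2_def by auto
  qed
  have orth: "ip M (\<lambda>x. S k x * Q k x) (Z j) = 0" if "k \<le> j" for k j
  proof -
    define f where "f w = (\<Sum>j=m..<k. w j) * q k w" for w :: "nat \<Rightarrow> real"
    have [measurable]: "(\<lambda>w. \<Sum>j=m..<i. w j :: real) \<in> borel_measurable (PiM {m..<k} (\<lambda>_. borel :: real measure))" if "i \<le> k" for i
      using that by (intro borel_measurable_sum[where S="{m..<i}" and f="\<lambda>j w. w j"] measurable_component_singleton) auto
    have f[measurable]: "f \<in> PiM {m..<k} (\<lambda>_. borel) \<rightarrow>\<^sub>M borel"
      unfolding f_def[abs_def] q_def by measurable
    have "indep_var borel (f \<circ> (\<lambda>\<omega>. restrict (\<lambda>i. Z i \<omega>) {m..<k})) borel ((\<lambda>w. w j) \<circ> (\<lambda>\<omega>. restrict (\<lambda>i. Z i \<omega>) {j}))"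
      using that by (intro indep_var_compose[OF indep_var_restrict[OF ind]] f measurable_component_singleton) auto
    moreover have "f \<circ> (\<lambda>\<omega>. restrict (\<lambda>i. Z i \<omega>) {m..<k}) = (\<lambda>x. S k x * Q k x)"
    proof
      fix x
      have "q k (restrict (\<lambda>i. Z i x) {m..<k}) = q k (\<lambda>i. Z i x)"
        unfolding q_def by (intro if_cong conj_cong ball_cong refl) (auto intro!: arg_cong2[where f="(\<le>)"] arg_cong2[where f="(<)"] arg_cong[where f=abs] sum.cong)
      then show "(f \<circ> (\<lambda>\<omega>. restrict (\<lambda>i. Z i \<omega>) {m..<k})) x = S k x * Q k x"
        by (simp add: f_def S_def Q_def)
    qed
    moreover have "(\<lambda>w. w j) \<circ> (\<lambda>\<omega>. restrict (\<lambda>i. Z i \<omega>) {j}) = Z j" by auto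
    ultimately have "indep_var borel (\<lambda>x. S k x * Q k x) borel (Z j)" by simp
    from indep_var_lebesgue_integral[OF this L2_integrable[OF QL[OF SL]] L2_integrable[OF Z]] show ?thesis
      by (simp add: ip_def mean)
  qed
  have orthZ: "ip M (Z i) (Z j) = 0" if "i \<noteq> j" for i j
  proof -
    have "indep_var borel ((\<lambda>w. w i) \<circ> (\<lambda>\<omega>. restrict (\<lambda>i. Z i \<omega>) {i})) borel ((\<lambda>w. w j) \<circ> (\<lambda>\<omega>. restrict (\<lambda>i. Z i \<omega>) {j}))"
      using that by (intro indep_var_compose[OF indep_var_restrict[OF ind]] measurable_component_singleton) auto
    moreover have "(\<lambda>w. w j) \<circ> (\<lambda>\<omega>. restrict (\<lambda>i. Z i \<omega>) {j}) = Z j" for j by auto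
    ultimately have "indep_var borel (Z i) borel (Z j)" by simp
    from indep_var_lebesgue_integral[OF this L2_integrable[OF Z] L2_integrable[OF Z]] show ?thesis
      by (simp add: ip_def mean)
  qed
  have Sn: "ip M (S n) (S n) = (\<Sum>j=m..<n. ip M (Z j) (Z j))"
  proof -
    have "ip M (S n) (S n) = (\<Sum>i=m..<n. \<Sum>j=m..<n. ip M (Z i) (Z j))"
      unfolding S_def[abs_def] by (simp add: ip_sum_left ip_sum_right Z L2_sum)
    also have "\<dots> = (\<Sum>i=m..<n. \<Sum>j=m..<n. if j = i then ip M (Z i) (Z i) else 0)"
      by (intro sum.cong refl) (auto simp: orthZ)
    finally show ?thesis by (simp add: sum.delta)
  qed
  have k_le: "e\<^sup>2 * expectation (Q k) \<le> expectation (\<lambda>x. (S n x)\<^sup>2 * Q k x)" if k: "k \<in> {m..n}" for k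
  proof -
    have "ip M (\<lambda>x. S k x * Q k x) (\<lambda>x. S n x - S k x) = ip M (\<lambda>x. S k x * Q k x) (\<lambda>x. \<Sum>j=k..<n. Z j x)"
    proof -
      have "S n x - S k x = (\<Sum>j=k..<n. Z j x)" for x
        unfolding S_def using k sum.atLeastLessThan_concat[of m k n "\<lambda>j. Z j x"] by simp
      then show ?thesis by simp
    qed
    also have "\<dots> = 0"
      by (subst ip_sum_right) (auto simp: QL SL Z orth)
    finally have 0: "expectation (\<lambda>x. (S k x * Q k x) * (S n x - S k x)) = 0" by (simp add: ip_def)
    have i1: "integrable M (\<lambda>x. (S k x * Q k x) * (S n x - S k x))"
      by (intro L2_integrable_mult QL SL L2_diff)
    have i2: "integrable M (\<lambda>x. (S k x * Q k x) * S k x)"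
      by (intro L2_integrable_mult QL SL)
    have i3: "integrable M (\<lambda>x. (S n x * Q k x) * S n x)"
      by (intro L2_integrable_mult QL SL)
    have iQ: "integrable M (Q k)"
      by (rule integrable_const_bound[of _ 1]) (use Q01 in \<open>auto simp: Qdef\<close>)
    have "e\<^sup>2 * expectation (Q k) = expectation (\<lambda>x. e\<^sup>2 * Q k x)" by simp
    also have "\<dots> \<le> expectation (\<lambda>x. (S k x * Q k x) * S k x)"
    proof (rule integral_mono)
      fix x
      show "e\<^sup>2 * Q k x \<le> (S k x * Q k x) * S k x"
        using power_mono[of e "\<bar>S k x\<bar>" 2] e by (auto simp: Qdef power2_eq_square)
    qed (use iQ i2 in auto)
    \<comment> \<open>The added cross term has mean 0; what then separates the integrand from
      \<open>(S n)\<^sup>2 * Q k\<close> is \<open>(S n - S k)\<^sup>2 * Q k\<close>, which is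
      nonnegative.\<close>
    also have "\<dots> = expectation (\<lambda>x. (S k x * Q k x) * S k x + 2 * ((S k x * Q k x) * (S n x - S k x)))"
      using i1 i2 0 by simp
    also have "\<dots> \<le> expectation (\<lambda>x. (S n x * Q k x) * S n x)"
    proof (rule integral_mono)
      fix x
      have "0 \<le> (S n x - S k x)\<^sup>2 * Q k x" using Q01[of k x] by auto
      then show "(S k x * Q k x) * S k x + 2 * ((S k x * Q k x) * (S n x - S k x)) \<le> (S n x * Q k x) * S n x"
        by (simp add: power2_eq_square algebra_simps)
    qed (use i1 i2 i3 in auto)
    also have "\<dots> = expectation (\<lambda>x. (S n x)\<^sup>2 * Q k x)"
      by (intro Bochner_Integration.integral_cong refl) (simp add: power2_eq_square)
    finally show ?thesis .
  qed
  let ?A = "{x\<in>space M. \<exists>k\<in>{m..n}. e \<le> \<bar>S k x\<bar>}"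
  have iQ: "integrable M (Q k)" for k
    by (rule integrable_const_bound[of _ 1]) (use Q01 in \<open>auto simp: Qdef\<close>)
  have iSQ: "integrable M (\<lambda>x. (S n x)\<^sup>2 * Q k x)" for k
    by (rule Bochner_Integration.integrable_bound[OF L2_integrable_sq[OF SL[of n]]]) (use Q01 in \<open>auto simp: Qdef\<close>)
  have le1: "(\<Sum>k\<in>{m..n}. Q k x) \<le> 1" for x
  proof (cases "\<exists>k\<in>{m..n}. Q k x = 1")
    case True
    then obtain k where k: "k \<in> {m..n}" "Q k x = 1" by auto
    have "Q i x = 0" if "i \<in> {m..n}" "i \<noteq> k" for i
    proof (cases "i < k")
      case True
      have "\<bar>S i x\<bar> < e" using k that True by (auto simp: Qdef split: if_splits)
      then show ?thesis by (simp add: Qdef)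
    next
      case False
      have "e \<le> \<bar>S k x\<bar>" using k by (auto simp: Qdef split: if_splits)
      moreover have "k \<in> {m..<i}" using k that False by auto
      ultimately have "\<not> (\<forall>i\<in>{m..<i}. \<bar>S i x\<bar> < e)" by (meson not_le)
      then show ?thesis by (simp add: Qdef)
    qed
    then have "(\<Sum>k\<in>{m..n}. Q k x) = (\<Sum>i\<in>{m..n}. if i = k then 1 else 0)"
      using k by (intro sum.cong refl) auto
    then show ?thesis using k by simp
  next
    case False
    then have "(\<Sum>k\<in>{m..n}. Q k x) = 0" using Q01 by (intro sum.neutral) blast
    then show ?thesis by simp
  qed
  have ge1: "1 \<le> (\<Sum>k\<in>{m..n}. Q k x)" if "x \<in> ?A" for x
  proof -
    from that have ex: "\<exists>k. k \<in> {m..n} \<and> e \<le> \<bar>S k x\<bar>" by auto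
    define k where "k = (LEAST k. k \<in> {m..n} \<and> e \<le> \<bar>S k x\<bar>)"
    have k: "k \<in> {m..n}" "e \<le> \<bar>S k x\<bar>" using LeastI_ex[OF ex] unfolding k_def by auto
    have "\<bar>S i x\<bar> < e" if "i \<in> {m..<k}" for i
    proof (rule ccontr)
      assume "\<not> \<bar>S i x\<bar> < e"
      then have "i \<in> {m..n} \<and> e \<le> \<bar>S i x\<bar>" using that k by auto
      then have "k \<le> i" unfolding k_def by (rule Least_le)
      then show False using that by auto
    qed
    then have "Q k x = 1" using k by (simp add: Qdef)
    moreover have "Q k x \<le> (\<Sum>k\<in>{m..n}. Q k x)"
      using k by (intro member_le_sum) (auto simp: Qdef)
    ultimately show ?thesis by simp
  qed
  have Am: "?A \<in> sets M" by measurable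
  have "e\<^sup>2 * prob ?A = e\<^sup>2 * expectation (indicator ?A)" using Am by simp
  also have "\<dots> \<le> e\<^sup>2 * expectation (\<lambda>x. \<Sum>k\<in>{m..n}. Q k x)"
  proof (intro mult_left_mono integral_mono)
    show "indicator ?A x \<le> (\<Sum>k\<in>{m..n}. Q k x)" for x
      using ge1[of x] by (auto simp: indicator_def intro!: sum_nonneg simp: Qdef)
    show "integrable M (indicator ?A :: 'a \<Rightarrow> real)"
      using Am by (rule integrable_real_indicator) (simp add: emeasure_eq_measure)
  qed (use iQ in auto)
  also have "\<dots> = (\<Sum>k\<in>{m..n}. e\<^sup>2 * expectation (Q k))"
    using iQ by (simp add: sum_distrib_left)
  also have "\<dots> \<le> (\<Sum>k\<in>{m..n}. expectation (\<lambda>x. (S n x)\<^sup>2 * Q k x))"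
    by (intro sum_mono k_le)
  also have "\<dots> = expectation (\<lambda>x. (S n x)\<^sup>2 * (\<Sum>k\<in>{m..n}. Q k x))"
    using iSQ by (simp add: sum_distrib_left)
  also have "\<dots> \<le> expectation (\<lambda>x. (S n x)\<^sup>2)"
  proof (intro integral_mono)
    show "integrable M (\<lambda>x. (S n x)\<^sup>2 * (\<Sum>k\<in>{m..n}. Q k x))"
      using iSQ by (simp add: sum_distrib_left)
    show "(S n x)\<^sup>2 * (\<Sum>k\<in>{m..n}. Q k x) \<le> (S n x)\<^sup>2" for x
      using mult_left_mono[OF le1[of x], of "(S n x)\<^sup>2"] by simp
  qed (rule L2_integrable_sq[OF SL])
  also have "\<dots> = (\<Sum>j=m..<n. ip M (Z j) (Z j))"
    using Sn by (simp add: ip_def power2_eq_square)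
  finally have "e\<^sup>2 * prob ?A \<le> (\<Sum>j=m..<n. ip M (Z j) (Z j))" .
  then have "prob ?A \<le> (\<Sum>j=m..<n. ip M (Z j) (Z j)) / e\<^sup>2"
    using e by (simp add: field_simps)
  then show ?thesis by (simp add: S_def)
qed

text \<open>The maximal inequality bounds the probability of any excursion after \<open>m\<close> by
  a tail of the variance series, which tends to 0. So almost surely, for every bound
  \<open>1 / (n + 1)\<close>, some \<open>m\<close> has no later excursion of that size: this is
  Cauchy's criterion.\<close>

lemma (in prob_space) AE_summable_of_indep:
  fixes Z :: "nat \<Rightarrow> 'a \<Rightarrow> real"
  assumes ind: "indep_vars (\<lambda>_. borel) Z UNIV" and Z: "\<And>j. Z j \<in> L2 M"
    and mean: "\<And>j. expectation (Z j) = 0" and sm: "summable (\<lambda>j. ip M (Z j) (Z j))"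
  shows "AE x in M. summable (\<lambda>j. Z j x)"
proof -
  have Zm[measurable]: "Z j \<in> borel_measurable M" for j using Z by (auto simp: L2_def)
  define r where "r m = (\<Sum>j. ip M (Z (j + m)) (Z (j + m)))" for m
  have r0: "r \<longlonglongrightarrow> 0"
    unfolding r_def using suminf_exist_split2[OF sm] .
  have rle: "(\<Sum>j=m..<n. ip M (Z j) (Z j)) \<le> r m" for m n
  proof (cases "m \<le> n")
    case True
    have "(\<Sum>j=m..<n. ip M (Z j) (Z j)) = (\<Sum>j=0..<n-m. ip M (Z (j + m)) (Z (j + m)))"
      using sum.shift_bounds_nat_ivl[of "\<lambda>j. ip M (Z j) (Z j)" 0 m "n - m"] True by simp
    also have "\<dots> \<le> r m"
      unfolding r_def using summable_ignore_initial_segment[OF sm, of m] by (intro sum_le_suminf) auto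
    finally show ?thesis .
  next
    case False
    then show ?thesis
      unfolding r_def using suminf_nonneg[OF summable_ignore_initial_segment[OF sm, of m]] by simp
  qed
  have bad: "AE x in M. \<exists>m. \<forall>k\<ge>m. \<bar>\<Sum>j=m..<k. Z j x\<bar> < e" if e: "e > 0" for e
  proof -
    define B where "B m = {x\<in>space M. \<exists>k\<ge>m. e \<le> \<bar>\<Sum>j=m..<k. Z j x\<bar>}" for m
    have Bm[measurable]: "B m \<in> sets M" for m unfolding B_def by measurable
    have PB: "prob (B m) \<le> r m / e\<^sup>2" for m
    proof (rule LIMSEQ_le_const2)
      let ?C = "\<lambda>n. {x\<in>space M. \<exists>k\<in>{m..n}. e \<le> \<bar>\<Sum>j=m..<k. Z j x\<bar>}"
      have "(\<lambda>n. prob (?C n)) \<longlonglongrightarrow> prob (\<Union>n. ?C n)"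
      proof (rule finite_Lim_measure_incseq)
        have "?C n \<in> sets M" for n by measurable
        then show "range ?C \<subseteq> sets M" by auto
        show "incseq ?C" by (intro monoI) fastforce
      qed
      moreover have "(\<Union>n. ?C n) = B m" unfolding B_def by fastforce
      ultimately show "(\<lambda>n. prob (?C n)) \<longlonglongrightarrow> prob (B m)" by simp
      have "prob (?C n) \<le> r m / e\<^sup>2" for n
        using Kolmogorov_inequality[OF ind Z mean e, of m n] rle[of m n]
        by (rule order_trans[OF _ divide_right_mono]) auto
      then show "\<exists>N. \<forall>n\<ge>N. prob (?C n) \<le> r m / e\<^sup>2" by auto
    qed
    have "(\<lambda>m. r m / e\<^sup>2) \<longlonglongrightarrow> 0 / e\<^sup>2" by (intro tendsto_intros r0) (use e in auto)
    then have "prob (\<Inter>m. B m) \<le> 0"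
    proof (intro LIMSEQ_le_const)
      show "\<exists>N. \<forall>m\<ge>N. prob (\<Inter>m. B m) \<le> r m / e\<^sup>2"
      proof (intro exI[of _ 0] allI impI)
        fix m
        have "prob (\<Inter>m. B m) \<le> prob (B m)" by (intro finite_measure_mono) auto
        then show "prob (\<Inter>m. B m) \<le> r m / e\<^sup>2" using PB[of m] by linarith
      qed
    qed auto
    then have "prob (\<Inter>m. B m) = 0" using measure_nonneg[of M "\<Inter>m. B m"] by linarith
    then have "(\<Inter>m. B m) \<in> null_sets M" by (intro null_setsI) (auto simp: emeasure_eq_measure)
    then have "AE x in M. x \<notin> (\<Inter>m. B m)" by (rule AE_not_in)
    with AE_space show ?thesis
    proof eventually_elim
      case (elim x)
      then obtain m where "x \<notin> B m" by auto
      with elim(1) show ?case by (intro exI[of _ m]) (auto simp: B_def linorder_not_le[symmetric])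
    qed
  qed
  have "AE x in M. \<forall>n::nat. \<exists>m. \<forall>k\<ge>m. \<bar>\<Sum>j=m..<k. Z j x\<bar> < 1 / (n + 1)"
    unfolding AE_all_countable by (intro allI bad) simp
  then show ?thesis
  proof eventually_elim
    case (elim x)
    show ?case unfolding summable_Cauchy
    proof (intro allI impI)
      fix e :: real assume e: "e > 0"
      \<comment> \<open>Half of \<open>e\<close>, because a block sum is the difference of two
        partial sums that both start at \<open>m\<close>.\<close>
      obtain n :: nat where n: "1 / (real n + 1) < e / 2"
        using reals_Archimedean[of "e / 2"] e by (auto simp: inverse_eq_divide add.commute)
      from elim obtain m where m: "\<And>k. k \<ge> m \<Longrightarrow> \<bar>\<Sum>j=m..<k. Z j x\<bar> < 1 / (real n + 1)" by blast
      show "\<exists>N. \<forall>m\<ge>N. \<forall>n. norm (\<Sum>j=m..<n. Z j x) < e"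
      proof (intro exI[of _ m] allI impI)
        fix a b assume a: "m \<le> a"
        show "norm (\<Sum>j=a..<b. Z j x) < e"
        proof (cases "a \<le> b")
          case True
          have "(\<Sum>j=a..<b. Z j x) = (\<Sum>j=m..<b. Z j x) - (\<Sum>j=m..<a. Z j x)"
            using sum.atLeastLessThan_concat[OF a True, of "\<lambda>j. Z j x"] by simp
          then show ?thesis using m[OF a] m[of b] a True n by simp
        qed (use e in auto)
      qed
    qed
  qed
qed

text \<open>Almost sure convergence identifies the pointwise \<open>suminf\<close> with the limit;
  the value that it takes where the series diverges affects only a null set. The Cauchy bound in
  mean square is the tail of the variances, by orthogonality.\<close>

lemma (in prob_space) indep_series_L2:
  fixes Z :: "nat \<Rightarrow> 'a \<Rightarrow> real"
  assumes ind: "indep_vars (\<lambda>_. borel) Z UNIV" and Z: "\<And>j. Z j \<in> L2 M"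
    and mean: "\<And>j. expectation (Z j) = 0" and orth: "\<And>i j. i \<noteq> j \<Longrightarrow> ip M (Z i) (Z j) = 0"
    and sm: "summable (\<lambda>j. ip M (Z j) (Z j))"
  shows "(\<lambda>x. \<Sum>j. Z j x) \<in> L2 M"
    and "(\<lambda>n. ip M (\<lambda>x. (\<Sum>j<n. Z j x) - (\<Sum>j. Z j x)) (\<lambda>x. (\<Sum>j<n. Z j x) - (\<Sum>j. Z j x))) \<longlonglongrightarrow> 0"
proof -
  have Zm[measurable]: "Z j \<in> borel_measurable M" for j using Z by (auto simp: L2_def)
  define r where "r m = (\<Sum>j. ip M (Z (j + m)) (Z (j + m)))" for m
  have r0: "r \<longlonglongrightarrow> 0"
    unfolding r_def using suminf_exist_split2[OF sm] .
  have lim: "AE x in M. (\<lambda>n. \<Sum>j<n. Z j x) \<longlonglongrightarrow> (\<Sum>j. Z j x)"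
    using AE_summable_of_indep[OF ind Z mean sm] by eventually_elim (rule summable_LIMSEQ)
  have cau: "ip M (\<lambda>x. (\<Sum>j<n. Z j x) - (\<Sum>j<m. Z j x)) (\<lambda>x. (\<Sum>j<n. Z j x) - (\<Sum>j<m. Z j x)) \<le> r m"
    if mn: "m \<le> n" for m n
  proof -
    have "(\<Sum>j<n. Z j x) - (\<Sum>j<m. Z j x) = (\<Sum>j=m..<n. Z j x)" for x
      using sum.atLeastLessThan_concat[of 0 m n "\<lambda>j. Z j x"] mn by (simp add: lessThan_atLeast0)
    then have "ip M (\<lambda>x. (\<Sum>j<n. Z j x) - (\<Sum>j<m. Z j x)) (\<lambda>x. (\<Sum>j<n. Z j x) - (\<Sum>j<m. Z j x))
       = (\<Sum>i=m..<n. \<Sum>j=m..<n. ip M (Z i) (Z j))"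
      by (simp add: ip_sum_left ip_sum_right Z L2_sum)
    also have "\<dots> = (\<Sum>i=m..<n. \<Sum>j=m..<n. if j = i then ip M (Z i) (Z i) else 0)"
      by (intro sum.cong refl) (auto simp: orth)
    also have "\<dots> = (\<Sum>j=m..<n. ip M (Z j) (Z j))" by simp
    also have "\<dots> = (\<Sum>j=0..<n-m. ip M (Z (j + m)) (Z (j + m)))"
      using sum.shift_bounds_nat_ivl[of "\<lambda>j. ip M (Z j) (Z j)" 0 m "n - m"] mn by simp
    also have "\<dots> \<le> r m"
      unfolding r_def using summable_ignore_initial_segment[OF sm, of m] by (intro sum_le_suminf) auto
    finally show ?thesis .
  qed
  have SL: "(\<lambda>x. \<Sum>j<n. Z j x) \<in> L2 M" for n by (intro L2_sum Z)
  show "(\<lambda>x. \<Sum>j. Z j x) \<in> L2 M"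
    by (rule L2_limit(1)[OF SL _ lim cau r0]) auto
  show "(\<lambda>n. ip M (\<lambda>x. (\<Sum>j<n. Z j x) - (\<Sum>j. Z j x)) (\<lambda>x. (\<Sum>j<n. Z j x) - (\<Sum>j. Z j x))) \<longlonglongrightarrow> 0"
    by (rule L2_limit(2)[OF SL _ lim cau r0]) auto
qed

section \<open>Regular points, diagonalization and densities\<close>

text \<open>Near a regular point the local inverse is differentiable, hence carries the null set
  \<open>N\<close> to a null set. Lindelof's theorem reduces the cover by such neighbourhoods to a
  countable one.\<close>

lemma negligible_vimage_regular_points:
  fixes f :: "real^'n \<Rightarrow> real^'n" and J :: "real^'n \<Rightarrow> real^'n^'n"
  assumes der: "\<And>x. (f has_derivative (\<lambda>h. J x *v h)) (at x)"
    and cont: "continuous_on UNIV J" and N: "negligible N"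
  shows "negligible {x. f x \<in> N \<and> det (J x) \<noteq> 0}"
proof -
  define S where "S = {x. f x \<in> N \<and> det (J x) \<noteq> 0}"
  define f' where "f' x = Blinfun (\<lambda>h. J x *v h)" for x
  have bl: "bounded_linear (\<lambda>h. A *v h)" for A :: "real^'n^'n"
    by (rule matrix_vector_mul_bounded_linear)
  have f'app: "blinfun_apply (f' x) = (\<lambda>h. J x *v h)" for x
    unfolding f'_def by (rule bounded_linear_Blinfun_apply[OF bl])
  have contf': "continuous_on UNIV f'"
  proof (rule continuous_on_blinfun_componentwise)
    fix i :: "real^'n"
    have "bounded_linear (\<lambda>A::real^'n^'n. A *v i)"
      by (intro linear_conv_bounded_linear[THEN iffD1] linearI)
         (auto simp: matrix_vector_mult_def vec_eq_iff sum.distrib algebra_simps scaleR_sum_right sum_distrib_left)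
    from bounded_linear.continuous_on[OF this cont]
    show "continuous_on UNIV (\<lambda>x. blinfun_apply (f' x) i)" unfolding f'app .
  qed
  have ex: "\<exists>U. open U \<and> x \<in> U \<and> negligible (U \<inter> S)" if x: "x \<in> S" for x
  proof -
    from x have "invertible (J x)" by (simp add: S_def invertible_det_nz)
    then obtain A where A: "A ** J x = mat 1" unfolding invertible_def by auto
    have inv: "Blinfun (\<lambda>h. A *v h) o\<^sub>L f' x = id_blinfun"
      by (rule blinfun_eqI) (simp add: f'app bounded_linear_Blinfun_apply[OF bl] matrix_vector_mul_assoc A)
    obtain U V g g' where U: "open U" "x \<in> U" "open V" "homeomorphism U V f g"
      and g: "\<And>y. y \<in> V \<Longrightarrow> (g has_derivative (g' y)) (at y)"
    proof (rule inverse_function_theorem[of UNIV f f' x "Blinfun (\<lambda>h. A *v h)"])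
      show "(f has_derivative blinfun_apply (f' y)) (at y)" for y using der[of y] by (simp add: f'app)
      fix U V g g'
      assume "open U" "x \<in> U" "open V" "homeomorphism U V f g"
        "\<And>y. y \<in> V \<Longrightarrow> (g has_derivative (g' y)) (at y)"
      then show thesis by (rule that)
    qed (use contf' inv in auto)
    have "negligible (g ` (V \<inter> N))"
    proof (rule negligible_differentiable_image_negligible)
      show "negligible (V \<inter> N)" using N by (rule negligible_subset) auto
      show "g differentiable_on (V \<inter> N)"
        using g unfolding differentiable_on_def differentiable_def by (blast intro: has_derivative_at_withinI)
    qed simp
    moreover have "U \<inter> S \<subseteq> g ` (V \<inter> N)"
    proof
      fix y assume y: "y \<in> U \<inter> S"
      then have "f y \<in> V" "g (f y) = y" using U(4) by (auto simp: homeomorphism_def)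
      then show "y \<in> g ` (V \<inter> N)" using y by (auto simp: S_def intro!: image_eqI[of _ _ "f y"])
    qed
    ultimately have "negligible (U \<inter> S)" by (rule negligible_subset)
    with U show ?thesis by auto
  qed
  obtain \<F> where F: "\<F> \<subseteq> {U. open U \<and> negligible (U \<inter> S)}" "countable \<F>" "\<Union>\<F> = \<Union>{U. open U \<and> negligible (U \<inter> S)}"
    using Lindelof[of "{U. open U \<and> negligible (U \<inter> S)}"] by auto
  have "negligible (\<Union>((\<lambda>U. U \<inter> S) ` \<F>))"
    using F by (intro negligible_countable_Union) auto
  moreover have "S \<subseteq> \<Union>((\<lambda>U. U \<inter> S) ` \<F>)"
  proof
    fix x assume x: "x \<in> S"
    with ex[OF this] have "x \<in> \<Union>\<F>" unfolding F(3) by auto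
    then show "x \<in> \<Union>((\<lambda>U. U \<inter> S) ` \<F>)" using x by auto
  qed
  ultimately show ?thesis unfolding S_def[symmetric] by (rule negligible_subset)
qed

text \<open>A maximizer of the Rayleigh quotient on the unit sphere of \<open>S\<close> is an
  eigenvector, and its orthogonal complement in \<open>S\<close> is invariant and of smaller
  dimension.\<close>

lemma self_adjoint_eigenbasis:
  fixes f :: "'a::euclidean_space \<Rightarrow> 'a"
  assumes lin: "linear f" and sa: "\<And>x y. f x \<bullet> y = x \<bullet> f y"
    and "subspace S" "\<And>x. x \<in> S \<Longrightarrow> f x \<in> S"
  shows "\<exists>B\<subseteq>S. pairwise orthogonal B \<and> (\<forall>b\<in>B. norm b = 1 \<and> (\<exists>c. f b = c *\<^sub>R b)) \<and> span B = S"
  using assms(3,4)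
proof (induction "dim S" arbitrary: S rule: less_induct)
  case less
  interpret linear f by (rule lin)
  show ?case
  proof (cases "S = {0}")
    case True
    then show ?thesis by (intro exI[of _ "{}"]) auto
  next
    case False
    then obtain w where w: "w \<in> S" "w \<noteq> 0" using subspace_0[OF less.prems(1)] by auto
    let ?K = "sphere 0 1 \<inter> S"
    have "compact ?K" using closed_subspace[OF less.prems(1)] by (intro compact_Int_closed) auto
    moreover have "(1 / norm w) *\<^sub>R w \<in> ?K"
      using w less.prems(1) by (auto simp: subspace_scale)
    moreover have "continuous_on ?K (\<lambda>x. x \<bullet> f x)"
      by (intro continuous_intros linear_continuous_on linear_conv_bounded_linear[THEN iffD1] lin)
    ultimately obtain u where u: "u \<in> ?K" and umax: "\<And>x. x \<in> ?K \<Longrightarrow> x \<bullet> f x \<le> u \<bullet> f u"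
      using continuous_attains_sup[of ?K "\<lambda>x. x \<bullet> f x"] by blast
    have uS: "u \<in> S" and u1: "u \<bullet> u = 1" "norm u = 1" using u by (auto simp: dot_square_norm)
    define c where "c = u \<bullet> f u"
    have le: "x \<bullet> f x \<le> c * (x \<bullet> x)" if "x \<in> S" for x
    proof (cases "x = 0")
      case False
      have "((1 / norm x) *\<^sub>R x) \<bullet> f ((1 / norm x) *\<^sub>R x) \<le> c"
        unfolding c_def by (rule umax) (use False that less.prems(1) in \<open>auto simp: subspace_scale\<close>)
      then have "(x \<bullet> f x) / (norm x * norm x) \<le> c" by (simp add: scale)
      then show ?thesis using False by (simp add: divide_le_eq dot_square_norm power2_eq_square)
    qed (simp add: zero)
    have orth: "v \<bullet> f u = 0" if v: "v \<in> S" "v \<bullet> u = 0" for v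
    proof (rule ccontr)
      assume ne: "v \<bullet> f u \<noteq> 0"
      define p where "p = v \<bullet> f u"
      define q where "q = c * (v \<bullet> v) - v \<bullet> f v"
      \<comment> \<open>Maximality of \<open>u\<close>, tested at the perturbed vector
        \<open>u + t *\<^sub>R v\<close>; the constant terms cancel.\<close>
      have ineq: "2 * t * p \<le> t * t * q" for t
      proof -
        have "(u + t *\<^sub>R v) \<bullet> f (u + t *\<^sub>R v) \<le> c * ((u + t *\<^sub>R v) \<bullet> (u + t *\<^sub>R v))"
          using uS v less.prems(1) by (intro le) (auto simp: subspace_add subspace_scale)
        moreover have "(u + t *\<^sub>R v) \<bullet> f (u + t *\<^sub>R v) = c + 2 * t * p + t * t * (v \<bullet> f v)"
          using sa[of u v] by (simp add: add scale inner_add_left inner_add_right p_def c_def inner_commute[of "f u" v] algebra_simps)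
        moreover have "(u + t *\<^sub>R v) \<bullet> (u + t *\<^sub>R v) = 1 + t * t * (v \<bullet> v)"
          using v u1 by (simp add: inner_add_left inner_add_right inner_commute[of u v])
        ultimately have "c + 2 * t * p + t * t * (v \<bullet> f v) \<le> c * (1 + t * t * (v \<bullet> v))" by (simp only:)
        then show ?thesis unfolding q_def by (simp add: algebra_simps)
      qed
      \<comment> \<open>A step size for which the quadratic term is at most half of the linear one:
        \<open>s * s * \<bar>q\<bar> \<le> s * p\<close>. The added 1 covers
        \<open>q = 0\<close>.\<close>
      define s where "s = p / (\<bar>q\<bar> + 1)"
      have "2 * s * p \<le> s * s * \<bar>q\<bar>"
        using ineq[of s] mult_left_mono[OF abs_ge_self[of q], of "s * s"] by simp
      also have "s * s * \<bar>q\<bar> \<le> s * s * (\<bar>q\<bar> + 1)" by (intro mult_left_mono) auto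
      also have "\<dots> = s * p"
      proof -
        have "s * (\<bar>q\<bar> + 1) = p" unfolding s_def by simp
        then show ?thesis by (simp only: mult.assoc)
      qed
      finally have "s * p \<le> 0" by linarith
      moreover have "s * p = p\<^sup>2 / (\<bar>q\<bar> + 1)" by (simp add: s_def power2_eq_square)
      ultimately have "p\<^sup>2 / (\<bar>q\<bar> + 1) \<le> 0" by simp
      moreover have "\<bar>q\<bar> + 1 > 0" by simp
      ultimately have "p\<^sup>2 \<le> 0" by (simp only: pos_divide_le_eq mult_zero_left)
      then show False using ne by (simp add: p_def)
    qed
    have fu: "f u = c *\<^sub>R u"
    proof -
      let ?v = "f u - c *\<^sub>R u"
      have v: "?v \<in> S" "?v \<bullet> u = 0"
        using uS less.prems u1 by (auto simp: subspace_diff subspace_scale inner_diff_left c_def inner_commute[of "f u" u])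
      have "?v \<bullet> ?v = ?v \<bullet> f u - c * (?v \<bullet> u)" by (simp add: inner_diff_right)
      then have "?v \<bullet> ?v = 0" using orth[OF v] v(2) by simp
      then show ?thesis by simp
    qed
    define S' where "S' = {x\<in>S. x \<bullet> u = 0}"
    have subS': "subspace S'"
      using less.prems(1) unfolding S'_def subspace_def by (auto simp: inner_add_left)
    have "S' \<subseteq> S" "u \<notin> S'" using u1 by (auto simp: S'_def)
    then have "dim S' < dim S"
      using uS subS' less.prems(1) by (intro dim_psubset) (auto simp: span_eq_iff[THEN iffD2])
    moreover have "f x \<in> S'" if "x \<in> S'" for x
      using that less.prems(2) sa[of x u] fu by (auto simp: S'_def)
    ultimately obtain B where B: "B \<subseteq> S'" "pairwise orthogonal B" "\<And>b. b \<in> B \<Longrightarrow> norm b = 1 \<and> (\<exists>c. f b = c *\<^sub>R b)" "span B = S'"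
      using less.hyps[OF _ subS'] by metis
    show ?thesis
    proof (intro exI[of _ "insert u B"] conjI)
      show "insert u B \<subseteq> S" using B(1) uS by (auto simp: S'_def)
      show "pairwise orthogonal (insert u B)"
        using B(1,2) by (auto simp: pairwise_insert orthogonal_def S'_def inner_commute)
      show "\<forall>b\<in>insert u B. norm b = 1 \<and> (\<exists>c. f b = c *\<^sub>R b)"
        using B(3) u1 fu by auto
      show "span (insert u B) = S"
      proof
        show "span (insert u B) \<subseteq> S"
          using B(1) uS less.prems(1) by (intro span_minimal) (auto simp: S'_def)
        show "S \<subseteq> span (insert u B)"
        proof
          fix x assume x: "x \<in> S"
          have "x - (x \<bullet> u) *\<^sub>R u \<in> S'"
            using x uS less.prems(1) u1 by (auto simp: S'_def subspace_diff subspace_scale inner_diff_left)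
          then show "x \<in> span (insert u B)"
            using B(4) by (auto simp: span_insert)
        qed
      qed
    qed
  qed
qed

lemma symmetric_matrix_diagonalization:
  fixes T :: "real^'n^'n"
  assumes sym: "transpose T = T"
  obtains u :: "'n \<Rightarrow> real^'n" and b :: "'n \<Rightarrow> real"
  where "\<And>p q. u p \<bullet> u q = (if p = q then 1 else 0)"
    and "\<And>p. T *v u p = b p *\<^sub>R u p"
    and "\<And>v. v = (\<Sum>p\<in>UNIV. (v \<bullet> u p) *\<^sub>R u p)"
proof -
  have sa: "(T *v x) \<bullet> y = x \<bullet> (T *v y)" for x y
    by (metis dot_lmul_matrix sym transpose_matrix_vector)
  obtain B where B: "pairwise orthogonal B" "\<And>b. b \<in> B \<Longrightarrow> norm b = 1 \<and> (\<exists>c. T *v b = c *\<^sub>R b)" "span B = UNIV"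
    using self_adjoint_eigenbasis[of "\<lambda>x. T *v x" UNIV] sa by auto
  have ind: "independent B" using B(1) B(2)[of 0] by (intro pairwise_orthogonal_independent) auto
  have "finite B" using ind by (rule independent_imp_finite)
  have "card B = dim (span B)" using dim_span_eq_card_independent[OF ind] by simp
  then have "card B = CARD('n)" using B(3) by simp
  then obtain u where u: "bij_betw u (UNIV::'n set) B"
    using \<open>finite B\<close> finite_same_card_bij[of "UNIV::'n set" B] by auto
  have uB: "u p \<in> B" for p using u by (auto simp: bij_betw_def)
  have on: "u p \<bullet> u q = (if p = q then 1 else 0)" for p q
  proof (cases "p = q")
    case True
    then show ?thesis using B(2)[OF uB[of p]] by (simp add: dot_square_norm)
  next
    case False
    then have "u p \<noteq> u q" using u by (auto simp: bij_betw_def inj_on_def)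
    then show ?thesis using False B(1) uB by (auto simp: pairwise_def orthogonal_def)
  qed
  obtain b where b: "\<And>p. T *v u p = b p *\<^sub>R u p"
    using B(2)[OF uB] by metis
  have "v = (\<Sum>p\<in>UNIV. (v \<bullet> u p) *\<^sub>R u p)" for v
  proof -
    have "v = (\<Sum>b\<in>B. (v \<bullet> b) *\<^sub>R b)"
      using orthonormal_basis_expand[of B v] B \<open>finite B\<close> by auto
    also have "\<dots> = (\<Sum>p\<in>UNIV. (v \<bullet> u p) *\<^sub>R u p)"
      using sum.reindex_bij_betw[OF u, of "\<lambda>b. (v \<bullet> b) *\<^sub>R b"] by simp
    finally show ?thesis .
  qed
  from that[OF on b this] show thesis .
qed

text \<open>The determinant is a polynomial in \<open>t\<close> whose top coefficient is
  \<open>det C\<close>. Passing to \<open>s = 1 / t\<close> reverses the coefficients, so that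
  \<open>det C\<close> becomes the value at 0 and no degree has to be computed; only
  \<open>t = 0\<close> needs separate treatment.\<close>

lemma finite_det_pencil_zeros:
  fixes C D :: "real^'n^'n"
  assumes C: "det C \<noteq> 0"
  shows "finite {t. det (\<chi> i j. t * C $ i $ j + D $ i $ j) = 0}"
proof -
  define q where "q = (\<Sum>p | p permutes (UNIV::'n set). smult (of_int (sign p)) (\<Prod>i\<in>UNIV. [:C $ i $ p i, D $ i $ p i:]))"
  have q: "poly q s = det (\<chi> i j. C $ i $ j + s * D $ i $ j)" for s
    unfolding q_def det_def by (simp add: poly_sum poly_prod)
  have "poly q 0 = det C" unfolding q by (simp add: vec_lambda_eta)
  then have "q \<noteq> 0" using C by auto
  then have fin: "finite {s. poly q s = 0}" by (rule poly_roots_finite)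
  have "{t. det (\<chi> i j. t * C $ i $ j + D $ i $ j) = 0} \<subseteq> insert 0 (inverse ` {s. poly q s = 0})"
  proof
    fix t assume t: "t \<in> {t. det (\<chi> i j. t * C $ i $ j + D $ i $ j) = 0}"
    show "t \<in> insert 0 (inverse ` {s. poly q s = 0})"
    proof (cases "t = 0")
      case False
      have "(\<chi> i j. t * C $ i $ j + D $ i $ j) = (\<chi> i. t *s (\<chi> j. C $ i $ j + inverse t * D $ i $ j))"
        using False by (simp add: vec_eq_iff field_simps)
      then have "det (\<chi> i j. t * C $ i $ j + D $ i $ j) = (\<Prod>i\<in>(UNIV::'n set). t) * poly q (inverse t)"
        unfolding q by (simp add: det_rows_mul)
      then have "poly q (inverse t) = 0" using t False by simp
      then show ?thesis by (auto intro!: image_eqI[of _ _ "inverse t"])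
    qed simp
  qed
  then show ?thesis using fin by (meson finite_imageI finite_insert finite_subset)
qed

section \<open>Measurability and product densities in coordinates\<close>

lemma borel_measurable_vec_lambda:
  fixes f :: "'n::finite \<Rightarrow> 'a \<Rightarrow> real"
  assumes [measurable]: "\<And>i. f i \<in> borel_measurable N"
  shows "(\<lambda>x. \<chi> i. f i x) \<in> borel_measurable N"
proof (subst borel_measurable_euclidean_space, safe)
  fix i :: "real^'n" assume "i \<in> Basis"
  then obtain k where "i = axis k 1" by (auto simp: Basis_vec_def)
  then have "(\<lambda>x. (\<chi> i. f i x) \<bullet> i) = (\<lambda>x. f k x)" by (auto simp: inner_axis)
  then show "(\<lambda>x. (\<chi> i. f i x) \<bullet> i) \<in> borel_measurable N" by simp
qed

lemma borel_measurable_det: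
  fixes f :: "'n::finite \<Rightarrow> 'n \<Rightarrow> 'a \<Rightarrow> real"
  assumes [measurable]: "\<And>i j. f i j \<in> borel_measurable N"
  shows "(\<lambda>x. det (\<chi> i j. f i j x)) \<in> borel_measurable N"
  unfolding det_def by simp

lemma lborel_vec_eq_distr_PiM:
  "(lborel :: (real^'n) measure) = distr (PiM UNIV (\<lambda>_. lborel)) borel vec_lambda"
proof (rule lborel_eqI)
  interpret product_sigma_finite "\<lambda>_::'n. lborel :: real measure" ..
  have m[measurable]: "(vec_lambda :: ('n \<Rightarrow> real) \<Rightarrow> _) \<in> PiM UNIV (\<lambda>_. lborel) \<rightarrow>\<^sub>M borel"
    using borel_measurable_vec_lambda[of "\<lambda>i x. x i" "PiM UNIV (\<lambda>_::'n. lborel)"] by simp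
  fix l u :: "real^'n" assume lu: "\<And>b. b \<in> Basis \<Longrightarrow> l \<bullet> b \<le> u \<bullet> b"
  have lu': "l $ i \<le> u $ i" for i using lu[of "axis i 1"] by (simp add: inner_axis axis_in_Basis_iff)
  have "vec_lambda -` box l u \<inter> space (PiM UNIV (\<lambda>_. lborel)) = (\<Pi>\<^sub>E i\<in>UNIV. {l $ i<..<u $ i})"
    by (auto simp: space_PiM mem_box_cart PiE_iff)
  then have "emeasure (distr (PiM UNIV (\<lambda>_. lborel)) borel vec_lambda) (box l u) = emeasure (PiM UNIV (\<lambda>_. lborel)) (\<Pi>\<^sub>E i\<in>UNIV. {l $ i<..<u $ i})"
    by (simp add: emeasure_distr)
  also have "\<dots> = (\<Prod>i\<in>UNIV. ennreal (u $ i - l $ i))"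
    using lu' by (subst emeasure_PiM) auto
  also have "\<dots> = ennreal (\<Prod>i\<in>UNIV. u $ i - l $ i)"
    using lu' by (subst prod_ennreal) auto
  also have "(\<Prod>i\<in>UNIV. u $ i - l $ i) = (\<Prod>b\<in>Basis. (u - l) \<bullet> b)"
  proof -
    have B: "Basis = (\<lambda>i::'n. axis i (1::real)) ` UNIV" by (auto simp: Basis_vec_def)
    have "inj (\<lambda>i::'n. axis i (1::real))" by (auto simp: inj_on_def axis_eq_axis)
    then show ?thesis unfolding B by (subst prod.reindex) (auto simp: inner_axis)
  qed
  finally show "emeasure (distr (PiM UNIV (\<lambda>_. lborel)) borel vec_lambda) (box l u) = (\<Prod>b\<in>Basis. (u - l) \<bullet> b)" .
qed simp

lemma PiM_density:
  fixes M :: "'i \<Rightarrow> 'a measure"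
  assumes I: "finite I" and "\<And>i. sigma_finite_measure (M i)"
    and f[measurable]: "\<And>i. f i \<in> borel_measurable (M i)"
    and "\<And>i. sigma_finite_measure (density (M i) (f i))"
  shows "PiM I (\<lambda>i. density (M i) (f i)) = density (PiM I M) (\<lambda>x. \<Prod>i\<in>I. f i (x i))"
proof -
  interpret M: product_sigma_finite M by (rule product_sigma_finite.intro) fact
  interpret D: product_sigma_finite "\<lambda>i. density (M i) (f i)" by (rule product_sigma_finite.intro) fact
  have pm[measurable]: "(\<lambda>x. \<Prod>i\<in>I. f i (x i)) \<in> borel_measurable (PiM I M)"
    by measurable
  show ?thesis
  proof (rule D.PiM_eqI[symmetric, OF I])
    show "sets (density (PiM I M) (\<lambda>x. \<Prod>i\<in>I. f i (x i))) = sets (PiM I (\<lambda>i. density (M i) (f i)))"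
      by (simp cong: sets_PiM_cong)
    fix A assume "\<And>i. i \<in> I \<Longrightarrow> A i \<in> sets (density (M i) (f i))"
    then have A[measurable]: "\<And>i. i \<in> I \<Longrightarrow> A i \<in> sets (M i)" by simp
    have "emeasure (density (PiM I M) (\<lambda>x. \<Prod>i\<in>I. f i (x i))) (Pi\<^sub>E I A)
      = (\<integral>\<^sup>+x. (\<Prod>i\<in>I. f i (x i)) * indicator (Pi\<^sub>E I A) x \<partial>PiM I M)"
      using A I by (intro emeasure_density pm sets_PiM_I_finite) auto
    also have "\<dots> = (\<integral>\<^sup>+x. (\<Prod>i\<in>I. f i (x i) * indicator (A i) (x i)) \<partial>PiM I M)"
    proof (rule nn_integral_cong)
      fix x assume x: "x \<in> space (PiM I M)"
      have "(indicator (Pi\<^sub>E I A) x :: ennreal) = (\<Prod>i\<in>I. indicator (A i) (x i))"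
      proof (cases "x \<in> Pi\<^sub>E I A")
        case True
        then show ?thesis by (simp add: PiE_iff)
      next
        case False
        then obtain i where "i \<in> I" "x i \<notin> A i" using x by (auto simp: PiE_iff space_PiM)
        then have "(\<Prod>i\<in>I. indicator (A i) (x i) :: ennreal) = 0"
          using I by (intro prod_zero bexI[of _ i]) auto
        then show ?thesis using False by simp
      qed
      then show "(\<Prod>i\<in>I. f i (x i)) * indicator (Pi\<^sub>E I A) x = (\<Prod>i\<in>I. f i (x i) * indicator (A i) (x i))"
        by (simp add: prod.distrib)
    qed
    also have "\<dots> = (\<Prod>i\<in>I. \<integral>\<^sup>+x. f i x * indicator (A i) x \<partial>M i)"
      using I by (intro M.product_nn_integral_prod) auto
    also have "\<dots> = (\<Prod>i\<in>I. emeasure (density (M i) (f i)) (A i))"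
      by (intro prod.cong refl) (simp add: emeasure_density)
    finally show "emeasure (density (PiM I M) (\<lambda>x. \<Prod>i\<in>I. f i (x i))) (Pi\<^sub>E I A) = (\<Prod>i\<in>I. emeasure (density (M i) (f i)) (A i))" .
  qed
qed

text \<open>Independence makes the joint law a product of densities, hence a density with respect to
  product Lebesgue measure, and \<open>vec_lambda\<close> carries the latter to
  \<open>lborel\<close> on vectors.\<close>

lemma (in prob_space) indep_densities_null_sets_vec:
  fixes e :: "'n::finite \<Rightarrow> 'a \<Rightarrow> real"
  assumes ind: "indep_vars (\<lambda>_. borel) e UNIV"
    and d: "\<And>l. distributed M lborel (e l) (f l)"
    and N: "N \<in> null_sets (lborel :: (real^'n) measure)"
  shows "N \<in> null_sets (distr M borel (\<lambda>x. \<chi> l. e l x))"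
proof -
  have em[measurable]: "e l \<in> borel_measurable M" for l
    using distributed_measurable[OF d] by simp
  have fm[measurable]: "f l \<in> borel_measurable borel" for l
    using distributed_borel_measurable[OF d] by simp
  have N': "N \<in> sets borel" using N by auto
  have dl: "distr M borel (e l) = density lborel (f l)" for l
    using distributed_distr_eq_density[OF d[of l]] by (simp cong: distr_cong)
  have ps: "prob_space (density lborel (f l))" for l
    unfolding dl[symmetric] by (rule prob_space_distr) simp
  have vm[measurable]: "(vec_lambda :: ('n \<Rightarrow> real) \<Rightarrow> _) \<in> PiM UNIV (\<lambda>_. borel) \<rightarrow>\<^sub>M borel"
    using borel_measurable_vec_lambda[of "\<lambda>i x. x i" "PiM UNIV (\<lambda>_::'n. borel)"] by simp
  have sb: "sets (PiM UNIV (\<lambda>_::'n. lborel :: real measure)) = sets (PiM UNIV (\<lambda>_. borel))"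
    by (intro sets_PiM_cong) auto
  have "distr M (PiM UNIV (\<lambda>_. borel)) (\<lambda>x. \<lambda>l\<in>UNIV. e l x) = PiM UNIV (\<lambda>l. density lborel (f l))"
    using ind by (subst (asm) indep_vars_iff_distr_eq_PiM) (auto simp: dl)
  also have "\<dots> = density (PiM UNIV (\<lambda>_. lborel)) (\<lambda>x. \<Prod>l\<in>UNIV. f l (x l))"
    using ps by (intro PiM_density) (auto intro: prob_space_imp_sigma_finite lborel.sigma_finite_measure_axioms)
  finally have eq: "distr M (PiM UNIV (\<lambda>_. borel)) (\<lambda>x l. e l x) = density (PiM UNIV (\<lambda>_. lborel)) (\<lambda>x. \<Prod>l\<in>UNIV. f l (x l))"
    by (simp add: restrict_def)
  let ?V = "vec_lambda -` N :: ('n \<Rightarrow> real) set"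
  have Vs: "?V \<in> sets (PiM UNIV (\<lambda>_. borel))"
    using measurable_sets[OF vm N'] by (simp add: space_PiM)
  have "?V \<in> null_sets (PiM UNIV (\<lambda>_. lborel))"
  proof (rule null_setsI)
    have "emeasure lborel N = emeasure (PiM UNIV (\<lambda>_. lborel)) (vec_lambda -` N \<inter> space (PiM UNIV (\<lambda>_::'n. lborel :: real measure)))"
      unfolding lborel_vec_eq_distr_PiM
      by (intro emeasure_distr N') (simp add: measurable_cong_sets[OF sb refl])
    then show "emeasure (PiM UNIV (\<lambda>_. lborel)) ?V = 0" using null_setsD1[OF N] by (simp add: space_PiM)
    show "?V \<in> sets (PiM UNIV (\<lambda>_. lborel))" using Vs sb by simp
  qed
  then have "?V \<in> null_sets (density (PiM UNIV (\<lambda>_. lborel)) (\<lambda>x. \<Prod>l\<in>UNIV. f l (x l)))"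
    by (intro absolutely_continuousI_density[unfolded absolutely_continuous_def, THEN subsetD]) (auto intro!: borel_measurable_prod_ennreal)
  then have "?V \<in> null_sets (distr M (PiM UNIV (\<lambda>_. borel)) (\<lambda>x l. e l x))" unfolding eq .
  moreover have Em: "(\<lambda>x l. e l x) \<in> M \<rightarrow>\<^sub>M PiM UNIV (\<lambda>_. borel)"
  proof -
    have "(\<lambda>x. \<lambda>l\<in>UNIV. e l x) \<in> M \<rightarrow>\<^sub>M PiM UNIV (\<lambda>_. borel)"
      by (rule measurable_restrict) (rule em)
    then show ?thesis by (simp only: restrict_UNIV)
  qed
  ultimately have "emeasure M ((\<lambda>x l. e l x) -` ?V \<inter> space M) = 0"
    using Vs by (auto simp: null_sets_def emeasure_distr)
  moreover have "(\<lambda>x. \<chi> l. e l x) -` N \<inter> space M = (\<lambda>x l. e l x) -` ?V \<inter> space M" by auto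
  moreover have "(\<lambda>x. \<chi> l. e l x) \<in> borel_measurable M" using measurable_compose[OF Em vm] .
  ultimately show ?thesis using N' by (intro null_setsI) (auto simp: emeasure_distr)
qed

section \<open>Gaussian spaces\<close>

text \<open>A Gaussian Hilbert space. The condition \<open>V_char\<close> encodes centering and
  normality at once, includes variance 0, and needs no parameter \<open>t\<close> because
  \<open>V\<close> is closed under scaling. \<open>V_closed\<close> asks for approximation in
  squared distance.\<close>

locale gaussian_space = prob_space M for M :: "'a measure" +
  fixes V :: "('a \<Rightarrow> real) set"
  assumes V_L2: "X \<in> V \<Longrightarrow> X \<in> L2 M"
    and V_zero: "(\<lambda>x. 0) \<in> V"
    and V_add: "X \<in> V \<Longrightarrow> Y \<in> V \<Longrightarrow> (\<lambda>x. X x + Y x) \<in> V"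
    and V_cmult: "X \<in> V \<Longrightarrow> (\<lambda>x. c * X x) \<in> V"
    and V_closed: "X \<in> L2 M \<Longrightarrow> (\<And>e. e > 0 \<Longrightarrow> \<exists>Y\<in>V. ip M (\<lambda>x. Y x - X x) (\<lambda>x. Y x - X x) < e) \<Longrightarrow> X \<in> V"
    and V_char: "X \<in> V \<Longrightarrow> (CLINT x|M. iexp (X x)) = exp (- (ip M X X) / 2)"
begin

lemma V_diff: "X \<in> V \<Longrightarrow> Y \<in> V \<Longrightarrow> (\<lambda>x. X x - Y x) \<in> V"
  using V_add[of X "\<lambda>x. (-1) * Y x"] V_cmult[of Y "-1"] by simp

lemma V_sum: "(\<And>i. i \<in> A \<Longrightarrow> X i \<in> V) \<Longrightarrow> (\<lambda>x. \<Sum>i\<in>A. X i x) \<in> V"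
  by (induction A rule: infinite_finite_induct) (auto intro: V_add V_zero)

lemma V_measurable[measurable_dest]: "X \<in> V \<Longrightarrow> X \<in> borel_measurable M"
  using V_L2 by (auto simp: L2_def)

section \<open>Moments and Wick squares\<close>

lemma V_std_normal:
  assumes X: "X \<in> V" and 1: "ip M X X = 1"
  shows "distributed M lborel X (normal_density 0 1)"
proof -
  have [measurable]: "X \<in> borel_measurable M" using X by measurable
  have "distr M borel X = std_normal_distribution"
  proof (rule Levy_uniqueness)
    show "char (distr M borel X) = char std_normal_distribution"
    proof
      fix t
      have "char (distr M borel X) t = (CLINT x|M. iexp (t * X x))"
        unfolding char_def by (simp add: integral_distr)
      also have "\<dots> = exp (- (t\<^sup>2) / 2)"
        using V_char[OF V_cmult[OF X, of t]] 1 by (simp add: ip_cmult_left ip_cmult_right power2_eq_square exp_of_real[symmetric])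
      finally show "char (distr M borel X) t = char std_normal_distribution t"
        by (simp add: char_std_normal_distribution exp_of_real)
    qed
  qed (auto intro: real_distribution_distr real_dist_normal_dist)
  then show ?thesis
    unfolding distributed_def by (simp cong: distr_cong)
qed

lemma V_moments:
  assumes X: "X \<in> V"
  shows "expectation X = 0" "integrable M (\<lambda>x. X x ^ 4)" "expectation (\<lambda>x. X x ^ 4) = 3 * (ip M X X)\<^sup>2"
proof -
  have [measurable]: "X \<in> borel_measurable M" using X by measurable
  have "expectation X = 0 \<and> integrable M (\<lambda>x. X x ^ 4) \<and> expectation (\<lambda>x. X x ^ 4) = 3 * (ip M X X)\<^sup>2"
  proof (cases "ip M X X = 0")
    case True
    then have ae: "AE x in M. X x = 0" using ip_self_eq_0_iff[OF V_L2[OF X]] by simp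
    have "expectation X = expectation (\<lambda>x. 0)" using ae by (intro integral_cong_AE) auto
    moreover have "integrable M (\<lambda>x. X x ^ 4) \<longleftrightarrow> integrable M (\<lambda>x. 0 :: real)"
      using ae by (intro integrable_cong_AE) auto
    moreover have "expectation (\<lambda>x. X x ^ 4) = expectation (\<lambda>x. 0)"
      using ae by (intro integral_cong_AE) auto
    ultimately show ?thesis using True by simp
  next
    case False
    define s where "s = sqrt (ip M X X)"
    have s: "s > 0" "s * s = ip M X X" using False ip_nonneg[of M X] by (auto simp: s_def order_less_le)
    define Y where "Y x = (1 / s) * X x" for x
    have XY: "X x = s * Y x" for x using s by (simp add: Y_def)
    have Y: "Y \<in> V" unfolding Y_def[abs_def] by (intro V_cmult X)
    have "ip M Y Y = 1"
      unfolding Y_def[abs_def] ip_cmult_left ip_cmult_right using s by (simp add: s(2)[symmetric])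
    then have d: "distributed M lborel Y (normal_density 0 1)" using V_std_normal[OF Y] by simp
    have "expectation (\<lambda>x. Y x) = 0"
      using distributed_integral[OF d, of "\<lambda>x. x"] integral_normal_moment_nz_1[of 1 0] by (simp add: normal_density_nonneg)
    \<comment> \<open>The even moment \<open>(2 * k)! / (2 ^ k * k!)\<close> of the standard normal
      law at \<open>k = 2\<close>.\<close>
    moreover have m: "has_bochner_integral lborel (\<lambda>x. normal_density 0 1 x * x ^ 4) 3"
      using std_normal_moment_even[of 2] by (simp add: fact_numeral)
    have "integrable M (\<lambda>x. Y x ^ 4)"
      using distributed_integrable[OF d, of "\<lambda>x. x ^ 4"] m by (auto simp: normal_density_nonneg has_bochner_integral_iff)
    moreover have "expectation (\<lambda>x. Y x ^ 4) = 3"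
      using distributed_integral[OF d, of "\<lambda>x. x ^ 4"] m by (auto simp: normal_density_nonneg has_bochner_integral_iff)
    moreover have XY': "X = (\<lambda>x. s * Y x)" by (rule ext) (rule XY)
    moreover have "s ^ 4 = (ip M X X)\<^sup>2"
      by (simp add: s(2)[symmetric] power2_eq_square power4_eq_xxxx)
    moreover have "expectation X = s * expectation Y"
      by (subst XY') simp
    moreover have "expectation (\<lambda>x. X x ^ 4) = s ^ 4 * expectation (\<lambda>x. Y x ^ 4)"
      by (subst XY') (simp add: power_mult_distrib)
    moreover have "integrable M (\<lambda>x. Y x ^ 4) \<Longrightarrow> integrable M (\<lambda>x. X x ^ 4)"
      by (subst XY') (simp add: power_mult_distrib)
    ultimately show ?thesis by simp
  qed
  then show "expectation X = 0" "integrable M (\<lambda>x. X x ^ 4)" "expectation (\<lambda>x. X x ^ 4) = 3 * (ip M X X)\<^sup>2" by auto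
qed

lemma V_square_L2:
  assumes X: "X \<in> V" shows "(\<lambda>x. (X x)\<^sup>2) \<in> L2 M"
proof -
  have [measurable]: "X \<in> borel_measurable M" using X by measurable
  show ?thesis unfolding L2_def using V_moments(2)[OF X] by (simp add: power_mult[symmetric])
qed

lemma V_wick_L2: "X \<in> V \<Longrightarrow> (\<lambda>x. (X x)\<^sup>2 - 1) \<in> L2 M"
  by (intro L2_diff V_square_L2) (auto simp: L2_def)

lemma V_wick_mean:
  assumes "X \<in> V" "ip M X X = 1"
  shows "expectation (\<lambda>x. (X x)\<^sup>2 - 1) = 0"
  using assms L2_integrable_sq[OF V_L2[OF assms(1)]] by (simp add: ip_def power2_eq_square prob_space)

text \<open>Polarization of the fourth moment: \<open>(X + Y)\<^sup>4 + (X - Y)\<^sup>4 = 2 X\<^sup>4 + 12 X\<^sup>2 Y\<^sup>2 + 2 Y\<^sup>4\<close>.\<close>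

lemma V_square_square:
  assumes X: "X \<in> V" and Y: "Y \<in> V"
  shows "ip M (\<lambda>x. (X x)\<^sup>2) (\<lambda>x. (Y x)\<^sup>2) = ip M X X * ip M Y Y + 2 * (ip M X Y)\<^sup>2"
proof -
  let ?P = "\<lambda>x. X x + Y x" and ?N = "\<lambda>x. X x - Y x"
  have P: "?P \<in> V" and N: "?N \<in> V" using X Y by (auto intro: V_add V_diff)
  have i: "integrable M (\<lambda>x. (X x)\<^sup>2 * (Y x)\<^sup>2)"
    by (intro L2_integrable_mult V_square_L2 X Y)
  have "12 * expectation (\<lambda>x. (X x)\<^sup>2 * (Y x)\<^sup>2) = expectation (\<lambda>x. 12 * ((X x)\<^sup>2 * (Y x)\<^sup>2))" by simp
  also have "\<dots> = expectation (\<lambda>x. ?P x ^ 4 + ?N x ^ 4 - 2 * X x ^ 4 - 2 * Y x ^ 4)"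
    by (intro Bochner_Integration.integral_cong refl) (simp add: power2_eq_square power4_eq_xxxx algebra_simps)
  also have "\<dots> = 3 * (ip M ?P ?P)\<^sup>2 + 3 * (ip M ?N ?N)\<^sup>2 - 6 * (ip M X X)\<^sup>2 - 6 * (ip M Y Y)\<^sup>2"
    using V_moments(2,3)[OF P] V_moments(2,3)[OF N] V_moments(2,3)[OF X] V_moments(2,3)[OF Y] by simp
  also have "ip M ?P ?P = ip M X X + 2 * ip M X Y + ip M Y Y"
    using V_L2[OF X] V_L2[OF Y] by (simp add: ip_add_left ip_add_right L2_add ip_commute[of M Y X])
  also have "ip M ?N ?N = ip M X X - 2 * ip M X Y + ip M Y Y"
    using V_L2[OF X] V_L2[OF Y] by (simp add: ip_diff_left ip_diff_right L2_diff ip_commute[of M Y X])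
  finally have "12 * expectation (\<lambda>x. (X x)\<^sup>2 * (Y x)\<^sup>2) = 12 * (ip M X X * ip M Y Y + 2 * (ip M X Y)\<^sup>2)"
    by (simp add: power2_eq_square algebra_simps)
  then show ?thesis by (simp add: ip_def)
qed

text \<open>For unit vectors the first term of the fourth-moment formula is 1, and centering cancels
  exactly this. So the Wick squares of orthogonal variables are orthogonal.\<close>

lemma V_wick:
  assumes X: "X \<in> V" "ip M X X = 1" and Y: "Y \<in> V" "ip M Y Y = 1"
  shows "ip M (\<lambda>x. (X x)\<^sup>2 - 1) (\<lambda>x. (Y x)\<^sup>2 - 1) = 2 * (ip M X Y)\<^sup>2"
proof -
  have c: "(\<lambda>x. 1) \<in> L2 M" by (auto simp: L2_def)
  have "ip M (\<lambda>x. (X x)\<^sup>2) (\<lambda>x. 1) = 1" "ip M (\<lambda>x. 1) (\<lambda>x. (Y x)\<^sup>2) = 1" "ip M (\<lambda>x. 1) (\<lambda>x. 1) = 1"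
    using X Y by (auto simp: ip_def power2_eq_square prob_space)
  then show ?thesis
    using X Y c V_square_L2[OF X(1)] V_square_L2[OF Y(1)] V_square_square[OF X(1) Y(1)]
    by (simp add: ip_diff_left ip_diff_right L2_diff)
qed

section \<open>Orthogonality as independence\<close>

lemma V_orthogonal_char:
  assumes X: "X \<in> V" and Y: "Y \<in> V" and o: "ip M X Y = 0"
  shows "(CLINT x|M. iexp (X x + Y x)) = (CLINT x|M. iexp (X x)) * (CLINT x|M. iexp (Y x))"
proof -
  have "ip M (\<lambda>x. X x + Y x) (\<lambda>x. X x + Y x) = ip M X X + ip M Y Y"
    using V_L2[OF X] V_L2[OF Y] o by (simp add: ip_add_left ip_add_right L2_add ip_commute[of M Y X])
  then show ?thesis
    using V_char[OF V_add[OF X Y]] V_char[OF X] V_char[OF Y]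
    by (simp add: exp_add[symmetric] add_divide_distrib diff_divide_distrib exp_of_real[symmetric] del: of_real_add)
qed

text \<open>Orthogonal finite combinations have additive variances, so their characteristic
  functions factor. Infinite families are allowed, which is what later replaces conditioning on the
  orthogonal part.\<close>

lemma V_orthogonal_distr_pair:
  assumes X: "\<And>i. i \<in> I \<Longrightarrow> X i \<in> V" and Y: "\<And>j. j \<in> J \<Longrightarrow> Y j \<in> V"
    and o: "\<And>i j. i \<in> I \<Longrightarrow> j \<in> J \<Longrightarrow> ip M (X i) (Y j) = 0"
  shows "distr M (PiM I (\<lambda>_. borel) \<Otimes>\<^sub>M PiM J (\<lambda>_. borel)) (\<lambda>x. (\<lambda>i\<in>I. X i x, \<lambda>j\<in>J. Y j x)) =
    distr M (PiM I (\<lambda>_. borel)) (\<lambda>x. \<lambda>i\<in>I. X i x) \<Otimes>\<^sub>M distr M (PiM J (\<lambda>_. borel)) (\<lambda>x. \<lambda>j\<in>J. Y j x)"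
proof (rule distr_pair_PiM_of_char)
  fix I' J' s t assume I': "finite I'" "I' \<subseteq> I" and J': "finite J'" "J' \<subseteq> J"
  let ?A = "\<lambda>x. \<Sum>i\<in>I'. s i * X i x" and ?B = "\<lambda>x. \<Sum>j\<in>J'. t j * Y j x"
  have XL: "X i \<in> L2 M" if "i \<in> I'" for i using that I' by (intro V_L2 X) auto
  have YL: "Y i \<in> L2 M" if "i \<in> J'" for i using that J' by (intro V_L2 Y) auto
  have "ip M ?A ?B = (\<Sum>i\<in>I'. \<Sum>j\<in>J'. s i * (t j * ip M (X i) (Y j)))"
    by (simp add: ip_sum_left ip_sum_right ip_cmult_left ip_cmult_right XL YL L2_intros sum_distrib_left)
  also have "\<dots> = 0" using I' J' o by (intro sum.neutral ballI) auto
  finally have "ip M ?A ?B = 0" .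
  moreover have "?A \<in> V" "?B \<in> V" using X Y I' J' by (auto intro!: V_sum V_cmult)
  ultimately show "(CLINT x|M. iexp (?A x + ?B x)) = (CLINT x|M. iexp (?A x)) * (CLINT x|M. iexp (?B x))"
    using V_orthogonal_char by blast
qed (use X Y in \<open>auto intro: V_measurable\<close>)

text \<open>Induction on the finite index set, splitting off one variable at a time by independence
  of two orthogonal families.\<close>

lemma V_orthogonal_indep_vars:
  fixes X :: "'i \<Rightarrow> 'a \<Rightarrow> real"
  assumes X: "\<And>i. i \<in> I \<Longrightarrow> X i \<in> V"
    and o: "\<And>i j. i \<in> I \<Longrightarrow> j \<in> I \<Longrightarrow> i \<noteq> j \<Longrightarrow> ip M (X i) (X j) = 0"
  shows "indep_vars (\<lambda>_. borel) X I"
  unfolding indep_vars_def2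
proof (intro conjI ballI indep_setsI)
  fix i assume "i \<in> I"
  then show Xm: "X i \<in> borel_measurable M" using X by (auto intro: V_measurable)
  then show "{X i -` A \<inter> space M |A. A \<in> sets borel} \<subseteq> events" by (auto intro: measurable_sets)
next
  fix A J assume J: "J \<noteq> {}" "J \<subseteq> I" "finite J" and "\<forall>j\<in>J. A j \<in> {X j -` A \<inter> space M |A. A \<in> sets borel}"
  then have "\<forall>j\<in>J. \<exists>B. B \<in> sets borel \<and> A j = X j -` B \<inter> space M" by auto
  then obtain B where B: "\<And>j. j \<in> J \<Longrightarrow> B j \<in> sets borel" "\<And>j. j \<in> J \<Longrightarrow> A j = X j -` B j \<inter> space M"
    by metis
  have Xm: "X i \<in> borel_measurable M" if "i \<in> I" for i using X that by (auto intro: V_measurable)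
  have "prob {x\<in>space M. \<forall>j\<in>J. X j x \<in> B j} = (\<Prod>j\<in>J. prob {x\<in>space M. X j x \<in> B j})"
    using \<open>finite J\<close> \<open>J \<subseteq> I\<close> B(1)
  proof (induction J)
    case empty
    then show ?case by (simp add: prob_space)
  next
    case (insert k J)
    have kI: "k \<in> I" and JI: "J \<subseteq> I" using insert.prems by auto
    let ?P = "PiM {k} (\<lambda>_. borel :: real measure)" and ?Q = "PiM J (\<lambda>_. borel :: real measure)"
    let ?x = "\<lambda>x. \<lambda>i\<in>{k}. X i x" and ?y = "\<lambda>x. \<lambda>i\<in>J. X i x"
    have [measurable]: "?x \<in> M \<rightarrow>\<^sub>M ?P" "?y \<in> M \<rightarrow>\<^sub>M ?Q"
      using Xm kI JI by (auto intro!: measurable_restrict)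
    have eq: "distr M (?P \<Otimes>\<^sub>M ?Q) (\<lambda>x. (?x x, ?y x)) = distr M ?P ?x \<Otimes>\<^sub>M distr M ?Q ?y"
      using kI JI insert.hyps by (intro V_orthogonal_distr_pair X o) auto
    have Bk: "Pi\<^sub>E {k} B \<in> sets ?P" and BJ: "Pi\<^sub>E J B \<in> sets ?Q"
      using insert.prems insert.hyps by (auto intro!: sets_PiM_I_finite)
    interpret Qp: prob_space "distr M ?Q ?y" by (rule prob_space_distr) simp
    have "emeasure (distr M (?P \<Otimes>\<^sub>M ?Q) (\<lambda>x. (?x x, ?y x))) (Pi\<^sub>E {k} B \<times> Pi\<^sub>E J B)
       = emeasure (distr M ?P ?x) (Pi\<^sub>E {k} B) * emeasure (distr M ?Q ?y) (Pi\<^sub>E J B)"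
      unfolding eq using Bk BJ by (intro Qp.emeasure_pair_measure_Times) auto
    moreover have "(\<lambda>x. (?x x, ?y x)) -` (Pi\<^sub>E {k} B \<times> Pi\<^sub>E J B) \<inter> space M = {x\<in>space M. \<forall>j\<in>insert k J. X j x \<in> B j}"
      by (auto simp: PiE_iff)
    moreover have "?x -` (Pi\<^sub>E {k} B) \<inter> space M = {x\<in>space M. X k x \<in> B k}" by (auto simp: PiE_iff)
    moreover have "?y -` (Pi\<^sub>E J B) \<inter> space M = {x\<in>space M. \<forall>j\<in>J. X j x \<in> B j}" by (auto simp: PiE_iff)
    ultimately have "prob {x\<in>space M. \<forall>j\<in>insert k J. X j x \<in> B j} = prob {x\<in>space M. X k x \<in> B k} * prob {x\<in>space M. \<forall>j\<in>J. X j x \<in> B j}"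
      using Bk BJ by (simp add: emeasure_distr emeasure_eq_measure ennreal_mult[symmetric] pair_measureI del: Pi_iff PiE_iff)
    then show ?case using insert.IH insert.prems insert.hyps by simp
  qed
  moreover have "(\<Inter>j\<in>J. A j) = {x\<in>space M. \<forall>j\<in>J. X j x \<in> B j}" using J B(2) by auto
  moreover have "A j = {x\<in>space M. X j x \<in> B j}" if "j \<in> J" for j using B(2)[OF that] by auto
  ultimately show "prob (\<Inter>j\<in>J. A j) = (\<Prod>j\<in>J. prob (A j))" by simp
qed

text \<open>The summands are independent, centered and of variance \<open>2 * (l j)\<^sup>2\<close>.
  Mean-square convergence is what permits inner products term by term.\<close>

lemma wick_series:
  fixes h :: "nat \<Rightarrow> 'a \<Rightarrow> real" and l :: "nat \<Rightarrow> real"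
  assumes h: "\<And>j. h j \<in> V" and on: "\<And>i j. ip M (h i) (h j) = (if i = j then 1 else 0)"
    and l: "summable (\<lambda>j. (l j)\<^sup>2)"
  shows wick_series_AE_summable: "AE x in M. summable (\<lambda>j. l j * ((h j x)\<^sup>2 - 1))"
    and wick_series_L2: "(\<lambda>x. \<Sum>j. l j * ((h j x)\<^sup>2 - 1)) \<in> L2 M"
    and wick_series_ip: "Y \<in> L2 M \<Longrightarrow> (\<lambda>j. l j * ip M (\<lambda>x. (h j x)\<^sup>2 - 1) Y) sums ip M (\<lambda>x. \<Sum>j. l j * ((h j x)\<^sup>2 - 1)) Y"
proof -
  define Z where "Z j x = l j * ((h j x)\<^sup>2 - 1)" for j x
  have ind: "indep_vars (\<lambda>_. borel) Z UNIV"
    unfolding Z_def[abs_def]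
    by (rule indep_vars_compose2[OF V_orthogonal_indep_vars[of UNIV h], where Y="\<lambda>j r. l j * (r\<^sup>2 - 1)"])
       (auto simp: h on)
  have ZL: "Z j \<in> L2 M" for j unfolding Z_def[abs_def] by (intro L2_cmult V_wick_L2 h)
  have mean: "expectation (Z j) = 0" for j unfolding Z_def[abs_def] using V_wick_mean[OF h] on by simp
  have ipZ: "ip M (Z i) (Z j) = l i * l j * (2 * (if i = j then 1 else 0))" for i j
    unfolding Z_def[abs_def] using on by (simp add: ip_cmult_left ip_cmult_right V_wick h)
  have sm: "summable (\<lambda>j. ip M (Z j) (Z j))"
    using summable_mult[OF l, of 2] by (simp add: ipZ power2_eq_square mult_ac)
  show "AE x in M. summable (\<lambda>j. l j * ((h j x)\<^sup>2 - 1))"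
    using AE_summable_of_indep[OF ind ZL mean sm] by (simp add: Z_def)
  have S: "(\<lambda>x. \<Sum>j. Z j x) \<in> L2 M"
    "(\<lambda>n. ip M (\<lambda>x. (\<Sum>j<n. Z j x) - (\<Sum>j. Z j x)) (\<lambda>x. (\<Sum>j<n. Z j x) - (\<Sum>j. Z j x))) \<longlonglongrightarrow> 0"
    by (rule indep_series_L2[OF ind ZL mean _ sm]; simp add: ipZ)+
  then show "(\<lambda>x. \<Sum>j. l j * ((h j x)\<^sup>2 - 1)) \<in> L2 M" by (simp add: Z_def)
  assume Y: "Y \<in> L2 M"
  have "(\<lambda>n. ip M (\<lambda>x. \<Sum>j<n. Z j x) Y) \<longlonglongrightarrow> ip M (\<lambda>x. \<Sum>j. Z j x) Y"
    by (rule ip_tendsto[OF _ S(1) Y S(2)]) (intro L2_sum ZL)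
  moreover have "ip M (\<lambda>x. \<Sum>j<n. Z j x) Y = (\<Sum>j<n. l j * ip M (\<lambda>x. (h j x)\<^sup>2 - 1) Y)" for n
    using ZL Y unfolding Z_def[abs_def] by (simp add: ip_sum_left ip_cmult_left)
  ultimately show "(\<lambda>j. l j * ip M (\<lambda>x. (h j x)\<^sup>2 - 1) Y) sums ip M (\<lambda>x. \<Sum>j. l j * ((h j x)\<^sup>2 - 1)) Y"
    unfolding sums_def by (simp add: Z_def)
qed

lemma gaussian_series:
  fixes h :: "nat \<Rightarrow> 'a \<Rightarrow> real" and c :: "nat \<Rightarrow> real"
  assumes h: "\<And>j. h j \<in> V" and on: "\<And>i j. ip M (h i) (h j) = (if i = j then 1 else 0)"
    and c: "summable (\<lambda>j. (c j)\<^sup>2)"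
  shows gaussian_series_AE_summable: "AE x in M. summable (\<lambda>j. c j * h j x)"
    and gaussian_series_V: "(\<lambda>x. \<Sum>j. c j * h j x) \<in> V"
    and gaussian_series_ip: "Y \<in> L2 M \<Longrightarrow> (\<lambda>j. c j * ip M (h j) Y) sums ip M (\<lambda>x. \<Sum>j. c j * h j x) Y"
proof -
  define Z where "Z j x = c j * h j x" for j x
  have ind: "indep_vars (\<lambda>_. borel) Z UNIV"
    unfolding Z_def[abs_def]
    by (rule indep_vars_compose2[OF V_orthogonal_indep_vars[of UNIV h], where Y="\<lambda>j r. c j * r"])
       (auto simp: h on)
  have ZV: "Z j \<in> V" for j unfolding Z_def[abs_def] by (intro V_cmult h)
  have ZL: "Z j \<in> L2 M" for j using ZV by (rule V_L2)
  have mean: "expectation (Z j) = 0" for j using V_moments(1)[OF ZV] .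
  have ipZ: "ip M (Z i) (Z j) = c i * c j * (if i = j then 1 else 0)" for i j
    unfolding Z_def[abs_def] using on by (simp add: ip_cmult_left ip_cmult_right)
  have sm: "summable (\<lambda>j. ip M (Z j) (Z j))"
    using c by (simp add: ipZ power2_eq_square)
  show "AE x in M. summable (\<lambda>j. c j * h j x)"
    using AE_summable_of_indep[OF ind ZL mean sm] by (simp add: Z_def)
  have S: "(\<lambda>x. \<Sum>j. Z j x) \<in> L2 M"
    "(\<lambda>n. ip M (\<lambda>x. (\<Sum>j<n. Z j x) - (\<Sum>j. Z j x)) (\<lambda>x. (\<Sum>j<n. Z j x) - (\<Sum>j. Z j x))) \<longlonglongrightarrow> 0"
    by (rule indep_series_L2[OF ind ZL mean _ sm]; simp add: ipZ)+
  have "(\<lambda>x. \<Sum>j. Z j x) \<in> V"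
  proof (rule V_closed[OF S(1)])
    fix e :: real assume "e > 0"
    from order_tendstoD(2)[OF S(2) this] obtain n where
      "ip M (\<lambda>x. (\<Sum>j<n. Z j x) - (\<Sum>j. Z j x)) (\<lambda>x. (\<Sum>j<n. Z j x) - (\<Sum>j. Z j x)) < e"
      by (auto simp: eventually_sequentially)
    then show "\<exists>Y\<in>V. ip M (\<lambda>x. Y x - (\<Sum>j. Z j x)) (\<lambda>x. Y x - (\<Sum>j. Z j x)) < e"
      by (intro bexI[of _ "\<lambda>x. \<Sum>j<n. Z j x"] V_sum ZV)
  qed
  then show "(\<lambda>x. \<Sum>j. c j * h j x) \<in> V" by (simp add: Z_def)
  assume Y: "Y \<in> L2 M"
  have "(\<lambda>n. ip M (\<lambda>x. \<Sum>j<n. Z j x) Y) \<longlonglongrightarrow> ip M (\<lambda>x. \<Sum>j. Z j x) Y"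
    by (rule ip_tendsto[OF _ S(1) Y S(2)]) (intro L2_sum ZL)
  moreover have "ip M (\<lambda>x. \<Sum>j<n. Z j x) Y = (\<Sum>j<n. c j * ip M (h j) Y)" for n
    using ZL Y unfolding Z_def[abs_def] by (simp add: ip_sum_left ip_cmult_left)
  ultimately show "(\<lambda>j. c j * ip M (h j) Y) sums ip M (\<lambda>x. \<Sum>j. c j * h j x) Y"
    unfolding sums_def by (simp add: Z_def)
qed

text \<open>Gram-Schmidt with padding: when the next \<open>X n\<close> already depends on the
  system, a vector of the infinite orthonormal sequence \<open>h\<close> is taken instead, so that
  the length is always exactly \<open>n\<close>.\<close>

lemma orthonormal_system_containing:
  fixes h :: "nat \<Rightarrow> 'a \<Rightarrow> real" and X :: "nat \<Rightarrow> 'a \<Rightarrow> real"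
  assumes h: "\<And>j. h j \<in> V" and on: "\<And>i j. ip M (h i) (h j) = (if i = j then 1 else 0)"
    and X: "\<And>j. X j \<in> V"
  shows "\<exists>e. (\<forall>j<n. e j \<in> V) \<and> (\<forall>i<n. \<forall>j<n. ip M (e i) (e j) = (if i = j then 1 else (0::real))) \<and>
    (\<forall>i<n. AE x in M. X i x = (\<Sum>l<n. ip M (X i) (e l) * e l x))"
proof (induction n)
  case 0
  then show ?case by simp
next
  case (Suc n)
  then obtain e where e: "\<And>j. j < n \<Longrightarrow> e j \<in> V"
    and eon: "\<And>i j. i < n \<Longrightarrow> j < n \<Longrightarrow> ip M (e i) (e j) = (if i = j then 1 else (0::real))"
    and ex: "\<And>i. i < n \<Longrightarrow> AE x in M. X i x = (\<Sum>l<n. ip M (X i) (e l) * e l x)"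
    by auto
  have eL: "e j \<in> L2 M" if "j < n" for j using e[OF that] by (rule V_L2)
  \<comment> \<open>The residual after projection onto the span of the \<open>e l\<close> found so
    far.\<close>
  define R where "R Y x = Y x - (\<Sum>l<n. ip M Y (e l) * e l x)" for Y x
  have RV: "R Y \<in> V" if "Y \<in> V" for Y
    unfolding R_def[abs_def] using e that by (auto intro!: V_diff V_sum V_cmult)
  have PL: "(\<lambda>x. \<Sum>l<n. ip M Y (e l) * e l x) \<in> L2 M" for Y
    by (intro L2_sum L2_cmult eL) auto
  have ipP: "ip M (\<lambda>x. \<Sum>l<n. ip M Y (e l) * e l x) Z = (\<Sum>k<n. ip M Y (e k) * ip M (e k) Z)" if "Z \<in> L2 M" for Y Z
    using that eL by (subst ip_sum_left) (auto simp: ip_cmult_left intro!: L2_cmult)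
  have Ro: "ip M (R Y) (e l) = 0" if Y: "Y \<in> V" and l: "l < n" for Y l
  proof -
    have "ip M (R Y) (e l) = ip M Y (e l) - (\<Sum>k<n. ip M Y (e k) * ip M (e k) (e l))"
      unfolding R_def[abs_def] by (simp add: ip_diff_left[OF V_L2[OF Y] PL eL[OF l]] ipP[OF eL[OF l]])
    also have "(\<Sum>k<n. ip M Y (e k) * ip M (e k) (e l)) = (\<Sum>k<n. if k = l then ip M Y (e l) else 0)"
      using l by (intro sum.cong refl) (auto simp: eon)
    finally show ?thesis using l by simp
  qed
  have RR: "ip M (R Y) Y = ip M (R Y) (R Y)" if Y: "Y \<in> V" for Y
  proof -
    have "ip M (R Y) (R Y) = ip M (R Y) Y - (\<Sum>k<n. ip M Y (e k) * ip M (R Y) (e k))"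
    proof -
      have c: "ip M (R Y) (e k) = ip M (e k) (R Y)" for k by (rule ip_commute)
      have "ip M (R Y) (R Y) = ip M (R Y) (\<lambda>x. Y x - (\<Sum>l<n. ip M Y (e l) * e l x))"
        by (simp add: R_def[abs_def])
      also have "\<dots> = ip M (R Y) Y - ip M (R Y) (\<lambda>x. \<Sum>l<n. ip M Y (e l) * e l x)"
        by (rule ip_diff_right[OF V_L2[OF Y] PL V_L2[OF RV[OF Y]]])
      finally show ?thesis
        unfolding ip_commute[of M "R Y" "\<lambda>x. \<Sum>l<n. ip M Y (e l) * e l x"] ipP[OF V_L2[OF RV[OF Y]]]
        by (simp only: c)
    qed
    then show ?thesis using Ro[OF Y] by simp
  qed
  \<comment> \<open>The vector to be normalized next: \<open>X n\<close> whenever its residual is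
    nonzero, otherwise some \<open>h j\<close>.\<close>
  have "\<exists>Y\<in>V. ip M (R Y) (R Y) \<noteq> 0 \<and> (ip M (R (X n)) (R (X n)) \<noteq> 0 \<longrightarrow> Y = X n)"
  proof (cases "ip M (R (X n)) (R (X n)) \<noteq> 0")
    case True
    then show ?thesis using X by auto
  next
    case False
    have "\<exists>j. ip M (R (h j)) (R (h j)) \<noteq> 0"
    proof (rule ccontr)
      assume "\<not> ?thesis"
      then have z: "ip M (R (h j)) (h j) = 0" for j using RR[OF h] by simp
      have one: "(\<Sum>l<n. (ip M (e l) (h j))\<^sup>2) = 1" for j
      proof -
        have "ip M (R (h j)) (h j) = ip M (h j) (h j) - (\<Sum>l<n. ip M (h j) (e l) * ip M (e l) (h j))"
          unfolding R_def[abs_def] by (simp add: ip_diff_left[OF V_L2[OF h] PL V_L2[OF h]] ipP[OF V_L2[OF h]])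
        moreover have "ip M (h j) (e l) = ip M (e l) (h j)" for l by (rule ip_commute)
        ultimately show ?thesis using z[of j] on[of j j] by (simp add: power2_eq_square)
      qed
      \<comment> \<open>Counting dimensions: if all \<open>h j\<close> had residual 0, then
        \<open>n + 1\<close> orthonormal vectors would lie in the span of \<open>n\<close>. Bessel's
        inequality with the two systems exchanged excludes this.\<close>
      have "real (Suc n) = (\<Sum>j<Suc n. \<Sum>l<n. (ip M (e l) (h j))\<^sup>2)" by (simp add: one del: sum.lessThan_Suc)
      also have "\<dots> = (\<Sum>l<n. \<Sum>j<Suc n. (ip M (e l) (h j))\<^sup>2)" by (rule sum.swap)
      also have "\<dots> \<le> (\<Sum>l<n. ip M (e l) (e l))"
        by (intro sum_mono Bessel) (auto simp: on eL V_L2 h)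
      also have "\<dots> = real n" by (simp add: eon)
      finally show False by simp
    qed
    then show ?thesis using False h by auto
  qed
  then obtain Y where Y: "Y \<in> V" "ip M (R Y) (R Y) \<noteq> 0" "ip M (R (X n)) (R (X n)) \<noteq> 0 \<Longrightarrow> Y = X n" by auto
  define s where "s = sqrt (ip M (R Y) (R Y))"
  have s: "s > 0" "s * s = ip M (R Y) (R Y)" using Y(2) ip_nonneg[of M "R Y"] by (auto simp: s_def order_less_le)
  define u where "u x = (1 / s) * R Y x" for x
  have uV: "u \<in> V" unfolding u_def[abs_def] by (intro V_cmult RV Y)
  have uu: "ip M u u = 1" unfolding u_def[abs_def] ip_cmult_left ip_cmult_right using s by (simp add: s(2)[symmetric])
  have uo: "ip M u (e l) = 0" if "l < n" for l
    unfolding u_def[abs_def] ip_cmult_left using Ro[OF Y(1) that] by simp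
  have uo': "ip M (e l) u = 0" if "l < n" for l
    using uo[OF that] by (simp add: ip_commute[of M "e l" u])
  define e' where "e' = e(n := u)"
  have e'n: "e' n = u" and e'l: "l < n \<Longrightarrow> e' l = e l" for l by (auto simp: e'_def)
  show ?case
  proof (intro exI[of _ e'] conjI allI impI)
    show "e' j \<in> V" if "j < Suc n" for j
      using that e uV by (cases "j = n") (auto simp: e'n e'l)
    show "ip M (e' i) (e' j) = (if i = j then 1 else 0)" if "i < Suc n" "j < Suc n" for i j
      using that uu uo eon by (cases "i = n"; cases "j = n") (auto simp: e'n e'l uo')
    fix i assume i: "i < Suc n"
    show "AE x in M. X i x = (\<Sum>l<Suc n. ip M (X i) (e' l) * e' l x)"
    proof (cases "i = n")
      case False
      then have i: "i < n" using i by simp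
      have "ip M (X i) u = 0"
      proof -
        have "ip M (X i) u = ip M (\<lambda>x. \<Sum>l<n. ip M (X i) (e l) * e l x) u"
          using ex[OF i] by (intro ip_cong_AE) (auto simp: V_L2 X uV e intro!: L2_intros)
        also have "\<dots> = 0"
          using uo' by (simp add: ipP[OF V_L2[OF uV]])
        finally show ?thesis .
      qed
      then show ?thesis using ex[OF i] by (simp add: e'n e'l)
    next
      case True
      show ?thesis
      proof (cases "ip M (R (X n)) (R (X n)) = 0")
        case True
        then have z: "AE x in M. R (X n) x = 0" using ip_self_eq_0_iff[OF V_L2[OF RV[OF X]]] by simp
        then have ae: "AE x in M. X n x = (\<Sum>l<n. ip M (X n) (e l) * e l x)" by (simp add: R_def)
        have "ip M (X n) u = ip M (\<lambda>x. \<Sum>l<n. ip M (X n) (e l) * e l x) u"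
          using ae by (intro ip_cong_AE) (auto simp: V_L2 X uV e intro!: L2_intros)
        also have "\<dots> = 0"
          using uo' by (simp add: ipP[OF V_L2[OF uV]])
        finally show ?thesis using ae \<open>i = n\<close> by (simp add: e'n e'l)
      next
        case False
        then have YX: "Y = X n" using Y(3) by simp
        have "ip M (X n) u = (1 / s) * ip M (R Y) Y"
          unfolding YX u_def[abs_def] ip_cmult_right by (simp add: ip_commute)
        also have "\<dots> = s" using RR[OF Y(1)] s(1) by (simp add: s(2)[symmetric])
        finally have "ip M (X n) u * u x = R (X n) x" for x using s by (simp add: u_def YX)
        then show ?thesis using \<open>i = n\<close> by (simp add: e'n e'l R_def)
      qed
    qed
  qed
qed

end

section \<open>Quadratic forms in Gaussian variables\<close>

locale gaussian_quadratic_forms = gaussian_space M V for M :: "'a measure" and V +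
  fixes g :: "'n::finite \<Rightarrow> nat \<Rightarrow> 'a \<Rightarrow> real" and lam :: "'n \<Rightarrow> nat \<Rightarrow> real"
  assumes g_V: "g i j \<in> V"
    and g_on: "ip M (g i j) (g i j') = (if j = j' then 1 else 0)"
    and lam_summable: "summable (\<lambda>j. (lam i j)\<^sup>2)"
begin

section \<open>The quadratic variables, their operators and bilinear forms\<close>

definition F :: "'n \<Rightarrow> 'a \<Rightarrow> real" where
  "F i x = (\<Sum>j. lam i j * ((g i j x)\<^sup>2 - 1))"

definition A :: "'n \<Rightarrow> ('a \<Rightarrow> real) \<Rightarrow> 'a \<Rightarrow> real" where
  "A i X x = (\<Sum>j. lam i j * ip M X (g i j) * g i j x)"

abbreviation q :: "'n \<Rightarrow> ('a \<Rightarrow> real) \<Rightarrow> ('a \<Rightarrow> real) \<Rightarrow> real" where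
  "q i X Y \<equiv> ip M (A i X) Y"

text \<open>Square-summable coefficients are bounded, and Bessel's inequality controls the other
  factor.\<close>

lemma A_coeff_summable:
  assumes X: "X \<in> V"
  shows "summable (\<lambda>j. (lam i j * ip M X (g i j))\<^sup>2)"
proof -
  have "Bseq (\<lambda>j. (lam i j)\<^sup>2)"
    by (rule convergent_imp_Bseq[OF convergentI[OF summable_LIMSEQ_zero[OF lam_summable]]])
  then obtain K where K: "\<And>j. (lam i j)\<^sup>2 \<le> K" unfolding Bseq_def by auto
  have "summable (\<lambda>j. K * (ip M X (g i j))\<^sup>2)"
    by (intro summable_mult Bessel_summable) (auto simp: V_L2 g_V g_on X)
  then show ?thesis
    by (rule summable_comparison_test'[where N=0])
      (use K in \<open>auto simp: power_mult_distrib intro!: mult_right_mono\<close>)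
qed

lemma A_V: "X \<in> V \<Longrightarrow> A i X \<in> V"
  unfolding A_def[abs_def] by (intro gaussian_series_V[OF g_V g_on] A_coeff_summable)

lemma A_L2: "X \<in> V \<Longrightarrow> A i X \<in> L2 M"
  using A_V V_L2 by blast

lemma A_AE_summable: "X \<in> V \<Longrightarrow> AE x in M. summable (\<lambda>j. lam i j * ip M X (g i j) * g i j x)"
  by (intro gaussian_series_AE_summable[OF g_V g_on] A_coeff_summable)

lemma q_sums:
  assumes X: "X \<in> V" and Y: "Y \<in> V"
  shows "(\<lambda>j. lam i j * ip M X (g i j) * ip M Y (g i j)) sums q i X Y"
  using gaussian_series_ip[OF g_V g_on A_coeff_summable[OF X] V_L2[OF Y], of i]
  by (simp add: A_def[abs_def] ip_commute[of M Y "g _ _"])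

lemma q_sym: "X \<in> V \<Longrightarrow> Y \<in> V \<Longrightarrow> q i X Y = q i Y X"
  using q_sums[of X Y i] q_sums[of Y X i] by (auto simp: mult_ac intro: sums_unique2)

text \<open>\<open>A i\<close> is a pointwise series, so its linearity is not read off the
  definition; symmetry moves the combination to the right argument, where \<open>ip\<close> is
  linear.\<close>

lemma q_add_left: "X \<in> V \<Longrightarrow> Y \<in> V \<Longrightarrow> Z \<in> V \<Longrightarrow> q i (\<lambda>x. X x + c * Y x) Z = q i X Z + c * q i Y Z"
  by (simp add: q_sym[of _ Z] V_add V_cmult ip_add_right ip_cmult_right A_L2 V_L2 L2_cmult)

lemma F_AE_summable: "AE x in M. summable (\<lambda>j. lam i j * ((g i j x)\<^sup>2 - 1))"
  by (rule wick_series_AE_summable[OF g_V g_on lam_summable])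

lemma F_L2: "F i \<in> L2 M"
  unfolding F_def[abs_def] by (rule wick_series_L2[OF g_V g_on lam_summable])

lemma F_ip_sums: "Y \<in> L2 M \<Longrightarrow> (\<lambda>j. lam i j * ip M (\<lambda>x. (g i j x)\<^sup>2 - 1) Y) sums ip M (F i) Y"
  unfolding F_def[abs_def] by (rule wick_series_ip[OF g_V g_on lam_summable])

text \<open>Testing \<open>F i\<close> against Wick squares recovers the quadratic form of
  \<open>A i\<close>; the factor 2 is the variance of a Wick square.\<close>

lemma F_ip_wick:
  assumes Y: "Y \<in> V" "ip M Y Y = 1"
  shows "ip M (F i) (\<lambda>x. (Y x)\<^sup>2 - 1) = 2 * q i Y Y"
proof -
  have "(\<lambda>j. lam i j * (2 * (ip M (g i j) Y)\<^sup>2)) sums ip M (F i) (\<lambda>x. (Y x)\<^sup>2 - 1)"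
    using F_ip_sums[OF V_wick_L2[OF Y(1)], of i] V_wick[OF g_V _ Y] g_on by simp
  moreover have "(\<lambda>j. 2 * (lam i j * ip M Y (g i j) * ip M Y (g i j))) sums (2 * q i Y Y)"
    by (intro sums_mult q_sums Y)
  ultimately show ?thesis
    by (auto intro!: sums_unique2 simp: power2_eq_square ip_commute[of M Y "g _ _"] mult_ac)
qed

text \<open>The difference \<open>D\<close> of the two sides is orthogonal to each of the variables \<open>F l\<close> and \<open>(\<eta> p)\<^sup>2 - 1\<close>,
  of which it is itself a linear combination.\<close>

lemma finite_rank_combination:
  fixes a v :: "real^'n" and e :: "'n \<Rightarrow> 'a \<Rightarrow> real"
  assumes e: "\<And>l. e l \<in> V" and eon: "\<And>l m. ip M (e l) (e m) = (if l = m then 1 else 0)"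
    and rng: "\<And>Y Z. Y \<in> V \<Longrightarrow> Z \<in> V \<Longrightarrow>
      (\<Sum>i\<in>UNIV. a $ i * q i Y Z) = (\<Sum>l\<in>UNIV. (\<Sum>i\<in>UNIV. a $ i * q i Y (e l)) * ip M (e l) Z)"
    and v: "v \<noteq> 0" "\<And>Y. Y \<in> V \<Longrightarrow> (\<Sum>l\<in>UNIV. v $ l * (\<Sum>i\<in>UNIV. a $ i * q i Y (e l))) = 0"
  shows "\<exists>(\<eta> :: nat \<Rightarrow> 'a \<Rightarrow> real) (b :: nat \<Rightarrow> real).
     (\<forall>m < CARD('n) - 1. distributed M lborel (\<eta> m) (normal_density 0 1)) \<and>
     indep_vars (\<lambda>_. borel) \<eta> {..< CARD('n) - 1} \<and>
     (AE x in M. (\<Sum>i\<in>UNIV. a $ i * F i x) = (\<Sum>m < CARD('n) - 1. b m * ((\<eta> m x)\<^sup>2 - 1)))"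
proof -
  define \<beta> where "\<beta> Y Z = (\<Sum>i\<in>UNIV. a $ i * q i Y Z)" for Y Z
  have \<beta>sym: "\<beta> Y Z = \<beta> Z Y" if "Y \<in> V" "Z \<in> V" for Y Z
    unfolding \<beta>_def using that by (simp add: q_sym[of Y Z])
  have \<beta>rng: "\<beta> Y Z = (\<Sum>l\<in>UNIV. \<beta> Y (e l) * ip M (e l) Z)" if "Y \<in> V" "Z \<in> V" for Y Z
    unfolding \<beta>_def using rng[OF that] .
  define T :: "real^'n^'n" where "T = (\<chi> l m. \<beta> (e l) (e m))"
  have Tsym: "transpose T = T"
    unfolding T_def transpose_def by (simp add: vec_eq_iff \<beta>sym e)
  obtain u :: "'n \<Rightarrow> real^'n" and b where u: "\<And>p q. u p \<bullet> u q = (if p = q then 1 else 0)"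
    and Tu: "\<And>p. T *v u p = b p *\<^sub>R u p" and exp: "\<And>v. v = (\<Sum>p\<in>UNIV. (v \<bullet> u p) *\<^sub>R u p)"
  proof (rule symmetric_matrix_diagonalization[OF Tsym])
    fix u :: "'n \<Rightarrow> real^'n" and b
    assume "\<And>p r. u p \<bullet> u r = (if p = r then 1 else 0)" "\<And>p. T *v u p = b p *\<^sub>R u p"
      "\<And>v. v = (\<Sum>p\<in>UNIV. (v \<bullet> u p) *\<^sub>R u p)"
    then show thesis by (rule that)
  qed
  define \<eta> where "\<eta> p x = (\<Sum>l\<in>UNIV. u p $ l * e l x)" for p x
  have eL: "e l \<in> L2 M" for l using e by (rule V_L2)
  have \<eta>V: "\<eta> p \<in> V" for p unfolding \<eta>_def[abs_def] by (intro V_sum V_cmult e)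
  have ip\<eta>: "ip M Y (\<eta> p) = (\<chi> l. ip M Y (e l)) \<bullet> u p" if "Y \<in> V" for Y p
    unfolding \<eta>_def[abs_def] using V_L2[OF that] eL
    by (simp add: ip_sum_right ip_cmult_right L2_intros inner_vec_def) (simp add: mult.commute)
  have \<eta>on: "ip M (\<eta> p) (\<eta> r) = (if p = r then 1 else 0)" for p r
  proof -
    have "ip M (\<eta> p) (e l) = u p $ l" for l
    proof -
      have "ip M (\<eta> p) (e l) = (\<Sum>m\<in>UNIV. u p $ m * ip M (e m) (e l))"
        unfolding \<eta>_def[abs_def] using eL by (simp add: ip_sum_left ip_cmult_left L2_intros)
      also have "\<dots> = (\<Sum>m\<in>UNIV. if m = l then u p $ l else 0)" by (intro sum.cong refl) (auto simp: eon)
      finally show ?thesis by simp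
    qed
    then have "ip M (\<eta> p) (\<eta> r) = (\<chi> l. u p $ l) \<bullet> u r" by (simp add: ip\<eta>[OF \<eta>V])
    then show ?thesis by (simp add: u vec_lambda_eta)
  qed
  \<comment> \<open>By \<open>\<beta>rng\<close> and symmetry the form depends only on the
    coordinates along \<open>e\<close>, so diagonalizing the finite matrix \<open>T\<close>
    diagonalizes it on all of \<open>V\<close>.\<close>
  have \<beta>diag: "\<beta> Y Z = (\<Sum>p\<in>UNIV. b p * ip M Y (\<eta> p) * ip M Z (\<eta> p))" if Y: "Y \<in> V" and Z: "Z \<in> V" for Y Z
  proof -
    let ?y = "\<chi> l. ip M Y (e l)" and ?z = "\<chi> l. ip M Z (e l)"
    have "\<beta> Y (e l) = (T *v ?y) $ l" for l
    proof -
      have "\<beta> Y (e l) = \<beta> (e l) Y" by (intro \<beta>sym e Y)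
      also have "\<dots> = (\<Sum>m\<in>UNIV. \<beta> (e l) (e m) * ip M (e m) Y)" by (intro \<beta>rng e Y)
      finally show ?thesis by (simp add: matrix_vector_mult_def T_def ip_commute[of M Y "e _"])
    qed
    then have "\<beta> Y Z = ?z \<bullet> (T *v ?y)"
      by (simp add: \<beta>rng[OF Y Z] inner_vec_def mult.commute ip_commute[of M Z "e _"])
    also have "T *v ?y = T *v (\<Sum>p\<in>UNIV. (?y \<bullet> u p) *\<^sub>R u p)" using exp[of ?y] by simp
    also have "\<dots> = (\<Sum>p\<in>UNIV. (?y \<bullet> u p) *\<^sub>R (b p *\<^sub>R u p))"
      using linear_sum[OF matrix_vector_mul_linear[of T], of "\<lambda>p. (?y \<bullet> u p) *\<^sub>R u p" UNIV]
      by (simp add: Tu matrix_vector_mult_scaleR)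
    also have "?z \<bullet> \<dots> = (\<Sum>p\<in>UNIV. b p * (?y \<bullet> u p) * (?z \<bullet> u p))"
      by (simp add: inner_sum_right mult_ac)
    finally show ?thesis by (simp add: ip\<eta>[OF Y] ip\<eta>[OF Z])
  qed
  \<comment> \<open>The null vector \<open>v\<close> has a nonzero component along some eigenvector,
    and symmetry of \<open>T\<close> then forces the eigenvalue of that eigenvector to be 0.\<close>
  obtain p0 where p0: "v \<bullet> u p0 \<noteq> 0"
    using exp[of v] v(1) by (metis (mono_tags, lifting) scale_eq_0_iff sum.neutral)
  have "T *v v = 0"
    using v(2)[OF e] by (simp add: vec_eq_iff matrix_vector_mult_def T_def \<beta>_def mult.commute)
  moreover have "u p0 \<bullet> (T *v v) = (T *v u p0) \<bullet> v"
    using Tsym by (metis dot_lmul_matrix transpose_matrix_vector)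
  ultimately have b0: "b p0 = 0" using p0 by (simp add: Tu inner_commute)
  define D where "D x = (\<Sum>i\<in>UNIV. a $ i * F i x) - (\<Sum>p\<in>UNIV. b p * ((\<eta> p x)\<^sup>2 - 1))" for x
  have WL: "(\<lambda>x. (\<eta> p x)\<^sup>2 - 1) \<in> L2 M" for p by (intro V_wick_L2 \<eta>V)
  have s1: "(\<lambda>x. \<Sum>i\<in>UNIV. a $ i * F i x) \<in> L2 M" by (intro L2_sum L2_cmult F_L2)
  have s2: "(\<lambda>x. \<Sum>p\<in>UNIV. b p * ((\<eta> p x)\<^sup>2 - 1)) \<in> L2 M" by (intro L2_sum L2_cmult WL)
  have DL: "D \<in> L2 M" unfolding D_def[abs_def] by (intro L2_diff s1 s2)
  have ipD: "ip M D Z = (\<Sum>i\<in>UNIV. a $ i * ip M (F i) Z) - (\<Sum>p\<in>UNIV. b p * ip M (\<lambda>x. (\<eta> p x)\<^sup>2 - 1) Z)"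
    if "Z \<in> L2 M" for Z
    unfolding D_def[abs_def] using that
    by (simp add: ip_diff_left[OF s1 s2] ip_sum_left ip_cmult_left L2_cmult F_L2 WL)
  have DW: "ip M D (\<lambda>x. (\<eta> r x)\<^sup>2 - 1) = 0" for r
  proof -
    have "(\<Sum>i\<in>UNIV. a $ i * ip M (F i) (\<lambda>x. (\<eta> r x)\<^sup>2 - 1)) = 2 * \<beta> (\<eta> r) (\<eta> r)"
      using F_ip_wick[OF \<eta>V] by (simp add: \<eta>on \<beta>_def sum_distrib_left mult_ac)
    also have "\<beta> (\<eta> r) (\<eta> r) = (\<Sum>p\<in>UNIV. if p = r then b r else 0)"
      unfolding \<beta>diag[OF \<eta>V \<eta>V] by (intro sum.cong refl) (auto simp: \<eta>on)
    finally have 1: "(\<Sum>i\<in>UNIV. a $ i * ip M (F i) (\<lambda>x. (\<eta> r x)\<^sup>2 - 1)) = 2 * b r" by simp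
    have "(\<Sum>p\<in>UNIV. b p * ip M (\<lambda>x. (\<eta> p x)\<^sup>2 - 1) (\<lambda>x. (\<eta> r x)\<^sup>2 - 1)) = (\<Sum>p\<in>UNIV. if p = r then 2 * b r else 0)"
      by (intro sum.cong refl) (auto simp: V_wick \<eta>V \<eta>on)
    then show ?thesis by (simp add: ipD[OF WL] 1)
  qed
  have DF: "ip M D (F l) = 0" for l
  proof -
    \<comment> \<open>Up to the factor 2 this is the trace of the product of \<open>A l\<close> and
      \<open>A i\<close>, computed in the orthonormal sequence \<open>g l\<close>, where
      \<open>A l\<close> is diagonal.\<close>
    have "ip M (F l) (F i) = 2 * (\<Sum>j. lam l j * q i (g l j) (g l j)) \<and> summable (\<lambda>j. lam l j * q i (g l j) (g l j))" for i
    proof -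
      have "ip M (\<lambda>x. (g l j x)\<^sup>2 - 1) (F i) = 2 * q i (g l j) (g l j)" for j
        using F_ip_wick[OF g_V] by (simp add: g_on ip_commute[of M "\<lambda>x. (g l j x)\<^sup>2 - 1"])
      then have *: "(\<lambda>j. 2 * (lam l j * q i (g l j) (g l j))) sums ip M (F l) (F i)"
        using F_ip_sums[OF F_L2, of l i] by (simp add: mult_ac)
      have "summable (\<lambda>j. (1/2) * (2 * (lam l j * q i (g l j) (g l j))))" by (rule summable_mult[OF sums_summable[OF *]])
      then have "summable (\<lambda>j. lam l j * q i (g l j) (g l j))" by simp
      with sums_unique[OF *] show ?thesis by (simp add: suminf_mult)
    qed
    then have FF: "ip M (F i) (F l) = 2 * (\<Sum>j. lam l j * q i (g l j) (g l j))" and sm: "summable (\<lambda>j. lam l j * q i (g l j) (g l j))" for i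
      by (auto simp: ip_commute[of M "F i" "F l"])
    have "(\<Sum>i\<in>UNIV. a $ i * ip M (F i) (F l)) = 2 * (\<Sum>i\<in>UNIV. \<Sum>j. a $ i * (lam l j * q i (g l j) (g l j)))"
      by (simp add: FF sum_distrib_left suminf_mult[OF sm] mult_ac)
    also have "(\<Sum>i\<in>UNIV. \<Sum>j. a $ i * (lam l j * q i (g l j) (g l j))) = (\<Sum>j. \<Sum>i\<in>UNIV. a $ i * (lam l j * q i (g l j) (g l j)))"
      by (intro suminf_sum[symmetric] summable_mult sm)
    also have "\<dots> = (\<Sum>j. \<Sum>p\<in>UNIV. b p * (lam l j * ip M (\<eta> p) (g l j) * ip M (\<eta> p) (g l j)))"
    proof (rule suminf_cong)
      fix j
      have "(\<Sum>i\<in>UNIV. a $ i * (lam l j * q i (g l j) (g l j))) = lam l j * \<beta> (g l j) (g l j)"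
        by (simp add: \<beta>_def sum_distrib_left mult_ac)
      then show "(\<Sum>i\<in>UNIV. a $ i * (lam l j * q i (g l j) (g l j))) = (\<Sum>p\<in>UNIV. b p * (lam l j * ip M (\<eta> p) (g l j) * ip M (\<eta> p) (g l j)))"
        by (simp add: \<beta>diag[OF g_V g_V] sum_distrib_left mult_ac ip_commute[of M "g l j" "\<eta> _"])
    qed
    also have "\<dots> = (\<Sum>p\<in>UNIV. \<Sum>j. b p * (lam l j * ip M (\<eta> p) (g l j) * ip M (\<eta> p) (g l j)))"
      by (intro suminf_sum summable_mult sums_summable[OF q_sums] \<eta>V)
    also have "\<dots> = (\<Sum>p\<in>UNIV. b p * q l (\<eta> p) (\<eta> p))"
      by (intro sum.cong refl) (simp add: suminf_mult[OF sums_summable[OF q_sums]] \<eta>V sums_unique[OF q_sums, symmetric])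
    also have "2 * \<dots> = (\<Sum>p\<in>UNIV. b p * ip M (\<lambda>x. (\<eta> p x)\<^sup>2 - 1) (F l))"
      using F_ip_wick[OF \<eta>V] by (simp add: sum_distrib_left \<eta>on ip_commute[of M _ "F l"] mult_ac)
    finally show ?thesis by (simp add: ipD[OF F_L2])
  qed
  have "ip M D D = 0"
    unfolding ipD[OF DL] using DF DW by (simp add: ip_commute[of M _ D])
  then have AE: "AE x in M. D x = 0" using ip_self_eq_0_iff[OF DL] by simp
  \<comment> \<open>An enumeration of the indices other than \<open>p0\<close>, whose term vanishes.
    With a single index nothing is left and the sum is empty.\<close>
  obtain \<phi> where \<phi>: "bij_betw \<phi> {..<CARD('n) - 1} (UNIV - {p0})"
    using finite_same_card_bij[of "{..<CARD('n) - 1}" "UNIV - {p0}"] by (auto simp: card_Diff_singleton)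
  have inj: "\<phi> i = \<phi> j \<longleftrightarrow> i = j" if "i < CARD('n) - 1" "j < CARD('n) - 1" for i j
    using bij_betw_imp_inj_on[OF \<phi>] that by (auto simp: inj_on_def)
  have sumeq: "(\<Sum>p\<in>UNIV. b p * ((\<eta> p x)\<^sup>2 - 1)) = (\<Sum>m<CARD('n) - 1. b (\<phi> m) * ((\<eta> (\<phi> m) x)\<^sup>2 - 1))" for x
  proof -
    have "(\<Sum>p\<in>UNIV. b p * ((\<eta> p x)\<^sup>2 - 1)) = (\<Sum>p\<in>UNIV - {p0}. b p * ((\<eta> p x)\<^sup>2 - 1))"
      by (subst sum.remove[of UNIV p0]) (auto simp: b0)
    also have "\<dots> = (\<Sum>m<CARD('n) - 1. b (\<phi> m) * ((\<eta> (\<phi> m) x)\<^sup>2 - 1))"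
      by (rule sum.reindex_bij_betw[OF \<phi>, symmetric])
    finally show ?thesis .
  qed
  show ?thesis
  proof (intro exI[of _ "\<lambda>m. \<eta> (\<phi> m)"] exI[of _ "\<lambda>m. b (\<phi> m)"] conjI allI impI)
    show "distributed M lborel (\<eta> (\<phi> m)) (normal_density 0 1)" for m
      by (intro V_std_normal \<eta>V) (simp add: \<eta>on)
    show "indep_vars (\<lambda>_. borel) (\<lambda>m. \<eta> (\<phi> m)) {..<CARD('n) - 1}"
      by (intro V_orthogonal_indep_vars \<eta>V) (auto simp: \<eta>on inj)
    show "AE x in M. (\<Sum>i\<in>UNIV. a $ i * F i x) = (\<Sum>m<CARD('n) - 1. b (\<phi> m) * ((\<eta> (\<phi> m) x)\<^sup>2 - 1))"
      using AE by (simp add: D_def sumeq)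
  qed
qed

section \<open>Linear relations among the \<open>A i X\<close>\<close>

lemma orthonormal_system_for_A:
  assumes X: "X \<in> V"
  obtains e :: "'n \<Rightarrow> 'a \<Rightarrow> real" where "\<And>l. e l \<in> V"
    "\<And>l m. ip M (e l) (e m) = (if l = m then 1 else 0)"
    "\<And>i Z. Z \<in> V \<Longrightarrow> q i X Z = (\<Sum>l\<in>UNIV. q i X (e l) * ip M (e l) Z)"
proof -
  obtain \<phi> where \<phi>: "bij_betw \<phi> {..<CARD('n)} (UNIV :: 'n set)"
    using finite_same_card_bij[of "{..<CARD('n)}" "UNIV :: 'n set"] by auto
  define \<psi> where "\<psi> = the_inv_into {..<CARD('n)} \<phi>"
  have \<psi>: "bij_betw \<psi> UNIV {..<CARD('n)}" unfolding \<psi>_def by (rule bij_betw_the_inv_into[OF \<phi>])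
  have \<psi>n: "\<psi> l < CARD('n)" for l using \<psi> by (auto simp: bij_betw_def)
  have \<phi>\<psi>: "\<phi> (\<psi> l) = l" for l
    unfolding \<psi>_def using \<phi> by (intro f_the_inv_into_f_bij_betw[OF \<phi>]) auto
  \<comment> \<open>Any single row of \<open>g\<close> can supply the padding vectors, hence the
    unspecified index \<open>undefined\<close>.\<close>
  obtain e where e: "\<forall>j<CARD('n). e j \<in> V"
    and eon: "\<forall>i<CARD('n). \<forall>j<CARD('n). ip M (e i) (e j) = (if i = j then 1 else (0::real))"
    and ex: "\<forall>i<CARD('n). AE x in M. A (\<phi> i) X x = (\<Sum>l<CARD('n). ip M (A (\<phi> i) X) (e l) * e l x)"
    using orthonormal_system_containing[OF g_V[of undefined] g_on A_V[OF X], of "CARD('n)" \<phi>] by blast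
  show thesis
  proof (rule that[of "\<lambda>l. e (\<psi> l)"])
    show "e (\<psi> l) \<in> V" for l using e \<psi>n by blast
    show "ip M (e (\<psi> l)) (e (\<psi> m)) = (if l = m then 1 else 0)" for l m
    proof -
      have "\<psi> l = \<psi> m \<longleftrightarrow> l = m" by (metis \<phi>\<psi>)
      then show ?thesis using eon \<psi>n[of l] \<psi>n[of m] by simp
    qed
    fix i Z assume Z: "Z \<in> V"
    have eL: "e l \<in> L2 M" if "l < CARD('n)" for l using e that V_L2 by blast
    have "AE x in M. A i X x = (\<Sum>l<CARD('n). q i X (e l) * e l x)"
      using ex \<psi>n[of i] \<phi>\<psi>[of i] by fastforce
    then have "q i X Z = ip M (\<lambda>x. \<Sum>l<CARD('n). q i X (e l) * e l x) Z"
      using V_L2[OF Z] A_L2[OF X] eL by (intro ip_cong_AE) (auto intro!: L2_sum L2_cmult)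
    also have "\<dots> = (\<Sum>l<CARD('n). q i X (e l) * ip M (e l) Z)"
      using V_L2[OF Z] eL by (subst ip_sum_left) (auto simp: ip_cmult_left intro!: L2_cmult)
    also have "\<dots> = (\<Sum>l\<in>UNIV. q i X (e (\<psi> l)) * ip M (e (\<psi> l)) Z)"
      by (rule sum.reindex_bij_betw[OF \<psi>, symmetric])
    finally show "q i X Z = (\<Sum>l\<in>UNIV. q i X (e (\<psi> l)) * ip M (e (\<psi> l)) Z)" .
  qed
qed

text \<open>The relations among the \<open>A i X\<close>, tested against \<open>V\<close>: its
  codimension is the dimension of the span of the \<open>A i X\<close>, so a maximal span means a
  minimal \<open>Ker\<close>.\<close>

definition Ker :: "('a \<Rightarrow> real) \<Rightarrow> (real^'n) set" where
  "Ker X = {a. \<forall>Z\<in>V. (\<Sum>i\<in>UNIV. a $ i * q i X Z) = 0}"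

lemma subspace_Ker: "subspace (Ker X)"
proof (rule subspaceI)
  show "0 \<in> Ker X" by (simp add: Ker_def)
  show "a + b \<in> Ker X" if "a \<in> Ker X" "b \<in> Ker X" for a b
    using that by (simp add: Ker_def sum.distrib distrib_right)
  show "c *\<^sub>R a \<in> Ker X" if "a \<in> Ker X" for c a
    using that by (simp add: Ker_def mult.assoc sum_distrib_left[symmetric])
qed

text \<open>If \<open>Y\<close> violated the conclusion, then for small \<open>t > 0\<close> the kernel at \<open>X + t Y\<close> would meet the sum
  of \<open>(Ker X)\<^sup>\<bottom>\<close> and the line through \<open>a\<close> trivially, hence have smaller dimension than \<open>Ker X\<close>.\<close>

lemma range_in_span_of_minimal_Ker:
  assumes X: "X \<in> V" and min: "\<And>Y. Y \<in> V \<Longrightarrow> dim (Ker X) \<le> dim (Ker Y)"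
    and a: "a \<in> Ker X" "a \<noteq> 0" and Y: "Y \<in> V"
  shows "\<exists>c::real^'n. \<forall>Z\<in>V. (\<Sum>i\<in>UNIV. a $ i * q i Y Z) = (\<Sum>i\<in>UNIV. c $ i * q i X Z)"
proof (rule ccontr)
  assume neg: "\<not> ?thesis"
  define P where "P = {u. \<forall>b\<in>Ker X. orthogonal b u}"
  define BY where "BY x = (\<Sum>i\<in>UNIV. a $ i * A i Y x)" for x
  \<comment> \<open>\<open>W p\<close> runs through the combinations of the \<open>A i X\<close> and
    the offending vector \<open>BY\<close>; \<open>U p\<close> is the part of the perturbation that
    has to be shown negligible.\<close>
  define W where "W p x = (\<Sum>i\<in>UNIV. fst p $ i * A i X x) + snd p * BY x" for p :: "(real^'n) \<times> real" and x
  define U where "U p x = (\<Sum>i\<in>UNIV. fst p $ i * A i Y x)" for p :: "(real^'n) \<times> real" and x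
  have AX: "A i X \<in> L2 M" and AY: "A i Y \<in> L2 M" for i using A_L2 X Y by auto
  have BYV: "BY \<in> V" unfolding BY_def[abs_def] by (intro V_sum V_cmult A_V Y)
  have BYL: "BY \<in> L2 M" using BYV by (rule V_L2)
  have WV: "W p \<in> V" for p unfolding W_def[abs_def] by (intro V_add V_sum V_cmult A_V X BYV)
  have sL: "(\<lambda>x. \<Sum>i\<in>UNIV. c i * A i X x) \<in> L2 M" for c by (intro L2_sum L2_cmult AX)
  have ipW: "ip M (W p) Z = (\<Sum>i\<in>UNIV. fst p $ i * q i X Z) + snd p * ip M BY Z" if "Z \<in> L2 M" for p Z
    unfolding W_def[abs_def] using that
    by (simp add: ip_add_left[OF sL L2_cmult[OF BYL]] ip_sum_left ip_cmult_left L2_cmult AX)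
  have ipBY: "ip M BY Z = (\<Sum>i\<in>UNIV. a $ i * q i Y Z)" if "Z \<in> L2 M" for Z
    unfolding BY_def[abs_def] using that by (simp add: ip_sum_left ip_cmult_left L2_cmult AY)
  have ipU: "ip M (U p) Z = (\<Sum>i\<in>UNIV. fst p $ i * q i Y Z)" if "Z \<in> L2 M" for p Z
    unfolding U_def[abs_def] using that by (simp add: ip_sum_left ip_cmult_left L2_cmult AY)
  have UV: "U p \<in> V" for p unfolding U_def[abs_def] by (intro V_sum V_cmult A_V Y)
  \<comment> \<open>Expanded into an explicit polynomial in \<open>p\<close>, from which continuity
    on the finite-dimensional space is immediate.\<close>
  have WW: "ip M (W p) (W p) = (\<Sum>i\<in>UNIV. fst p $ i * ((\<Sum>j\<in>UNIV. fst p $ j * ip M (A j X) (A i X)) + snd p * ip M BY (A i X)))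
     + snd p * ((\<Sum>i\<in>UNIV. fst p $ i * q i X BY) + snd p * ip M BY BY)" for p
  proof -
    have c: "ip M (A i X) (W p) = ip M (W p) (A i X)" "ip M BY (W p) = ip M (W p) BY" for i by (rule ip_commute)+
    show ?thesis unfolding ipW[OF V_L2[OF WV], of p p] c by (simp add: ipW AX BYL)
  qed
  have UU: "ip M (U p) (U p) = (\<Sum>i\<in>UNIV. fst p $ i * (\<Sum>j\<in>UNIV. fst p $ j * ip M (A j Y) (A i Y)))" for p
  proof -
    have c: "ip M (A i Y) (U p) = ip M (U p) (A i Y)" for i by (rule ip_commute)
    show ?thesis unfolding ipU[OF V_L2[OF UV], of p p] c by (simp add: ipU AY)
  qed
  have contW: "continuous_on S (\<lambda>p. ip M (W p) (W p))" for S unfolding WW by (intro continuous_intros)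
  have contU: "continuous_on S (\<lambda>p. ip M (U p) (U p))" for S unfolding UU by (intro continuous_intros)
  have Wscale: "W (r *\<^sub>R p) = (\<lambda>x. r * W p x)" for r p
    unfolding W_def by (auto simp: fun_eq_iff sum_distrib_left algebra_simps)
  have Uscale: "U (r *\<^sub>R p) = (\<lambda>x. r * U p x)" for r p
    unfolding U_def by (auto simp: fun_eq_iff sum_distrib_left algebra_simps)
  have subP: "subspace P" unfolding P_def subspace_def by (auto simp: orthogonal_def inner_add_right)
  \<comment> \<open>On \<open>P\<close> a vanishing combination without \<open>BY\<close> is a
    relation orthogonal to all relations, and one that involves \<open>BY\<close> would contradict
    \<open>neg\<close>.\<close>
  have pos: "ip M (W p) (W p) > 0" if p: "fst p \<in> P" "p \<noteq> 0" for p
  proof (rule ccontr)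
    assume "\<not> ?thesis"
    then have "ip M (W p) (W p) = 0" using ip_nonneg[of M "W p"] by linarith
    then have "AE x in M. W p x = 0" using ip_self_eq_0_iff[OF V_L2[OF WV]] by simp
    then have "ip M (W p) Z = ip M (\<lambda>x. 0) Z" if "Z \<in> V" for Z
      using that V_L2[OF WV] V_L2 by (intro ip_cong_AE) auto
    then have z: "(\<Sum>i\<in>UNIV. fst p $ i * q i X Z) + snd p * (\<Sum>i\<in>UNIV. a $ i * q i Y Z) = 0" if "Z \<in> V" for Z
      using that ipW[OF V_L2[OF that], of p] ipBY[OF V_L2[OF that]] by simp
    show False
    proof (cases "snd p = 0")
      case True
      then have "fst p \<in> Ker X" using z by (simp add: Ker_def)
      then have "fst p \<bullet> fst p = 0" using p(1) by (auto simp: P_def orthogonal_def)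
      then show False using True p(2) by (simp add: prod_eq_iff)
    next
      case False
      have "\<forall>Z\<in>V. (\<Sum>i\<in>UNIV. a $ i * q i Y Z) = (\<Sum>i\<in>UNIV. ((- 1 / snd p) *\<^sub>R fst p) $ i * q i X Z)"
      proof
        fix Z assume "Z \<in> V"
        from z[OF this] have "snd p * (\<Sum>i\<in>UNIV. a $ i * q i Y Z) = - (\<Sum>i\<in>UNIV. fst p $ i * q i X Z)" by linarith
        then have "(\<Sum>i\<in>UNIV. a $ i * q i Y Z) = (- 1 / snd p) * (\<Sum>i\<in>UNIV. fst p $ i * q i X Z)"
          using False by (simp add: field_simps)
        then show "(\<Sum>i\<in>UNIV. a $ i * q i Y Z) = (\<Sum>i\<in>UNIV. ((- 1 / snd p) *\<^sub>R fst p) $ i * q i X Z)"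
          by (simp add: sum_distrib_left mult.assoc)
      qed
      then show False using neg by blast
    qed
  qed
  define K where "K = sphere (0 :: (real^'n) \<times> real) 1 \<inter> (P \<times> UNIV)"
  have Kc: "compact K"
    unfolding K_def using closed_subspace[OF subP] by (intro compact_Int_closed closed_Times) auto
  have "((0::real^'n), 1::real) \<in> K" using subspace_0[OF subP] by (simp add: K_def norm_Pair)
  then have Kne: "K \<noteq> {}" by auto
  obtain p1 where p1: "p1 \<in> K" "\<And>p. p \<in> K \<Longrightarrow> ip M (W p1) (W p1) \<le> ip M (W p) (W p)"
    using continuous_attains_inf[OF Kc Kne contW] by blast
  obtain p2 where p2: "p2 \<in> K" "\<And>p. p \<in> K \<Longrightarrow> ip M (U p) (U p) \<le> ip M (U p2) (U p2)"
    using continuous_attains_sup[OF Kc Kne contU] by blast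
  define d where "d = ip M (W p1) (W p1)"
  define C where "C = ip M (U p2) (U p2)"
  have d0: "d > 0" unfolding d_def using p1(1) by (intro pos) (auto simp: K_def)
  have C0: "C \<ge> 0" unfolding C_def by simp
  \<comment> \<open>Chosen such that \<open>t\<^sup>2 * C < d\<close>, where \<open>d\<close> is the
    least size of \<open>W\<close> and \<open>C\<close> the greatest size of \<open>U\<close> on the
    unit sphere; the added 1 covers \<open>C = 0\<close>.\<close>
  define t where "t = sqrt (d / (2 * (C + 1)))"
  have t0: "t > 0" unfolding t_def using d0 C0 by simp
  have t2: "t\<^sup>2 * C < d"
  proof -
    have "t\<^sup>2 = d / (2 * (C + 1))" unfolding t_def using d0 C0 by simp
    moreover have "d * C < d * (2 * (C + 1))" using d0 C0 by (intro mult_strict_left_mono) auto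
    then have "d * C / (2 * (C + 1)) < d" using C0 by (subst pos_divide_less_eq) auto
    ultimately show ?thesis by simp
  qed
  define Xt where "Xt x = X x + t * Y x" for x
  have XtV: "Xt \<in> V" unfolding Xt_def[abs_def] by (intro V_add V_cmult X Y)
  have triv: "p = 0" if p: "fst p \<in> P" and k: "fst p + snd p *\<^sub>R a \<in> Ker Xt" for p
  proof (rule ccontr)
    assume "p \<noteq> 0"
    \<comment> \<open>Since \<open>a\<close> annihilates the \<open>A i X\<close>, the vector
      \<open>BY\<close> enters a relation at \<open>Xt\<close> with coefficient
      \<open>snd p * t\<close>. The relation then reads \<open>W w = - t * U w\<close> when tested
      against \<open>V\<close>.\<close>
    define w where "w = (fst p, snd p * t)"
    have w0: "w \<noteq> 0" and wP: "fst w \<in> P" using \<open>p \<noteq> 0\<close> t0 p by (auto simp: w_def prod_eq_iff)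
    have WU: "ip M (W w) Z = - t * ip M (U w) Z" if Z: "Z \<in> V" for Z
    proof -
      have "0 = (\<Sum>i\<in>UNIV. (fst p + snd p *\<^sub>R a) $ i * q i Xt Z)" using k Z by (simp add: Ker_def)
      also have "\<dots> = (\<Sum>i\<in>UNIV. (fst p $ i + snd p * a $ i) * (q i X Z + t * q i Y Z))"
        unfolding Xt_def[abs_def] by (simp add: q_add_left[OF X Y Z])
      also have "\<dots> = (\<Sum>i\<in>UNIV. fst p $ i * q i X Z) + t * (\<Sum>i\<in>UNIV. fst p $ i * q i Y Z)
           + snd p * (\<Sum>i\<in>UNIV. a $ i * q i X Z) + snd p * t * (\<Sum>i\<in>UNIV. a $ i * q i Y Z)"
        by (simp add: sum_distrib_left sum.distrib algebra_simps)
      also have "(\<Sum>i\<in>UNIV. a $ i * q i X Z) = 0" using a(1) Z by (simp add: Ker_def)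
      finally show ?thesis
        using V_L2[OF Z] by (simp add: ipW ipU ipBY w_def)
    qed
    have "ip M (W w) (W w) = - t * ip M (U w) (W w)" by (rule WU[OF WV])
    also have "ip M (U w) (W w) = - t * ip M (U w) (U w)" using WU[OF UV, of w] by (simp add: ip_commute[of M "U w" "W w"])
    finally have eq: "ip M (W w) (W w) = t\<^sup>2 * ip M (U w) (U w)" by (simp add: power2_eq_square)
    define r where "r = norm w"
    have r0: "r > 0" using w0 by (simp add: r_def)
    define p' where "p' = (1 / r) *\<^sub>R w"
    have "fst p' \<in> P" using wP subP by (simp add: p'_def subspace_scale)
    then have p'K: "p' \<in> K"
      unfolding K_def using r0 by (simp add: p'_def r_def mem_Times_iff)
    have w: "w = r *\<^sub>R p'" using r0 by (simp add: p'_def)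
    have "r * r * ip M (W p') (W p') = t\<^sup>2 * (r * r * ip M (U p') (U p'))"
      using eq unfolding w Wscale Uscale by (simp add: ip_cmult_left ip_cmult_right)
    then have "ip M (W p') (W p') = t\<^sup>2 * ip M (U p') (U p')" using r0 by simp
    also have "\<dots> \<le> t\<^sup>2 * C" unfolding C_def using p2(2)[OF p'K] by (intro mult_left_mono) auto
    also have "\<dots> < d" by (rule t2)
    also have "d \<le> ip M (W p') (W p')" unfolding d_def by (rule p1(2)[OF p'K])
    finally show False by simp
  qed
  \<comment> \<open>Its dimension exceeds the codimension of \<open>Ker X\<close> by one, and it
    meets \<open>Ker Xt\<close> only in 0.\<close>
  define L where "L = {x + y |x y. x \<in> P \<and> y \<in> span {a}}"
  have subL: "subspace L" unfolding L_def by (rule subspace_sums[OF subP subspace_span])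
  have PK: "b \<in> P \<Longrightarrow> b \<in> Ker X \<Longrightarrow> b = 0" for b by (auto simp: P_def orthogonal_def)
  have "P \<inter> span {a} = {0}"
  proof -
    have "span {a} \<subseteq> Ker X" using a(1) subspace_Ker by (intro span_minimal) auto
    then show ?thesis using PK subspace_0[OF subP] span_zero[of "{a}"] by auto
  qed
  then have dL: "dim L = dim P + 1"
    using dim_sums_Int[OF subP subspace_span[of "{a}"]] a(2) unfolding L_def by simp
  have dP: "dim P + dim (Ker X) = CARD('n)"
    using dim_subspace_orthogonal_to_vectors[OF subspace_Ker subspace_UNIV, of X] unfolding P_def by simp
  have "L \<inter> Ker Xt = {0}"
  proof -
    have "b = 0" if b: "b \<in> L" "b \<in> Ker Xt" for b
    proof -
      obtain x s where "b = x + s *\<^sub>R a" "x \<in> P" using b(1) by (auto simp: L_def span_singleton)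
      then show ?thesis using triv[of "(x, s)"] b(2) by (simp add: zero_prod_def)
    qed
    then show ?thesis using subspace_0[OF subL] subspace_0[OF subspace_Ker] by blast
  qed
  then have "dim {x + y |x y. x \<in> L \<and> y \<in> Ker Xt} = dim L + dim (Ker Xt)"
    using dim_sums_Int[OF subL subspace_Ker[of Xt]] by simp
  moreover have "dim {x + y |x y. x \<in> L \<and> y \<in> Ker Xt} \<le> CARD('n)"
    using dim_subset_UNIV[of "{x + y |x y. x \<in> L \<and> y \<in> Ker Xt}"] by simp
  ultimately have "dim (Ker Xt) < dim (Ker X)" using dL dP by linarith
  then show False using min[OF XtV] by simp
qed

lemma degenerate_combination:
  assumes deg: "\<And>X. X \<in> V \<Longrightarrow> Ker X \<noteq> {0}"
  shows "\<exists>(\<eta> :: nat \<Rightarrow> 'a \<Rightarrow> real) (a :: real^'n) (b :: nat \<Rightarrow> real).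
     (\<forall>m < CARD('n) - 1. distributed M lborel (\<eta> m) (normal_density 0 1)) \<and>
     indep_vars (\<lambda>_. borel) \<eta> {..< CARD('n) - 1} \<and> a \<noteq> 0 \<and>
     (AE x in M. (\<Sum>i\<in>UNIV. a $ i * F i x) = (\<Sum>m < CARD('n) - 1. b m * ((\<eta> m x)\<^sup>2 - 1)))"
proof -
  \<comment> \<open>Dimensions are natural numbers, so a minimal kernel exists.\<close>
  obtain X where X: "X \<in> V" "\<And>Y. Y \<in> V \<Longrightarrow> dim (Ker X) \<le> dim (Ker Y)"
    using ex_has_least_nat[of "\<lambda>X. X \<in> V" _ "\<lambda>X. dim (Ker X)"] V_zero by blast
  obtain a where a: "a \<in> Ker X" "a \<noteq> 0" using deg[OF X(1)] subspace_0[OF subspace_Ker[of X]] by blast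
  obtain e :: "'n \<Rightarrow> 'a \<Rightarrow> real" where e: "\<And>l. e l \<in> V" "\<And>l m. ip M (e l) (e m) = (if l = m then 1 else 0)"
    and eX: "\<And>i Z. Z \<in> V \<Longrightarrow> q i X Z = (\<Sum>l\<in>UNIV. q i X (e l) * ip M (e l) Z)"
  proof (rule orthonormal_system_for_A[OF X(1)])
    fix e :: "'n \<Rightarrow> 'a \<Rightarrow> real"
    assume "\<And>l. e l \<in> V" "\<And>l m. ip M (e l) (e m) = (if l = m then 1 else 0)"
      "\<And>i Z. Z \<in> V \<Longrightarrow> q i X Z = (\<Sum>l\<in>UNIV. q i X (e l) * ip M (e l) Z)"
    then show thesis by (rule that)
  qed
  \<comment> \<open>The rows hold the coordinates of the \<open>A i X\<close>. A square matrix with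
    left null vector \<open>a\<close> has a right null vector \<open>v\<close>; the combination of
    the \<open>e l\<close> with coefficients \<open>v\<close> is orthogonal to every
    \<open>A i X\<close>, hence to the range of the combined operator.\<close>
  define C :: "real^'n^'n" where "C = (\<chi> i l. q i X (e l))"
  have "a v* C = 0" using a(1) e(1) by (auto simp: vec_eq_iff vector_matrix_mult_def C_def Ker_def mult.commute)
  then have "\<not> invertible C" using a(2) by (metis invertible_def vector_matrix_mul_assoc vector_matrix_mul_rid vector_matrix_mult_0)
  then obtain v where v: "v \<noteq> 0" "C *v v = 0"
    using invertible_left_inverse matrix_left_invertible_ker by blast
  have rep: "\<exists>c::real^'n. \<forall>Z\<in>V. (\<Sum>i\<in>UNIV. a $ i * q i Y Z) = (\<Sum>i\<in>UNIV. c $ i * q i X Z)" if "Y \<in> V" for Y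
    by (rule range_in_span_of_minimal_Ker[OF X a that])
  have "\<exists>\<eta> b. (\<forall>m < CARD('n) - 1. distributed M lborel (\<eta> m) (normal_density 0 1)) \<and>
     indep_vars (\<lambda>_. borel) \<eta> {..< CARD('n) - 1} \<and>
     (AE x in M. (\<Sum>i\<in>UNIV. a $ i * F i x) = (\<Sum>m < CARD('n) - 1. b m * ((\<eta> m x)\<^sup>2 - 1)))"
  proof (rule finite_rank_combination[OF e _ v(1)])
    fix Y assume Y: "Y \<in> V"
    from rep[OF Y] obtain c :: "real^'n" where c: "\<And>Z. Z \<in> V \<Longrightarrow> (\<Sum>i\<in>UNIV. a $ i * q i Y Z) = (\<Sum>i\<in>UNIV. c $ i * q i X Z)" by blast
    have "(\<Sum>l\<in>UNIV. v $ l * (\<Sum>i\<in>UNIV. a $ i * q i Y (e l))) = (\<Sum>l\<in>UNIV. \<Sum>i\<in>UNIV. c $ i * (C $ i $ l * v $ l))"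
      by (simp add: c[OF e(1)] sum_distrib_left C_def mult_ac)
    also have "\<dots> = (\<Sum>i\<in>UNIV. c $ i * (C *v v) $ i)"
      by (subst sum.swap) (simp add: matrix_vector_mult_def sum_distrib_left)
    finally show "(\<Sum>l\<in>UNIV. v $ l * (\<Sum>i\<in>UNIV. a $ i * q i Y (e l))) = 0" by (simp add: v(2))
    fix Z assume Z: "Z \<in> V"
    have "(\<Sum>i\<in>UNIV. a $ i * q i Y Z) = (\<Sum>i\<in>UNIV. \<Sum>l\<in>UNIV. c $ i * q i X (e l) * ip M (e l) Z)"
      by (simp add: c[OF Z] eX[OF Z] sum_distrib_left mult.assoc)
    also have "\<dots> = (\<Sum>l\<in>UNIV. (\<Sum>i\<in>UNIV. c $ i * q i X (e l)) * ip M (e l) Z)"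
      by (subst sum.swap) (simp add: sum_distrib_right)
    also have "\<dots> = (\<Sum>l\<in>UNIV. (\<Sum>i\<in>UNIV. a $ i * q i Y (e l)) * ip M (e l) Z)"
      by (simp add: c[OF e(1)])
    finally show "(\<Sum>i\<in>UNIV. a $ i * q i Y Z) = (\<Sum>l\<in>UNIV. (\<Sum>i\<in>UNIV. a $ i * q i Y (e l)) * ip M (e l) Z)" .
  qed
  with a(2) show ?thesis by blast
qed

end

section \<open>Absolute continuity in the regular case\<close>

text \<open>Fubini for null sets in place of conditioning: it suffices to exclude \<open>S\<close>
  with the second component frozen at each value.\<close>

lemma (in prob_space) AE_pair_of_product_distr:
  assumes X[measurable]: "X \<in> M \<rightarrow>\<^sub>M P" and Y[measurable]: "Y \<in> M \<rightarrow>\<^sub>M Q"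
    and eq: "distr M (P \<Otimes>\<^sub>M Q) (\<lambda>x. (X x, Y x)) = distr M P X \<Otimes>\<^sub>M distr M Q Y"
    and S[measurable]: "S \<in> sets (P \<Otimes>\<^sub>M Q)"
    and ae: "\<And>y. y \<in> space Q \<Longrightarrow> AE x in M. (X x, y) \<notin> S"
  shows "AE x in M. (X x, Y x) \<notin> S"
proof -
  interpret PX: prob_space "distr M P X" by (rule prob_space_distr) simp
  interpret PY: prob_space "distr M Q Y" by (rule prob_space_distr) simp
  interpret PP: pair_sigma_finite "distr M P X" "distr M Q Y" ..
  have z: "emeasure (distr M P X) ((\<lambda>x. (x, y)) -` S) = 0" if y: "y \<in> space Q" for y
  proof -
    have m: "(\<lambda>x. (x, y)) -` S \<in> sets P" using sets_Pair2[OF S, of y] .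
    have "emeasure (distr M P X) ((\<lambda>x. (x, y)) -` S) = emeasure M (X -` ((\<lambda>x. (x, y)) -` S) \<inter> space M)"
      by (rule emeasure_distr[OF X m])
    also have "X -` ((\<lambda>x. (x, y)) -` S) \<inter> space M = {x\<in>space M. (X x, y) \<in> S}" by auto
    also have "emeasure M {x\<in>space M. (X x, y) \<in> S} = 0"
      using ae[OF y] measurable_sets[OF X m] by (subst (asm) AE_iff_measurable[OF _ refl]) (auto simp: vimage_def Int_def conj_commute)
    finally show ?thesis .
  qed
  have "emeasure (distr M (P \<Otimes>\<^sub>M Q) (\<lambda>x. (X x, Y x))) S =
      (\<integral>\<^sup>+y. emeasure (distr M P X) ((\<lambda>x. (x, y)) -` S) \<partial>distr M Q Y)"
    unfolding eq by (rule PP.emeasure_pair_measure_alt2) simp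
  also have "\<dots> = (\<integral>\<^sup>+y. 0 \<partial>distr M Q Y)"
    by (intro nn_integral_cong) (simp add: z)
  finally have "emeasure M ((\<lambda>x. (X x, Y x)) -` S \<inter> space M) = 0"
    by (simp add: emeasure_distr)
  then show ?thesis
    by (intro AE_I[where N="(\<lambda>x. (X x, Y x)) -` S \<inter> space M"]) auto
qed

context gaussian_quadratic_forms
begin

text \<open>Each entry splits into a multiple of \<open>X\<close> and a part independent of
  \<open>X\<close>. For frozen second parts the determinant is a pencil in the value of
  \<open>X\<close> with finitely many zeros, and the nondegenerate Gaussian \<open>X\<close> avoids
  a finite set almost surely.\<close>

lemma AE_det_A_nonzero:
  assumes X: "X \<in> V" and e: "\<And>l. e l \<in> V" and C: "det (\<chi> i l. q i X (e l)) \<noteq> 0"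
  shows "AE x in M. det (\<chi> i l. A i (e l) x) \<noteq> 0"
proof -
  let ?C = "\<chi> i l. q i X (e l)"
  define n where "n = ip M X X"
  have YX: "ip M (A i (e l)) X = q i X (e l)" for i l by (rule q_sym[OF e X])
  have "n \<noteq> 0"
  proof
    assume "n = 0"
    then have ae: "AE x in M. X x = 0" using ip_self_eq_0_iff[OF V_L2[OF X]] by (simp add: n_def)
    have "q i X (e l) = 0" for i l
    proof -
      have "q i X (e l) = ip M X (A i (e l))" unfolding YX[symmetric] by (rule ip_commute)
      also have "\<dots> = ip M (\<lambda>x. 0) (A i (e l))"
        using ae V_L2[OF X] A_L2[OF e] by (intro ip_cong_AE) auto
      finally show ?thesis by simp
    qed
    then have "?C = 0" by (simp add: vec_eq_iff)
    then show False using C det_0 by (metis mat_0)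
  qed
  then have n0: "n > 0" using ip_nonneg[of M X] unfolding n_def by linarith
  \<comment> \<open>The residual of \<open>A i (e l)\<close> after projection onto \<open>X\<close>;
    by symmetry of the form its coefficient is \<open>q i X (e l) / n\<close>.\<close>
  define Y' where "Y' p x = A (fst p) (e (snd p)) x - (q (fst p) X (e (snd p)) / n) * X x" for p x
  have Y'V: "Y' p \<in> V" for p
    unfolding Y'_def[abs_def] by (intro V_diff V_cmult A_V e X)
  have XY': "ip M X (Y' p) = 0" for p
  proof -
    have "ip M X (Y' p) = ip M X (A (fst p) (e (snd p))) - (q (fst p) X (e (snd p)) / n) * n"
      unfolding Y'_def[abs_def]
      by (simp only: ip_diff_right[OF A_L2[OF e] L2_cmult[OF V_L2[OF X]] V_L2[OF X]] ip_cmult_right n_def[symmetric])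
    then show ?thesis using n0 YX by (simp add: ip_commute[of M X "A _ _"])
  qed
  have [measurable]: "X \<in> borel_measurable M" "Y' p \<in> borel_measurable M" for p
    using X Y'V by (auto intro: V_measurable)
  \<comment> \<open>The single variable \<open>X\<close> is regarded as a family indexed by the unit
    type.\<close>
  let ?P = "PiM {()} (\<lambda>_. borel :: real measure)" and ?Q = "PiM (UNIV :: ('n \<times> 'n) set) (\<lambda>_. borel :: real measure)"
  let ?x = "\<lambda>x. \<lambda>i\<in>{()}. X x" and ?y = "\<lambda>x. \<lambda>p\<in>UNIV. Y' p x"
  have xm: "?x \<in> M \<rightarrow>\<^sub>M ?P" and ym: "?y \<in> M \<rightarrow>\<^sub>M ?Q" by (auto intro!: measurable_restrict)
  have eq: "distr M (?P \<Otimes>\<^sub>M ?Q) (\<lambda>x. (?x x, ?y x)) = distr M ?P ?x \<Otimes>\<^sub>M distr M ?Q ?y"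
    by (intro V_orthogonal_distr_pair X Y'V XY')
  define S where "S = {p \<in> space (?P \<Otimes>\<^sub>M ?Q). det (\<chi> i l. fst p () * ((1 / n) *\<^sub>R ?C) $ i $ l + snd p (i, l)) = 0}"
  have S: "S \<in> sets (?P \<Otimes>\<^sub>M ?Q)"
  proof -
    have [measurable]: "(\<lambda>p. det (\<chi> i l. fst p () * ((1 / n) *\<^sub>R ?C) $ i $ l + snd p (i, l))) \<in> borel_measurable (?P \<Otimes>\<^sub>M ?Q)"
      by (intro borel_measurable_det) measurable
    show ?thesis unfolding S_def by measurable
  qed
  have "AE x in M. (?x x, ?y x) \<notin> S"
  proof (rule AE_pair_of_product_distr[OF xm ym eq S])
    fix w assume "w \<in> space ?Q"
    define Z where "Z = {t. det (\<chi> i l. t * ((1 / n) *\<^sub>R ?C) $ i $ l + (\<chi> i l. w (i, l)) $ i $ l) = 0}"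
    have "det ((1 / n) *\<^sub>R ?C) \<noteq> 0"
    proof -
      have "(1 / n) *\<^sub>R ?C = (\<chi> i. (1 / n) *s ?C $ i)" by (simp add: vec_eq_iff)
      then have "det ((1 / n) *\<^sub>R ?C) = (\<Prod>i\<in>(UNIV::'n set). 1 / n) * det (\<chi> i. ?C $ i)" by (simp only: det_rows_mul)
      then show ?thesis using C n0 by (simp add: vec_lambda_eta)
    qed
    then have finZ: "finite Z" unfolding Z_def by (rule finite_det_pencil_zeros)
    define X1 where "X1 x = (1 / sqrt n) * X x" for x
    have X1V: "X1 \<in> V" unfolding X1_def[abs_def] by (intro V_cmult X)
    have "ip M X1 X1 = 1" unfolding X1_def[abs_def] ip_cmult_left ip_cmult_right using n0 by (simp add: n_def[symmetric])
    then have d: "distributed M lborel X1 (normal_density 0 1)" by (rule V_std_normal[OF X1V])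
    have "AE x in M. X1 x \<notin> (\<lambda>t. t / sqrt n) ` Z"
    proof -
      let ?Z = "(\<lambda>t. t / sqrt n) ` Z"
      have Z0: "?Z \<in> null_sets lborel" using finZ by (intro finite_imp_null_set_lborel) auto
      have "AE t in lborel. t \<notin> ?Z" by (rule AE_not_in[OF Z0])
      then have "AE t in density lborel (normal_density 0 1). t \<notin> ?Z"
        by (subst AE_density) auto
      then have "AE t in distr M lborel X1. t \<notin> ?Z"
        unfolding distributed_distr_eq_density[OF d] .
      then show ?thesis
        using Z0 X1V by (subst (asm) AE_distr_iff) (auto simp: V_measurable intro!: sets.finite_UN finZ)
    qed
    then show "AE x in M. (?x x, w) \<notin> S"
    proof eventually_elim
      case (elim x)
      have "X x \<notin> Z"
      proof
        assume "X x \<in> Z"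
        then have "X1 x \<in> (\<lambda>t. t / sqrt n) ` Z" by (intro image_eqI[of _ _ "X x"]) (auto simp: X1_def)
        then show False using elim by simp
      qed
      then show ?case by (simp add: S_def Z_def)
    qed
  qed
  then show ?thesis
  proof eventually_elim
    case (elim x)
    have "(?x x, ?y x) \<in> space (?P \<Otimes>\<^sub>M ?Q)" by (simp add: space_pair_measure space_PiM PiE_iff extensional_def)
    moreover have "(\<chi> i l. X x * ((1 / n) *\<^sub>R ?C) $ i $ l + Y' (i, l) x) = (\<chi> i l. A i (e l) x)"
      by (simp add: vec_eq_iff Y'_def)
    ultimately show ?case using elim by (simp add: S_def)
  qed
qed

end

section \<open>The quadratic map seen with the orthogonal part frozen\<close>

lemma has_derivative_vec_componentwise:
  fixes f :: "'a::real_normed_vector \<Rightarrow> real^'n"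
  assumes "\<And>i. ((\<lambda>x. f x $ i) has_derivative (\<lambda>h. f' h $ i)) (at x)"
  shows "(f has_derivative f') (at x)"
  unfolding has_derivative_componentwise_within[of f f' x UNIV]
  using assms by (auto simp: Basis_vec_def inner_axis)

text \<open>By symmetry of \<open>Q\<close> the Jacobian matrix is twice the matrix under the
  determinant. The factor 2 on the linear term is the one from expanding the square of a
  sum.\<close>

lemma negligible_vimage_quadratic_map:
  fixes c :: "real^'n" and L :: "real^'n^'n" and Q :: "'n \<Rightarrow> 'n \<Rightarrow> 'n \<Rightarrow> real"
  assumes sym: "\<And>i l m. Q i l m = Q i m l" and N: "negligible N"
  shows "negligible {u::real^'n. (\<chi> i. c $ i + 2 * (\<Sum>l\<in>UNIV. u $ l * L $ i $ l) + (\<Sum>l\<in>UNIV. \<Sum>m\<in>UNIV. Q i l m * u $ l * u $ m)) \<in> N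
     \<and> det (\<chi> i l. L $ i $ l + (\<Sum>m\<in>UNIV. Q i l m * u $ m)) \<noteq> 0}"
proof -
  let ?f = "\<lambda>u::real^'n. \<chi> i. c $ i + 2 * (\<Sum>l\<in>UNIV. u $ l * L $ i $ l) + (\<Sum>l\<in>UNIV. \<Sum>m\<in>UNIV. Q i l m * u $ l * u $ m)"
  let ?J = "\<lambda>u::real^'n. \<chi> i l. 2 * (L $ i $ l + (\<Sum>m\<in>UNIV. Q i l m * u $ m))"
  have der: "(?f has_derivative (\<lambda>h. ?J u *v h)) (at u)" for u
  proof (rule has_derivative_vec_componentwise)
    fix i
    have nth: "((\<lambda>u::real^'n. u $ l) has_derivative (\<lambda>h. h $ l)) (at u)" for l
      by (rule bounded_linear_imp_has_derivative[OF bounded_linear_vec_nth])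
    have "((\<lambda>u. c $ i + 2 * (\<Sum>l\<in>UNIV. u $ l * L $ i $ l) + (\<Sum>l\<in>UNIV. \<Sum>m\<in>UNIV. Q i l m * u $ l * u $ m))
      has_derivative (\<lambda>h. 2 * (\<Sum>l\<in>UNIV. h $ l * L $ i $ l) + (\<Sum>l\<in>UNIV. \<Sum>m\<in>UNIV. Q i l m * u $ l * h $ m + Q i l m * h $ l * u $ m))) (at u)"
      by (auto intro!: derivative_eq_intros nth)
    moreover have "2 * (\<Sum>l\<in>UNIV. h $ l * L $ i $ l) + (\<Sum>l\<in>UNIV. \<Sum>m\<in>UNIV. Q i l m * u $ l * h $ m + Q i l m * h $ l * u $ m) = (?J u *v h) $ i" for h
    proof -
      have "(\<Sum>l\<in>UNIV. \<Sum>m\<in>UNIV. Q i l m * u $ l * h $ m) = (\<Sum>l\<in>UNIV. \<Sum>m\<in>UNIV. Q i l m * h $ l * u $ m)"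
        by (subst sum.swap) (simp add: sym[of i] mult_ac)
      then have "2 * (\<Sum>l\<in>UNIV. h $ l * L $ i $ l) + (\<Sum>l\<in>UNIV. \<Sum>m\<in>UNIV. Q i l m * u $ l * h $ m + Q i l m * h $ l * u $ m)
        = (\<Sum>l\<in>UNIV. 2 * (h $ l * L $ i $ l) + 2 * (\<Sum>m\<in>UNIV. Q i l m * h $ l * u $ m))"
        by (simp add: sum.distrib sum_distrib_left[symmetric])
      also have "\<dots> = (\<Sum>l\<in>UNIV. 2 * (L $ i $ l + (\<Sum>m\<in>UNIV. Q i l m * u $ m)) * h $ l)"
        by (intro sum.cong refl) (simp add: distrib_left distrib_right sum_distrib_right sum_distrib_left mult_ac)
      finally show ?thesis by (simp add: matrix_vector_mult_def)
    qed
    ultimately show "((\<lambda>u. ?f u $ i) has_derivative (\<lambda>h. (?J u *v h) $ i)) (at u)" by simp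
  qed
  have cont: "continuous_on UNIV ?J" by (intro continuous_on_vec_lambda continuous_intros)
  have "negligible {u. ?f u \<in> N \<and> det (?J u) \<noteq> 0}"
    by (rule negligible_vimage_regular_points[OF der cont N])
  moreover have "det (?J u) = (\<Prod>i\<in>(UNIV::'n set). 2) * det (\<chi> i l. L $ i $ l + (\<Sum>m\<in>UNIV. Q i l m * u $ m))" for u
  proof -
    have "?J u = (\<chi> i. 2 *s (\<chi> l. L $ i $ l + (\<Sum>m\<in>UNIV. Q i l m * u $ m)))" by (simp add: vec_eq_iff)
    then show ?thesis by (simp only: det_rows_mul)
  qed
  ultimately show ?thesis by simp
qed

context gaussian_quadratic_forms
begin

lemma F_measurable[measurable]: "F i \<in> borel_measurable M"
  using F_L2[of i] by (auto simp: L2_def)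

text \<open>Writing \<open>g i j\<close> as its projection on the \<open>e l\<close> plus the
  independent residual \<open>g'\<close> makes \<open>F\<close> a quadratic polynomial in
  \<open>e\<close> with coefficients that depend on \<open>g'\<close> alone. The law of
  \<open>e\<close> has a density, so the preimage of a null set among regular points is
  avoided.\<close>

lemma AE_F_not_in_null_set:
  fixes e :: "'n \<Rightarrow> 'a \<Rightarrow> real"
  assumes e: "\<And>l. e l \<in> V" and eon: "\<And>l m. ip M (e l) (e m) = (if l = m then 1 else 0)"
    and det: "AE x in M. det (\<chi> i l. A i (e l) x) \<noteq> 0"
    and N: "N \<in> null_sets (lborel :: (real^'n) measure)"
  shows "AE x in M. (\<chi> i. F i x) \<notin> N"
proof -
  have eL: "e l \<in> L2 M" for l using e by (rule V_L2)
  have gL: "g i j \<in> L2 M" for i j using g_V by (rule V_L2)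
  define c where "c i j l = ip M (e l) (g i j)" for i j l
  define g' where "g' p x = g (fst p) (snd p) x - (\<Sum>l\<in>UNIV. c (fst p) (snd p) l * e l x)" for p x
  have g'V: "g' p \<in> V" for p unfolding g'_def[abs_def] by (intro V_diff V_sum V_cmult g_V e)
  have orth: "ip M (e l) (g' p) = 0" for l p
  proof -
    have sL: "(\<lambda>x. \<Sum>l\<in>UNIV. c (fst p) (snd p) l * e l x) \<in> L2 M" by (intro L2_sum L2_cmult eL)
    have "ip M (e l) (g' p) = c (fst p) (snd p) l - (\<Sum>m\<in>UNIV. c (fst p) (snd p) m * ip M (e l) (e m))"
      unfolding g'_def[abs_def] ip_diff_right[OF gL sL eL]
      by (subst ip_sum_right) (auto simp: ip_cmult_right L2_cmult eL c_def)
    also have "(\<Sum>m\<in>UNIV. c (fst p) (snd p) m * ip M (e l) (e m)) = (\<Sum>m\<in>UNIV. if m = l then c (fst p) (snd p) l else 0)"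
      by (intro sum.cong refl) (auto simp: eon)
    finally show ?thesis by simp
  qed
  define Q where "Q i l m = q i (e l) (e m)" for i l m
  have Qsym: "Q i l m = Q i m l" for i l m unfolding Q_def by (rule q_sym[OF e e])
  define cc where "cc i w = (\<Sum>j. lam i j * ((w (i, j))\<^sup>2 - 1))" for i and w :: "'n \<times> nat \<Rightarrow> real"
  define ll where "ll i l w = (\<Sum>j. lam i j * c i j l * w (i, j))" for i l and w :: "'n \<times> nat \<Rightarrow> real"
  define \<Phi> where "\<Phi> f w = (\<chi> i. cc i w + 2 * (\<Sum>l\<in>UNIV. f l * ll i l w) + (\<Sum>l\<in>UNIV. \<Sum>m\<in>UNIV. Q i l m * f l * f m))"
    for f and w
  define J where "J f w = (\<chi> i l. ll i l w + (\<Sum>m\<in>UNIV. Q i l m * f m))" for f w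
  let ?P = "PiM (UNIV :: 'n set) (\<lambda>_. borel :: real measure)" and ?Q = "PiM (UNIV :: ('n \<times> nat) set) (\<lambda>_. borel :: real measure)"
  let ?x = "\<lambda>x. \<lambda>l\<in>UNIV. e l x" and ?y = "\<lambda>x. \<lambda>p\<in>UNIV. g' p x"
  have [measurable]: "e l \<in> borel_measurable M" "g' p \<in> borel_measurable M" for l p
    using e g'V by (auto intro: V_measurable)
  have xm: "?x \<in> M \<rightarrow>\<^sub>M ?P" and ym: "?y \<in> M \<rightarrow>\<^sub>M ?Q" by (auto intro!: measurable_restrict)
  have eq: "distr M (?P \<Otimes>\<^sub>M ?Q) (\<lambda>x. (?x x, ?y x)) = distr M ?P ?x \<Otimes>\<^sub>M distr M ?Q ?y"
    by (intro V_orthogonal_distr_pair e g'V orth)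
  have Nb: "N \<in> sets borel" using N by auto
  have ccm[measurable]: "(\<lambda>p. cc i (snd p)) \<in> borel_measurable (?P \<Otimes>\<^sub>M ?Q)" for i
    unfolding cc_def by measurable
  have llm[measurable]: "(\<lambda>p. ll i l (snd p)) \<in> borel_measurable (?P \<Otimes>\<^sub>M ?Q)" for i l
    unfolding ll_def by measurable
  have \<Phi>m: "(\<lambda>p. \<Phi> (fst p) (snd p)) \<in> borel_measurable (?P \<Otimes>\<^sub>M ?Q)"
    unfolding \<Phi>_def by (intro borel_measurable_vec_lambda) measurable
  have Jm: "(\<lambda>p. det (J (fst p) (snd p))) \<in> borel_measurable (?P \<Otimes>\<^sub>M ?Q)"
    unfolding J_def by (intro borel_measurable_det) measurable
  define S where "S = {p \<in> space (?P \<Otimes>\<^sub>M ?Q). \<Phi> (fst p) (snd p) \<in> N \<and> det (J (fst p) (snd p)) \<noteq> 0}"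
  have S: "S \<in> sets (?P \<Otimes>\<^sub>M ?Q)"
    unfolding S_def using \<Phi>m Jm Nb by measurable
  have "AE x in M. (?x x, ?y x) \<notin> S"
  proof (rule AE_pair_of_product_distr[OF xm ym eq S])
    fix w assume w: "w \<in> space ?Q"
    let ?R = "{u::real^'n. \<Phi> (($) u) w \<in> N \<and> det (J (($) u) w) \<noteq> 0}"
    have "negligible N" using N by (simp add: negligible_iff_null_sets null_sets_completionI)
    from negligible_vimage_quadratic_map[OF Qsym this, of "\<chi> i. cc i w" "\<chi> i l. ll i l w"]
    have "negligible ?R" unfolding \<Phi>_def J_def by simp
    moreover have "?R \<in> sets borel"
    proof -
      have [measurable]: "(\<lambda>u::real^'n. u $ l) \<in> borel_measurable borel" for l by (intro borel_measurable_continuous_onI continuous_intros)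
      have [measurable]: "(\<lambda>u::real^'n. \<Phi> (($) u) w) \<in> borel_measurable borel"
        unfolding \<Phi>_def by (intro borel_measurable_vec_lambda) measurable
      have [measurable]: "(\<lambda>u::real^'n. det (J (($) u) w)) \<in> borel_measurable borel"
        unfolding J_def by (intro borel_measurable_det) measurable
      have "{u\<in>space borel. \<Phi> (($) u) w \<in> N \<and> det (J (($) u) w) \<noteq> 0} \<in> sets borel"
        using Nb by measurable
      then show ?thesis by simp
    qed
    ultimately have "?R \<in> null_sets lborel"
      by (simp add: negligible_iff_null_sets null_sets_completion_iff)
    then have "?R \<in> null_sets (distr M borel (\<lambda>x. \<chi> l. e l x))"
      using e eon by (intro indep_densities_null_sets_vec[OF V_orthogonal_indep_vars V_std_normal]) auto
    then have "AE u in distr M borel (\<lambda>x. \<chi> l. e l x). u \<notin> ?R" by (rule AE_not_in)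
    then have "AE x in M. (\<chi> l. e l x) \<notin> ?R"
      by (rule AE_distrD[rotated]) (intro borel_measurable_vec_lambda, simp)
    then show "AE x in M. (?x x, w) \<notin> S"
    proof eventually_elim
      case (elim x)
      have "($) (\<chi> l. e l x) = ?x x" by (auto simp: fun_eq_iff)
      then show ?case using elim by (simp add: S_def)
    qed
  qed
  moreover have "AE x in M. \<forall>i. summable (\<lambda>j. lam i j * ((g i j x)\<^sup>2 - 1))"
    using F_AE_summable by (simp add: AE_all_countable)
  moreover have "AE x in M. \<forall>i l. summable (\<lambda>j. lam i j * ip M (e l) (g i j) * g i j x)"
    using A_AE_summable[OF e] by (simp add: AE_all_countable)
  moreover note det
  ultimately show ?thesis
  proof eventually_elim
    case (elim x)
    have s1: "(\<lambda>j. lam i j * ((g i j x)\<^sup>2 - 1)) sums F i x" for i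
      unfolding F_def using elim(2) by (intro summable_sums) auto
    have s2: "(\<lambda>j. lam i j * c i j l * g i j x) sums A i (e l) x" for i l
      unfolding A_def c_def using elim(3) by (intro summable_sums) auto
    have s3: "(\<lambda>j. lam i j * c i j l * c i j m) sums Q i l m" for i l m
      unfolding c_def Q_def by (rule q_sums[OF e e])
    let ?E = "\<lambda>l. e l x"
    \<comment> \<open>At the sample point this series is a finite combination of series known to
      converge there.\<close>
    have ll: "ll i l (?y x) = A i (e l) x - (\<Sum>m\<in>UNIV. ?E m * Q i l m)" for i l
    proof -
      have "(\<lambda>j. lam i j * c i j l * g i j x - (\<Sum>m\<in>UNIV. ?E m * (lam i j * c i j l * c i j m))) sums
        (A i (e l) x - (\<Sum>m\<in>UNIV. ?E m * Q i l m))"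
        by (intro sums_diff sums_sum sums_mult s2 s3)
      moreover have "lam i j * c i j l * g i j x - (\<Sum>m\<in>UNIV. ?E m * (lam i j * c i j l * c i j m)) =
          lam i j * c i j l * ?y x (i, j)" for j
        by (simp add: g'_def right_diff_distrib sum_distrib_left mult_ac)
      ultimately show ?thesis unfolding ll_def by (simp add: sums_unique[symmetric])
    qed
    \<comment> \<open>Each summand is the expanded square of \<open>g i j x\<close> minus its
      component along \<open>e\<close>.\<close>
    have cc: "cc i (?y x) = F i x - 2 * (\<Sum>l\<in>UNIV. ?E l * A i (e l) x) + (\<Sum>l\<in>UNIV. \<Sum>m\<in>UNIV. (?E l * ?E m) * Q i l m)" for i
    proof -
      have "(\<lambda>j. lam i j * ((g i j x)\<^sup>2 - 1) - 2 * (\<Sum>l\<in>UNIV. ?E l * (lam i j * c i j l * g i j x))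
          + (\<Sum>l\<in>UNIV. \<Sum>m\<in>UNIV. (?E l * ?E m) * (lam i j * c i j l * c i j m))) sums
        (F i x - 2 * (\<Sum>l\<in>UNIV. ?E l * A i (e l) x) + (\<Sum>l\<in>UNIV. \<Sum>m\<in>UNIV. (?E l * ?E m) * Q i l m))"
        by (intro sums_diff sums_add sums_sum sums_mult s1 s2 s3)
      moreover have "lam i j * ((g i j x)\<^sup>2 - 1) - 2 * (\<Sum>l\<in>UNIV. ?E l * (lam i j * c i j l * g i j x))
          + (\<Sum>l\<in>UNIV. \<Sum>m\<in>UNIV. (?E l * ?E m) * (lam i j * c i j l * c i j m)) = lam i j * ((?y x (i, j))\<^sup>2 - 1)" for j
      proof -
        define s where "s = (\<Sum>l\<in>UNIV. c i j l * ?E l)"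
        have f1: "(\<Sum>l\<in>UNIV. ?E l * (lam i j * c i j l * g i j x)) = lam i j * g i j x * s"
          unfolding s_def by (simp add: sum_distrib_left mult_ac)
        have f2: "(\<Sum>l\<in>UNIV. \<Sum>m\<in>UNIV. (?E l * ?E m) * (lam i j * c i j l * c i j m)) = lam i j * (s * s)"
          unfolding s_def sum_product by (simp add: sum_distrib_left mult_ac)
        have f3: "?y x (i, j) = g i j x - s" by (simp add: g'_def s_def)
        show ?thesis unfolding f1 f2 f3 by (simp add: power2_eq_square algebra_simps)
      qed
      ultimately show ?thesis unfolding cc_def by (simp add: sums_unique[symmetric])
    qed
    \<comment> \<open>The quadratic part of \<open>J\<close> restores the projection removed in
      \<open>ll\<close>, so the Jacobian at the sample point is, up to the factor 2, the matrix
      assumed nonsingular.\<close>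
    have JA: "J (?x x) (?y x) = (\<chi> i l. A i (e l) x)"
      unfolding J_def by (simp add: vec_eq_iff ll mult.commute)
    have "\<Phi> (?x x) (?y x) = (\<chi> i. F i x)"
    proof -
      have "(\<Sum>l\<in>UNIV. ?E l * (A i (e l) x - (\<Sum>m\<in>UNIV. ?E m * Q i l m))) =
        (\<Sum>l\<in>UNIV. ?E l * A i (e l) x) - (\<Sum>l\<in>UNIV. \<Sum>m\<in>UNIV. (?E l * ?E m) * Q i l m)" for i
        by (simp add: right_diff_distrib sum_subtractf sum_distrib_left mult_ac)
      moreover have "(\<Sum>l\<in>UNIV. \<Sum>m\<in>UNIV. Q i l m * ?E l * ?E m) = (\<Sum>l\<in>UNIV. \<Sum>m\<in>UNIV. (?E l * ?E m) * Q i l m)" for i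
        by (simp add: mult_ac)
      ultimately show ?thesis
        unfolding \<Phi>_def by (simp add: vec_eq_iff ll cc)
    qed
    moreover have "(?x x, ?y x) \<in> space (?P \<Otimes>\<^sub>M ?Q)" by (simp add: space_pair_measure space_PiM)
    ultimately show ?case using elim(1,4) JA by (simp add: S_def del: restrict_UNIV)
  qed
qed

text \<open>The system \<open>e\<close> spans the \<open>A i X\<close>, so a relation that holds
  against all \<open>e l\<close> holds against all of \<open>V\<close>. A trivial
  \<open>Ker X\<close> thus makes the coefficient matrix invertible.\<close>

lemma absolutely_continuous_F:
  assumes X: "X \<in> V" "Ker X = {0}"
  shows "absolutely_continuous lborel (distr M lborel (\<lambda>x. \<chi> i. F i x))"
proof -
  obtain e :: "'n \<Rightarrow> 'a \<Rightarrow> real" where e: "\<And>l. e l \<in> V" "\<And>l m. ip M (e l) (e m) = (if l = m then 1 else 0)"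
    and eX: "\<And>i Z. Z \<in> V \<Longrightarrow> q i X Z = (\<Sum>l\<in>UNIV. q i X (e l) * ip M (e l) Z)"
  proof (rule orthonormal_system_for_A[OF X(1)])
    fix e :: "'n \<Rightarrow> 'a \<Rightarrow> real"
    assume "\<And>l. e l \<in> V" "\<And>l m. ip M (e l) (e m) = (if l = m then 1 else 0)"
      "\<And>i Z. Z \<in> V \<Longrightarrow> q i X Z = (\<Sum>l\<in>UNIV. q i X (e l) * ip M (e l) Z)"
    then show thesis by (rule that)
  qed
  let ?C = "\<chi> i l. q i X (e l)"
  have "a = 0" if a: "transpose ?C *v a = 0" for a
  proof -
    have al: "(\<Sum>i\<in>UNIV. a $ i * q i X (e l)) = 0" for l
      using a by (auto simp: vec_eq_iff matrix_vector_mult_def transpose_def mult.commute)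
    have "(\<Sum>i\<in>UNIV. a $ i * q i X Z) = 0" if Z: "Z \<in> V" for Z
    proof -
      have "(\<Sum>i\<in>UNIV. a $ i * q i X Z) = (\<Sum>i\<in>UNIV. \<Sum>l\<in>UNIV. a $ i * q i X (e l) * ip M (e l) Z)"
        by (simp add: eX[OF Z] sum_distrib_left mult.assoc)
      also have "\<dots> = (\<Sum>l\<in>UNIV. (\<Sum>i\<in>UNIV. a $ i * q i X (e l)) * ip M (e l) Z)"
        by (subst sum.swap) (simp add: sum_distrib_right)
      finally show ?thesis by (simp add: al)
    qed
    then have "a \<in> Ker X" by (simp add: Ker_def)
    then show ?thesis using X(2) by simp
  qed
  then have "\<exists>B. B ** transpose ?C = mat 1" by (simp add: matrix_left_invertible_ker)
  then have "invertible (transpose ?C)" by (simp add: invertible_left_inverse)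
  then have C: "det ?C \<noteq> 0" by (simp add: invertible_det_nz det_transpose)
  have Fm: "(\<lambda>x. \<chi> i. F i x) \<in> borel_measurable M" by (intro borel_measurable_vec_lambda F_measurable)
  show ?thesis unfolding absolutely_continuous_def
  proof
    fix N assume N: "N \<in> null_sets (lborel :: (real^'n) measure)"
    have "AE x in M. (\<chi> i. F i x) \<notin> N"
      by (rule AE_F_not_in_null_set[OF e AE_det_A_nonzero[OF X(1) e(1) C] N])
    then have "emeasure M ((\<lambda>x. \<chi> i. F i x) -` N \<inter> space M) = 0"
      using Fm N by (subst (asm) AE_iff_measurable[OF _ refl]) (auto simp: vimage_def Int_def conj_commute dest: measurable_sets)
    then show "N \<in> null_sets (distr M lborel (\<lambda>x. \<chi> i. F i x))"
      using Fm N by (auto simp: null_sets_def emeasure_distr)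
  qed
qed

lemma not_absolutely_continuous_imp_combination:
  assumes "\<not> absolutely_continuous lborel (distr M lborel (\<lambda>x. \<chi> i. F i x))"
  shows "\<exists>(\<eta> :: nat \<Rightarrow> 'a \<Rightarrow> real) (a :: real^'n) (b :: nat \<Rightarrow> real).
     (\<forall>m < CARD('n) - 1. distributed M lborel (\<eta> m) (normal_density 0 1)) \<and>
     indep_vars (\<lambda>_. borel) \<eta> {..< CARD('n) - 1} \<and> a \<noteq> 0 \<and>
     (AE x in M. (\<Sum>i\<in>UNIV. a $ i * F i x) = (\<Sum>m < CARD('n) - 1. b m * ((\<eta> m x)\<^sup>2 - 1)))"
  using assms absolutely_continuous_F by (intro degenerate_combination) auto

end

section \<open>Gaussian space of a jointly Gaussian family\<close>

definition closed_linear_span :: "'a measure \<Rightarrow> ('i \<Rightarrow> 'a \<Rightarrow> real) \<Rightarrow> ('a \<Rightarrow> real) set" where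
  "closed_linear_span M G = {X \<in> L2 M. \<forall>e>0. \<exists>S c. finite S \<and>
     ip M (\<lambda>x. (\<Sum>p\<in>S. c p * G p x) - X x) (\<lambda>x. (\<Sum>p\<in>S. c p * G p x) - X x) < e}"

lemma norm_iexp_diff_le: "cmod (iexp a - iexp b) \<le> \<bar>a - b\<bar>"
proof -
  have "iexp a - iexp b = iexp b * (iexp (a - b) - 1)"
    by (simp add: right_diff_distrib exp_add[symmetric] distrib_left[symmetric])
  then have "cmod (iexp a - iexp b) = cmod (iexp (a - b) - 1)" by (simp add: norm_mult)
  also have "\<dots> \<le> \<bar>a - b\<bar>" using iexp_approx1[of "a - b" 0] by simp
  finally show ?thesis .
qed

lemma (in prob_space) char_centered_gaussian_rv:
  assumes g: "gaussian_rv M Y" and Y: "Y \<in> L2 M" and mean: "expectation Y = 0"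
  shows "(CLINT x|M. iexp (Y x)) = exp (- (ip M Y Y) / 2)"
proof -
  have [measurable]: "Y \<in> borel_measurable M" using Y by (auto simp: L2_def)
  from g consider c where "AE x in M. Y x = c" | \<mu> \<sigma> where "\<sigma> > 0" "distributed M lborel Y (normal_density \<mu> \<sigma>)"
    unfolding gaussian_rv_def by blast
  then show ?thesis
  proof cases
    case 1
    have "expectation Y = expectation (\<lambda>x. c)" using 1 by (intro integral_cong_AE) auto
    then have c: "c = 0" using mean by (simp add: prob_space)
    then have ae: "AE x in M. Y x = 0" using 1 by simp
    then have "ip M Y Y = 0" using ip_self_eq_0_iff[OF Y] by simp
    moreover have "(CLINT x|M. iexp (Y x)) = (CLINT x|M. 1)"
      using ae by (intro integral_cong_AE) auto
    ultimately show ?thesis by (simp add: prob_space)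
  next
    case 2
    have "expectation (\<lambda>x. Y x) = \<mu>"
      using distributed_integral[OF 2(2), of "\<lambda>x. x"] integral_normal_moment_nz_1[OF 2(1), of \<mu>]
      by (simp add: normal_density_nonneg)
    then have mu: "\<mu> = 0" using mean by simp
    have "expectation (\<lambda>x. (Y x)\<^sup>2) = \<sigma>\<^sup>2"
      using distributed_integral[OF 2(2), of "\<lambda>x. x\<^sup>2"] integral_normal_moment_even[OF 2(1), of \<mu> 1] 2(1)
      by (simp add: normal_density_nonneg mu)
    then have ipY: "ip M Y Y = \<sigma>\<^sup>2" by (simp add: ip_def power2_eq_square)
    have d: "distributed M lborel (\<lambda>x. (Y x - \<mu>) / \<sigma>) std_normal_density"
      using normal_standard_normal_convert[OF 2(1), of Y \<mu>] 2(2) by simp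
    have D: "distr M borel (\<lambda>x. (Y x - \<mu>) / \<sigma>) = std_normal_distribution"
      using distributed_distr_eq_density[OF d] by (simp cong: distr_cong)
    have "(CLINT x|M. iexp (Y x)) = (CLINT x|M. iexp (\<sigma> * ((Y x - \<mu>) / \<sigma>)))"
      using 2(1) by (simp add: mu)
    also have "\<dots> = char (distr M borel (\<lambda>x. (Y x - \<mu>) / \<sigma>)) \<sigma>"
      unfolding char_def by (subst integral_distr) auto
    also have "\<dots> = exp (- (ip M Y Y) / 2)"
      unfolding D char_std_normal_distribution ipY by (simp add: exp_of_real)
    finally show ?thesis .
  qed
qed

text \<open>The only analytic point is \<open>V_char\<close>: finite combinations are centered
  Gaussian, and both sides of the formula pass to mean-square limits because \<open>iexp\<close> is
  1-Lipschitz.\<close>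

lemma (in prob_space) gaussian_space_closed_linear_span:
  assumes jg: "jointly_gaussian M G" and GL: "\<And>p. G p \<in> L2 M" and mean: "\<And>p. expectation (G p) = 0"
  shows "gaussian_space M (closed_linear_span M G)"
proof -
  let ?V = "closed_linear_span M G"
  let ?c = "\<lambda>S c x. \<Sum>p\<in>S. c p * G p x"
  have lcL: "?c S c \<in> L2 M" for S c by (intro L2_sum L2_cmult GL)
  have VL: "X \<in> L2 M" if "X \<in> ?V" for X using that by (simp add: closed_linear_span_def)
  have VD: "\<exists>S c. finite S \<and> ip M (\<lambda>x. ?c S c x - X x) (\<lambda>x. ?c S c x - X x) < e" if "X \<in> ?V" "e > 0" for X e
    using that by (simp add: closed_linear_span_def)
  have zero: "(\<lambda>x. 0) \<in> ?V"
    unfolding closed_linear_span_def by (auto intro!: exI[of _ "{}"])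
  have chlc: "(CLINT x|M. iexp (?c S c x)) = exp (- (ip M (?c S c) (?c S c)) / 2)" if "finite S" for S c
  proof (rule char_centered_gaussian_rv[OF _ lcL])
    show "gaussian_rv M (?c S c)" using jg that unfolding jointly_gaussian_def by blast
    show "expectation (?c S c) = 0"
      using mean L2_integrable[OF GL] by simp
  qed
  show ?thesis
  proof
    show "X \<in> L2 M" if "X \<in> ?V" for X by (rule VL[OF that])
    show "(\<lambda>x. 0) \<in> ?V" by (rule zero)
    fix X assume X: "X \<in> ?V"
    show "(\<lambda>x. X x + Y x) \<in> ?V" if Y: "Y \<in> ?V" for Y
      unfolding closed_linear_span_def
    proof (intro CollectI conjI allI impI)
      show "(\<lambda>x. X x + Y x) \<in> L2 M" using X Y by (intro L2_add VL)
      fix e :: real assume "e > 0"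
      \<comment> \<open>A quarter each: \<open>ip_self_add_le\<close> doubles both squared
        distances.\<close>
      then have "e / 4 > 0" by simp
      from VD[OF X this] VD[OF Y this] obtain S c T d where
        S: "finite S" "ip M (\<lambda>x. ?c S c x - X x) (\<lambda>x. ?c S c x - X x) < e / 4" and
        T: "finite T" "ip M (\<lambda>x. ?c T d x - Y x) (\<lambda>x. ?c T d x - Y x) < e / 4" by blast
      \<comment> \<open>The supports \<open>S\<close> and \<open>T\<close> may overlap, so the
        coefficients are extended by 0 and added.\<close>
      let ?b = "\<lambda>p. (if p \<in> S then c p else 0) + (if p \<in> T then d p else 0)"
      have "?c (S \<union> T) ?b x = ?c S c x + ?c T d x" for x
      proof -
        have "?c (S \<union> T) ?b x = (\<Sum>p\<in>S \<union> T. if p \<in> S then c p * G p x else 0) + (\<Sum>p\<in>S \<union> T. if p \<in> T then d p * G p x else 0)"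
          unfolding sum.distrib[symmetric] by (intro sum.cong) (auto simp: distrib_right)
        also have "(\<Sum>p\<in>S \<union> T. if p \<in> S then c p * G p x else 0) = ?c S c x"
          using S T by (intro sum.mono_neutral_cong_right) auto
        also have "(\<Sum>p\<in>S \<union> T. if p \<in> T then d p * G p x else 0) = ?c T d x"
          using S T by (intro sum.mono_neutral_cong_right) auto
        finally show ?thesis .
      qed
      then have eq: "(\<lambda>x. ?c (S \<union> T) ?b x - (X x + Y x)) = (\<lambda>x. (?c S c x - X x) + (?c T d x - Y x))"
        by (auto simp: fun_eq_iff)
      have "ip M (\<lambda>x. ?c (S \<union> T) ?b x - (X x + Y x)) (\<lambda>x. ?c (S \<union> T) ?b x - (X x + Y x)) < e"
        unfolding eq using ip_self_add_le[OF L2_diff[OF lcL[of c S] VL[OF X]] L2_diff[OF lcL[of d T] VL[OF Y]]] S(2) T(2)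
        by linarith
      then show "\<exists>S c. finite S \<and> ip M (\<lambda>x. ?c S c x - (X x + Y x)) (\<lambda>x. ?c S c x - (X x + Y x)) < e"
        using S(1) T(1) by (intro exI[of _ "S \<union> T"] exI[of _ ?b] conjI finite_UnI)
    qed
    show "(\<lambda>x. r * X x) \<in> ?V" for r
    proof (cases "r = 0")
      case False
      show ?thesis unfolding closed_linear_span_def
      proof (intro CollectI conjI allI impI)
        show "(\<lambda>x. r * X x) \<in> L2 M" using X by (intro L2_cmult VL)
        fix e :: real assume "e > 0"
        then have "e / r\<^sup>2 > 0" using False by simp
        from VD[OF X this] obtain S c where S: "finite S" "ip M (\<lambda>x. ?c S c x - X x) (\<lambda>x. ?c S c x - X x) < e / r\<^sup>2" by blast
        have eq: "(\<lambda>x. ?c S (\<lambda>p. r * c p) x - r * X x) = (\<lambda>x. r * (?c S c x - X x))"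
          by (auto simp: fun_eq_iff right_diff_distrib sum_distrib_left mult.assoc)
        have "ip M (\<lambda>x. ?c S (\<lambda>p. r * c p) x - r * X x) (\<lambda>x. ?c S (\<lambda>p. r * c p) x - r * X x) < e"
        proof -
          define k where "k = ip M (\<lambda>x. ?c S c x - X x) (\<lambda>x. ?c S c x - X x)"
          have "0 < r\<^sup>2" using False by simp
          moreover have "k < e / r\<^sup>2" unfolding k_def by (rule S(2))
          ultimately have "k * r\<^sup>2 < e" by (simp only: pos_less_divide_eq)
          then have "r * (r * k) < e" by (simp add: power2_eq_square mult_ac)
          then show ?thesis unfolding eq k_def by (simp only: ip_cmult_left ip_cmult_right)
        qed
        then show "\<exists>S c. finite S \<and> ip M (\<lambda>x. ?c S c x - r * X x) (\<lambda>x. ?c S c x - r * X x) < e"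
          using S(1) by (intro exI[of _ S] exI[of _ "\<lambda>p. r * c p"] conjI)
      qed
    qed (simp add: zero)
  next
    fix X assume X: "X \<in> L2 M" and ap: "\<And>e. e > 0 \<Longrightarrow> \<exists>Y\<in>?V. ip M (\<lambda>x. Y x - X x) (\<lambda>x. Y x - X x) < e"
    show "X \<in> ?V" unfolding closed_linear_span_def
    proof (intro CollectI conjI allI impI X)
      fix e :: real assume "e > 0"
      then have e: "e / 4 > 0" by simp
      from ap[OF e] obtain Y where Y: "Y \<in> ?V" "ip M (\<lambda>x. Y x - X x) (\<lambda>x. Y x - X x) < e / 4" by blast
      from VD[OF Y(1) e] obtain S c where S: "finite S" "ip M (\<lambda>x. ?c S c x - Y x) (\<lambda>x. ?c S c x - Y x) < e / 4" by blast
      have "(\<lambda>x. ?c S c x - X x) = (\<lambda>x. (?c S c x - Y x) + (Y x - X x))" by (auto simp: fun_eq_iff)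
      then have "ip M (\<lambda>x. ?c S c x - X x) (\<lambda>x. ?c S c x - X x) < e"
        using ip_self_add_le[OF L2_diff[OF lcL[of c S] VL[OF Y(1)]] L2_diff[OF VL[OF Y(1)] X]] S(2) Y(2) by simp
      then show "\<exists>S c. finite S \<and> ip M (\<lambda>x. ?c S c x - X x) (\<lambda>x. ?c S c x - X x) < e"
        using S(1) by (intro exI[of _ S] exI[of _ c] conjI)
    qed
  next
    fix X assume X: "X \<in> ?V"
    have "\<forall>n::nat. \<exists>S c. finite S \<and> ip M (\<lambda>x. ?c S c x - X x) (\<lambda>x. ?c S c x - X x) < 1 / (real n + 1)"
      using VD[OF X] by simp
    from choice[OF this] obtain S where
      "\<forall>n. \<exists>c. finite (S n) \<and> ip M (\<lambda>x. ?c (S n) c x - X x) (\<lambda>x. ?c (S n) c x - X x) < 1 / (real n + 1)"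
      by (rule exE)
    from choice[OF this] obtain c where
      c: "\<forall>n. finite (S n) \<and> ip M (\<lambda>x. ?c (S n) (c n) x - X x) (\<lambda>x. ?c (S n) (c n) x - X x) < 1 / (real n + 1)"
      by (rule exE)
    have S: "finite (S n)"
      and close: "ip M (\<lambda>x. ?c (S n) (c n) x - X x) (\<lambda>x. ?c (S n) (c n) x - X x) < 1 / (real n + 1)" for n
      using c by simp_all
    define Y where "Y n = ?c (S n) (c n)" for n
    have YL: "Y n \<in> L2 M" for n unfolding Y_def by (rule lcL)
    have XL: "X \<in> L2 M" by (rule VL[OF X])
    have [measurable]: "X \<in> borel_measurable M" "Y n \<in> borel_measurable M" for n
      using XL YL by (auto simp: L2_def)
    have lim: "(\<lambda>n. ip M (\<lambda>x. Y n x - X x) (\<lambda>x. Y n x - X x)) \<longlonglongrightarrow> 0"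
    proof (rule tendsto_sandwich[of "\<lambda>_. 0" _ _ "\<lambda>n. 1 / (real n + 1)"])
      show "(\<lambda>n. 1 / (real n + 1)) \<longlonglongrightarrow> 0" using LIMSEQ_inverse_real_of_nat by (simp add: inverse_eq_divide add.commute)
    qed (use close in \<open>auto simp: Y_def intro!: always_eventually less_imp_le\<close>)
    have "ip M (Y n) (Y n) = ip M (\<lambda>x. Y n x - X x) (\<lambda>x. Y n x - X x) + 2 * ip M (Y n) X - ip M X X" for n
      using YL[of n] XL by (simp add: ip_diff_left ip_diff_right L2_diff ip_commute[of M X "Y n"])
    then have "(\<lambda>n. ip M (Y n) (Y n)) \<longlonglongrightarrow> 0 + 2 * ip M X X - ip M X X"
      by (simp only:) (intro tendsto_intros lim ip_tendsto[OF YL XL XL lim])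
    then have "(\<lambda>n. exp (- (ip M (Y n) (Y n)) / 2)) \<longlonglongrightarrow> exp (- (ip M X X) / 2)"
      by (intro tendsto_intros) auto
    then have "(\<lambda>n. complex_of_real (exp (- (ip M (Y n) (Y n)) / 2))) \<longlonglongrightarrow> complex_of_real (exp (- (ip M X X) / 2))"
      by (rule tendsto_of_real)
    then have 1: "(\<lambda>n. CLINT x|M. iexp (Y n x)) \<longlonglongrightarrow> complex_of_real (exp (- (ip M X X) / 2))"
      using chlc[OF S] by (simp add: Y_def exp_of_real)
    have "(\<lambda>n. (CLINT x|M. iexp (Y n x)) - (CLINT x|M. iexp (X x))) \<longlonglongrightarrow> 0"
    proof (rule Lim_null_comparison)
      show "(\<lambda>n. sqrt (ip M (\<lambda>x. Y n x - X x) (\<lambda>x. Y n x - X x))) \<longlonglongrightarrow> 0"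
        using tendsto_real_sqrt[OF lim] by simp
      have "norm ((CLINT x|M. iexp (Y n x)) - (CLINT x|M. iexp (X x))) \<le> sqrt (ip M (\<lambda>x. Y n x - X x) (\<lambda>x. Y n x - X x))" for n
      proof -
        let ?D = "\<lambda>x. \<bar>Y n x - X x\<bar>"
        have DL: "?D \<in> L2 M" using L2_diff[OF YL[of n] XL] by (auto simp: L2_def)
        have "(CLINT x|M. iexp (Y n x)) - (CLINT x|M. iexp (X x)) = (CLINT x|M. iexp (Y n x) - iexp (X x))"
          by (intro Bochner_Integration.integral_diff[symmetric] integrable_iexp) auto
        also have "norm \<dots> \<le> expectation (\<lambda>x. norm (iexp (Y n x) - iexp (X x)))" by (rule integral_norm_bound)
        also have "\<dots> \<le> expectation ?D"
          by (intro integral_mono norm_iexp_diff_le L2_integrable DL integrable_norm Bochner_Integration.integrable_diff integrable_iexp) auto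
        also have "\<dots> \<le> sqrt (ip M (\<lambda>x. Y n x - X x) (\<lambda>x. Y n x - X x))"
        proof (rule real_le_rsqrt)
          \<comment> \<open>Against the constant 1, of norm 1 on a probability space: the first
            absolute moment is bounded by the root of the second.\<close>
          have "(ip M ?D (\<lambda>x. 1))\<^sup>2 \<le> ip M ?D ?D * ip M (\<lambda>x. 1) (\<lambda>x. 1)"
            by (rule ip_Cauchy_Schwarz[OF DL]) (auto simp: L2_def)
          then show "(expectation ?D)\<^sup>2 \<le> ip M (\<lambda>x. Y n x - X x) (\<lambda>x. Y n x - X x)"
            by (simp add: ip_def prob_space)
        qed
        finally show ?thesis .
      qed
      then show "\<forall>\<^sub>F n in sequentially. norm ((CLINT x|M. iexp (Y n x)) - (CLINT x|M. iexp (X x))) \<le> sqrt (ip M (\<lambda>x. Y n x - X x) (\<lambda>x. Y n x - X x))"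
        by simp
    qed
    then have 2: "(\<lambda>n. CLINT x|M. iexp (Y n x)) \<longlonglongrightarrow> (CLINT x|M. iexp (X x))" by (rule LIM_zero_cancel)
    from LIMSEQ_unique[OF 2 1] show "(CLINT x|M. iexp (X x)) = exp (- (ip M X X) / 2)" by (simp add: exp_of_real)
  qed
qed

theorem theorem1p1:
  fixes M :: "'a measure"
    and g :: "'n::finite \<Rightarrow> nat \<Rightarrow> 'a \<Rightarrow> real"
    and lam :: "'n \<Rightarrow> nat \<Rightarrow> real"
  assumes "prob_space M"
    and "jointly_gaussian M (\<lambda>(i, j). g i j)"
    and "\<And>i j. distributed M lborel (g i j) (normal_density 0 1)"
    and "\<And>i j j'. j \<noteq> j' \<Longrightarrow>
           prob_space.expectation M (\<lambda>x. g i j x * g i j' x) = 0"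
    and "\<And>i. summable (\<lambda>j. (lam i j)\<^sup>2)"
    and "\<not> absolutely_continuous lborel
           (distr M lborel (\<lambda>x. \<chi> i. (\<Sum>j. lam i j * ((g i j x)\<^sup>2 - 1))))"
  shows "\<exists>(\<eta> :: nat \<Rightarrow> 'a \<Rightarrow> real) (a :: 'n \<Rightarrow> real) (b :: nat \<Rightarrow> real).
           (\<forall>m < CARD('n) - 1. distributed M lborel (\<eta> m) (normal_density 0 1)) \<and>
           prob_space.indep_vars M (\<lambda>_. borel) \<eta> {..< CARD('n) - 1} \<and>
           a \<noteq> (\<lambda>_. 0) \<and>
           (AE x in M. (\<Sum>i\<in>UNIV. a i * (\<Sum>j. lam i j * ((g i j x)\<^sup>2 - 1))) =
                       (\<Sum>m < CARD('n) - 1. b m * ((\<eta> m x)\<^sup>2 - 1)))"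
proof -
  interpret prob_space M by (rule assms(1))
  let ?G = "\<lambda>(i, j). g i j"
  have gm: "g i j \<in> borel_measurable M" for i j using distributed_measurable[OF assms(3)] by simp
  have sq: "has_bochner_integral lborel (\<lambda>x. std_normal_density x * x\<^sup>2) 1"
    using std_normal_moment_even[of 1] by simp
  have gL: "g i j \<in> L2 M" for i j
    unfolding L2_def using gm distributed_integrable[OF assms(3)[of i j], of "\<lambda>x. x\<^sup>2"] sq
    by (auto simp: normal_density_nonneg has_bochner_integral_iff)
  have g1: "ip M (g i j) (g i j) = 1" for i j
    unfolding ip_def using distributed_integral[OF assms(3)[of i j], of "\<lambda>x. x\<^sup>2"] sq
    by (auto simp: normal_density_nonneg has_bochner_integral_iff power2_eq_square)
  have mean: "expectation (\<lambda>x. g i j x) = 0" for i j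
    using distributed_integral[OF assms(3)[of i j], of "\<lambda>x. x"] integral_normal_moment_nz_1[of 1 0]
    by (simp add: normal_density_nonneg)
  \<comment> \<open>The span is taken over all pairs \<open>(i, j)\<close> at once, so that every
    \<open>F i\<close> lives over the same Gaussian space; joint Gaussianity of the whole family is
    what makes this possible.\<close>
  have GS: "gaussian_space M (closed_linear_span M ?G)"
    using assms(2) gL mean by (intro gaussian_space_closed_linear_span) (auto split: prod.split)
  interpret gaussian_quadratic_forms M "closed_linear_span M ?G" g lam
  proof (intro gaussian_quadratic_forms.intro GS gaussian_quadratic_forms_axioms.intro)
    fix i j j'
    show "g i j \<in> closed_linear_span M ?G"
      unfolding closed_linear_span_def using gL
      by (auto intro!: exI[of _ "{(i, j)}"] exI[of _ "\<lambda>_. 1"])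
    show "ip M (g i j) (g i j') = (if j = j' then 1 else 0)"
      using g1 assms(4)[of j j' i] by (auto simp: ip_def)
    show "summable (\<lambda>j. (lam i j)\<^sup>2)" by (rule assms(5))
  qed
  have "\<not> absolutely_continuous lborel (distr M lborel (\<lambda>x. \<chi> i. F i x))"
    unfolding F_def by (rule assms(6))
  from not_absolutely_continuous_imp_combination[OF this] obtain \<eta> :: "nat \<Rightarrow> 'a \<Rightarrow> real" and a :: "real^'n" and b :: "nat \<Rightarrow> real" where
    "\<forall>m < CARD('n) - 1. distributed M lborel (\<eta> m) (normal_density 0 1)"
    "indep_vars (\<lambda>_. borel) \<eta> {..< CARD('n) - 1}" "a \<noteq> 0"
    "AE x in M. (\<Sum>i\<in>UNIV. a $ i * F i x) = (\<Sum>m < CARD('n) - 1. b m * ((\<eta> m x)\<^sup>2 - 1))"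
    by blast
  then show ?thesis
    by (intro exI[of _ \<eta>] exI[of _ "\<lambda>i. a $ i"] exI[of _ b]) (auto simp: F_def fun_eq_iff vec_eq_iff)
qed

end
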